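(* Let $N\ge1$. Let $\omega:[0,\infty)\to[0,\infty)$ be a non-decreasing and concave function such that $\lim_{x\to0}\omega(x)=0$, and assume that $F:\mathbb{T}^N\times\mathbb{R}^N\to\mathbb{C}$ is continuous and verifies $$|F(\boldsymbol{\theta},\boldsymbol{s})-F(\boldsymbol{\theta},\boldsymbol{0})|\le\omega(|\boldsymbol{s}|)\quad\text{for all }(\boldsymbol{\theta},\boldsymbol{s})\in\mathbb{T}^N\times\mathbb{R}^N.$$ Let $H:(0,\infty)\to(0,\infty)$ be a non-decreasing function such that $\lim_{x\to\infty}H(x)=\infty$ and $H(x)/\sqrt{x}$ is non-increasing. Then, for any $\boldsymbol{\xi}\in(\overline{\mathbb{Q}}^{\times})^N$, we have $$\mathcal{E}(F,\boldsymbol{\xi})\le\omega\big(2h(\boldsymbol{\xi})\big)+\frac{C_2(F,H)}{H\big((24\,h_{\mathcal{D}}(\boldsymbol{\xi}))^{-1}\big)},$$ where $$C_2(F,H):=\sum_{\boldsymbol{n}\in\mathbb{Z}^N\setminus\{\boldsymbol{0}\}}\big|\widehat{F_{\boldsymbol{0}}}(\boldsymbol{n})\big|\,H(\|\boldsymbol{n}\|_1).$$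
   Context: Fix $\overline{\mathbb{Q}}\subset\mathbb{C}$, the algebraic closure of $\mathbb{Q}$; $\overline{\mathbb{Q}}^\times$, $\mathbb{C}^\times$ are the multiplicative groups. Heights. For $\xi\in\overline{\mathbb{Q}}$ let $P_\xi(x)=c_d\prod_{j=1}^d(x-\alpha_j)\in\mathbb{Z}[x]$ be its minimal polynomial (primitive, with integer coefficients), $d=\deg(\xi)=[\mathbb{Q}(\xi):\mathbb{Q}]$. Its Weil height is $h(\xi)=\frac1d\big(\log|c_d|+\sum_{j=1}^d\log^+|\alpha_j|\big)$, where $\log^+x=\max\{0,\log x\}$ (and $\log^+0=0$). For $\boldsymbol{\xi}=(\xi_1,\dots,\xi_N)\in(\overline{\mathbb{Q}}^\times)^N$, $h(\boldsymbol{\xi}):=h(\xi_1)+\dots+h(\xi_N)$. For $\boldsymbol{n}\in\mathbb{Z}^N$, $\chi^{\boldsymbol{n}}(\boldsymbol{\xi}):=\xi_1^{n_1}\cdots\xi_N^{n_N}$. The generalized degree is $\mathcal{D}(\boldsymbol{\xi}):=\min_{\boldsymbol{n}\in\mathbb{Z}^N\setminus\{\boldsymbol{0}\}}\{\|\boldsymbol{n}\|_1\deg(\chi^{\boldsymbol{n}}(\boldsymbol{\xi}))\}$, and $h_{\mathcal{D}}(\boldsymbol{\xi}):=h(\boldsymbol{\xi})+\frac{\log(2\mathcal{D}(\boldsymbol{\xi}))}{3\mathcal{D}(\boldsymbol{\xi})}$. Here $\|\boldsymbol{n}\|_1=\sum_j|n_j|$ and $|\boldsymbol{s}|$ is the Euclidean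 norm. Equidistribution error. Let $\mathbb{T}=\mathbb{R}/\mathbb{Z}$. The space $\mathbb{T}^N\times\mathbb{R}^N$ is identified with $(\mathbb{C}^\times)^N$ via $(\boldsymbol{\theta},\boldsymbol{s})\mapsto(e^{2\pi i\theta_1+s_1},\dots,e^{2\pi i\theta_N+s_N})$, and test functions are viewed as functions $F(\boldsymbol{\theta},\boldsymbol{s})$ on $\mathbb{T}^N\times\mathbb{R}^N$. Let $S=\{(\sigma\xi_1,\dots,\sigma\xi_N):\sigma\in\mathrm{Gal}(\overline{\mathbb{Q}}/\mathbb{Q})\}$ be the (finite) Galois orbit of $\boldsymbol{\xi}$. For $\boldsymbol{\alpha}\in S$ let $(\boldsymbol{\theta}(\boldsymbol{\alpha}),\boldsymbol{s}(\boldsymbol{\alpha}))$ be the corresponding point of $\mathbb{T}^N\times\mathbb{R}^N$, i.e. $\boldsymbol{\theta}(\boldsymbol{\alpha})=(\arg(\alpha_j)/2\pi)_j$, $\boldsymbol{s}(\boldsymbol{\alpha})=(\log|\alpha_j|)_j$. Then $$\mathcal{E}(F,\boldsymbol{\xi}):=\Big|\frac1{|S|}\sum_{\boldsymbol{\alpha}\in S}F(\boldsymbol{\theta}(\boldsymbol{\alpha}),\boldsymbol{s}(\boldsymbol{\alpha}))-\int_{\mathbb{T}^N}F(\boldsymbol{\theta},\boldsymbol{0})\,d\boldsymbol{\theta}\Big|,$$ that is, the absolute difference of the integrals of $F$ against the uniform probability measure on $S$ and the Haar probability measure on the unit polycircle $(\mathbb{S}^1)^N$. Fourier coefficients. $F_{\boldsymbol{0}}(\boldsymbol{\theta}):=F(\boldsymbol{\theta},\boldsymbol{0})$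 and $\widehat{F_{\boldsymbol{0}}}(\boldsymbol{n})=\int_{\mathbb{T}^N}F_{\boldsymbol{0}}(\boldsymbol{\theta})e^{-2\pi i\boldsymbol{n}\cdot\boldsymbol{\theta}}\,d\boldsymbol{\theta}$ for $\boldsymbol{n}\in\mathbb{Z}^N$. Convention. If $C_2(F,H)=\infty$ the right-hand side is $+\infty$ and the estimate is trivially true. *)

theory Defs
  imports "HOL-Analysis.Analysis"
begin

definition is_min_int_poly :: "complex \<Rightarrow> int poly \<Rightarrow> bool" where
  "is_min_int_poly x p \<longleftrightarrow>
     p \<noteq> 0 \<and> poly (map_poly of_int p) x = 0 \<and>
     (\<forall>q :: int poly. q \<noteq> 0 \<longrightarrow> poly (map_poly of_int q) x = 0 \<longrightarrow> degree p \<le> degree q) \<and>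
     Polynomial.content p = 1 \<and> lead_coeff p > 0"

text \<open>The sign of the primitive minimal polynomial is normalised by a positive leading coefficient.\<close>

definition min_int_poly :: "complex \<Rightarrow> int poly" where
  "min_int_poly x = (THE p. is_min_int_poly x p)"

lemma ex1_is_min_int_poly:
  assumes "algebraic x"
  shows "\<exists>!p. is_min_int_poly x p"
proof -
  define R where "R = (\<lambda>p :: int poly. p \<noteq> 0 \<and> poly (map_poly of_int p) x = 0)"
  obtain p0 where "R p0"
    using algebraicE'[OF assms] unfolding R_def by metis
  then obtain p where p: "R p" and p_min: "\<And>q. R q \<Longrightarrow> degree p \<le> degree q"
    using ex_has_least_nat[of R p0 degree] by blast
  define q where "q = smult (sgn (lead_coeff p)) (primitive_part p)"
  have pp: "p \<noteq> 0" "primitive_part p \<noteq> 0" "Polynomial.content p \<noteq> 0"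
    using p by (auto simp: R_def)
  have "lead_coeff p = Polynomial.content p * lead_coeff (primitive_part p)"
    using lead_coeff_smult[of "Polynomial.content p" "primitive_part p"] by simp
  moreover have "Polynomial.content p > 0"
    using pp(3) normalize_content[of p] by (simp only: normalize_int_def)
  ultimately have sgn_eq: "sgn (lead_coeff p) = sgn (lead_coeff (primitive_part p))"
    by (simp add: sgn_mult)
  have smult_root: "poly (map_poly of_int (smult c r)) x = of_int c * poly (map_poly of_int r) x"
    for c and r :: "int poly"
    by (simp add: map_poly_smult)
  have "poly (map_poly of_int (smult (Polynomial.content p) (primitive_part p))) x = 0"
    using p by (simp add: R_def)
  then have root: "poly (map_poly of_int (primitive_part p)) x = 0"
    unfolding smult_root using pp by simp
  have sgn_nz: "sgn (lead_coeff p) \<noteq> 0"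
    using pp by (simp add: sgn_0_0)
  have "is_min_int_poly x q"
    unfolding is_min_int_poly_def
  proof (intro conjI allI impI)
    show "q \<noteq> 0" using sgn_nz pp by (simp add: q_def)
    show "poly (map_poly of_int q) x = 0"
      unfolding q_def smult_root using root by simp
    show "degree q \<le> degree r" if "r \<noteq> 0" "poly (map_poly of_int r) x = 0" for r
      using p_min[of r] that sgn_nz by (simp add: q_def R_def)
    show "Polynomial.content q = 1"
      using pp sgn_nz by (simp add: q_def sgn_if)
    show "lead_coeff q > 0"
    proof -
      have "lead_coeff (primitive_part p) \<noteq> 0"
        using pp by (simp only: leading_coeff_0_iff) simp
      then have "\<bar>lead_coeff (primitive_part p)\<bar> > 0"
        by (simp only: zero_less_abs_iff) simp
      then show ?thesis
        unfolding q_def sgn_eq lead_coeff_smult by (simp only: mult.commute[of "sgn _"] abs_sgn[symmetric])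
    qed
  qed
  moreover have "r = s" if r: "is_min_int_poly x r" and s: "is_min_int_poly x s" for r s
  proof -
    have rs: "r \<noteq> 0" "s \<noteq> 0" "lead_coeff r > 0" "lead_coeff s > 0"
      "Polynomial.content r = 1" "Polynomial.content s = 1"
      "poly (map_poly of_int r) x = 0" "poly (map_poly of_int s) x = 0"
      using r s by (auto simp: is_min_int_poly_def)
    have deg: "degree r = degree s"
      using r s by (intro antisym) (auto simp: is_min_int_poly_def)
    define t where "t = smult (lead_coeff s) r - smult (lead_coeff r) s"
    have "t = 0"
    proof (rule ccontr)
      assume "t \<noteq> 0"
      have "degree t \<le> degree r"
        unfolding t_def by (rule degree_diff_le) (auto simp: deg)
      moreover have "coeff t (degree r) = 0"
        by (simp add: t_def deg)
      ultimately have "degree t < degree r"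
        using \<open>t \<noteq> 0\<close> leading_coeff_0_iff[of t] by (cases "degree t = degree r") (simp, linarith)
      moreover have "map_poly of_int t =
          (map_poly of_int (smult (lead_coeff s) r) :: complex poly)
          - map_poly of_int (smult (lead_coeff r) s)"
        unfolding t_def by (intro poly_eqI) (simp add: coeff_map_poly)
      then have "poly (map_poly of_int t) x = 0"
        using rs by (simp only: poly_diff smult_root) simp
      ultimately show False
        using r \<open>t \<noteq> 0\<close> by (auto simp: is_min_int_poly_def)
    qed
    then have eq: "smult (lead_coeff s) r = smult (lead_coeff r) s"
      by (simp add: t_def)
    then have "Polynomial.content (smult (lead_coeff s) r) = Polynomial.content (smult (lead_coeff r) s)"
      by simp
    then have "lead_coeff s = lead_coeff r"
      using rs by simp
    then show "r = s"
      using eq rs(3) by (auto simp: poly_eq_iff)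
  qed
  ultimately show ?thesis by blast
qed

definition alg_degree :: "complex \<Rightarrow> nat" where
  "alg_degree x = degree (min_int_poly x)"

definition log_plus :: "real \<Rightarrow> real" where
  "log_plus x = max 0 (ln x)"

text \<open>\<^term>\<open>proots\<close> counts roots with multiplicity; also \<^prop>\<open>ln (0::real) = 0\<close>, so
  \<^prop>\<open>log_plus 0 = 0\<close>.\<close>

definition weil_height :: "complex \<Rightarrow> real" where
  "weil_height x =
     (ln \<bar>of_int (lead_coeff (min_int_poly x))\<bar>
       + (\<Sum>\<alpha>\<in>#proots (map_poly of_int (min_int_poly x)). log_plus (cmod \<alpha>)))
     / real (alg_degree x)"

definition height :: "complex ^ 'n \<Rightarrow> real" where
  "height \<xi> = (\<Sum>j\<in>UNIV. weil_height (\<xi> $ j))"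

definition monomial_char :: "int ^ 'n \<Rightarrow> complex ^ 'n \<Rightarrow> complex" where
  "monomial_char n \<xi> = (\<Prod>j\<in>UNIV. (\<xi> $ j) powi (n $ j))"

definition l1_norm :: "int ^ 'n \<Rightarrow> nat" where
  "l1_norm n = (\<Sum>j\<in>UNIV. nat \<bar>n $ j\<bar>)"

text \<open>An infimum in \<^typ>\<open>nat\<close> over a nonempty set, hence a minimum.\<close>

definition generalized_degree :: "complex ^ 'n \<Rightarrow> nat" where
  "generalized_degree \<xi> = (INF n \<in> - {0}. l1_norm n * alg_degree (monomial_char n \<xi>))"

definition height_D :: "complex ^ 'n \<Rightarrow> real" where
  "height_D \<xi> = height \<xi>
     + ln (2 * real (generalized_degree \<xi>)) / (3 * real (generalized_degree \<xi>))"

text \<open>Elements of the absolute Galois group are represented by functions on \<^typ>\<open>complex\<close> whose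
  values outside the algebraic numbers are irrelevant.\<close>

definition absolute_galois :: "(complex \<Rightarrow> complex) set" where
  "absolute_galois = {\<sigma>. bij_betw \<sigma> {x. algebraic x} {x. algebraic x} \<and>
     (\<forall>x y. algebraic x \<longrightarrow> algebraic y \<longrightarrow>
        \<sigma> (x + y) = \<sigma> x + \<sigma> y \<and> \<sigma> (x * y) = \<sigma> x * \<sigma> y) \<and>
     (\<forall>q\<in>\<rat>. \<sigma> q = q)}"

definition galois_orbit :: "complex ^ 'n \<Rightarrow> (complex ^ 'n) set" where
  "galois_orbit \<xi> = (\<lambda>\<sigma>. \<chi> j. \<sigma> (\<xi> $ j)) ` absolute_galois"

text \<open>A function on the torus \<open>(\<real> / \<int>)\<^sup>N\<close> is represented by a function on
  \<open>\<real>\<^sup>N\<close> that is periodic under integer translations; its continuity is that of the periodic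
  lift, and its Haar integral is the Lebesgue integral over the unit cube.\<close>

definition torus_periodic :: "(real ^ 'n \<Rightarrow> 'b) \<Rightarrow> bool" where
  "torus_periodic f \<longleftrightarrow> (\<forall>\<theta> (k :: int ^ 'n). f (\<theta> + (\<chi> j. of_int (k $ j))) = f \<theta>)"

definition torus_integral :: "(real ^ 'n \<Rightarrow> complex) \<Rightarrow> complex" where
  "torus_integral f = (LINT \<theta>:cbox 0 1|lborel. f \<theta>)"

definition angular_part :: "complex ^ 'n \<Rightarrow> real ^ 'n" where
  "angular_part \<alpha> = (\<chi> j. Arg (\<alpha> $ j) / (2 * pi))"

definition radial_part :: "complex ^ 'n \<Rightarrow> real ^ 'n" where
  "radial_part \<alpha> = (\<chi> j. ln (cmod (\<alpha> $ j)))"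

definition equidist_error ::
    "(real ^ 'n \<Rightarrow> real ^ 'n \<Rightarrow> complex) \<Rightarrow> complex ^ 'n \<Rightarrow> real" where
  "equidist_error F \<xi> =
     cmod ((\<Sum>\<alpha>\<in>galois_orbit \<xi>. F (angular_part \<alpha>) (radial_part \<alpha>))
             / of_nat (card (galois_orbit \<xi>))
           - torus_integral (\<lambda>\<theta>. F \<theta> 0))"

definition torus_fourier :: "(real ^ 'n \<Rightarrow> complex) \<Rightarrow> int ^ 'n \<Rightarrow> complex" where
  "torus_fourier f n =
     torus_integral (\<lambda>\<theta>. f \<theta> *
       exp (- 2 * of_real pi * \<i> * of_real (\<Sum>j\<in>UNIV. of_int (n $ j) * \<theta> $ j)))"

text \<open>The sum is taken in \<^typ>\<open>ennreal\<close>, so it is \<open>\<infinity>\<close> when the series diverges.\<close>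

definition C2_const ::
    "(real ^ 'n \<Rightarrow> real ^ 'n \<Rightarrow> complex) \<Rightarrow> (real \<Rightarrow> real) \<Rightarrow> ennreal" where
  "C2_const F H =
     (\<Sum>\<^sub>\<infinity>n\<in>- {0}. ennreal (cmod (torus_fourier (\<lambda>\<theta>. F \<theta> 0) n) * H (real (l1_norm n))))"

end

theory Submission
  imports Defs "HOL-Computational_Algebra.Fundamental_Theorem_Algebra"
begin

text \<open>
  The error has a radial and an angular part. Replacing \<open>F(\<theta>, s)\<close> by \<open>F(\<theta>, 0)\<close> costs at most the
  average of \<open>\<omega>(|s(\<alpha>)|)\<close> over the orbit. By concavity this is at most \<open>\<omega>\<close> of the average of
  \<open>|s(\<alpha>)|\<close>, and the average of \<open>|log|x||\<close> over the conjugates \<open>x\<close> of one coordinate is at most twice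
  its height, because the positive and the negative part are both bounded by the height
  (\<open>average_radial_modulus\<close>).

  For the angular part, \<open>F(\<theta>, 0)\<close> equals its Fourier series whenever \<open>C\<^sub>2(F, H)\<close> is finite
  (\<open>fourier_inversion\<close>), and the average of the \<open>n\<close>-th character over the orbit is the
  average of \<open>\<gamma>/|\<gamma>|\<close> over the conjugates of \<open>\<gamma> = \<chi>\<^sup>n(\<xi>)\<close>. The theorem
  reduces to bounding this average by the square root of \<open>24 \<parallel>n\<parallel>\<^sub>1 h\<^sub>D(\<xi>)\<close>
  (\<open>character_sum_bound\<close>): the monotonicity of \<open>H\<close> and of \<open>H(x) / sqrt x\<close> turns the minimum of 1 and
  this root into \<open>H(\<parallel>n\<parallel>\<^sub>1) / H(1 / (24 h\<^sub>D(\<xi>)))\<close>.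

  The average is controlled by logarithmic energy (\<open>unit_vector_sum_bound\<close>). Up to normalisation
  by absolute values, \<open>- log|x - y|\<close> is the sum over \<open>k \<ge> 1\<close> of the positive semidefinite kernels
  \<open>\<rho>\<^sup>k cos(k \<phi>) / k\<close>, where \<open>\<rho> \<le> 1\<close> is the ratio of the absolute values and \<open>\<phi>\<close> the
  angle between \<open>x\<close> and \<open>y\<close>. So the mode \<open>k = 1\<close>, which is the square of the exponential sum up to
  an error from the radii, is at most the total energy. The energy is bounded above
  because the product of all differences of distinct conjugates of \<open>\<gamma>\<close> is a nonzero rational number with
  controlled denominator (\<open>discriminant_lower_bound\<close>); a regularisation at scale \<open>1/d\<close> removes the
  singularity on the diagonal and costs a term of order \<open>log(2d)/d\<close>, where \<open>d\<close> is the degree of \<open>\<gamma>\<close>.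

  The denominator is bounded directly by the leading and constant coefficients of the minimal
  polynomials of the \<open>\<xi>\<^sub>j\<close>. This yields the inequality in terms of the heights of the \<open>\<xi>\<^sub>j\<close> and
  takes the place of the height inequality for products. The bound is proved one prime at a
  time, in a valuation ring of \<open>\<complex>\<close> above the prime, where each algebraic number is integral or has
  an integral inverse (\<open>difference_product_in_valuation_ring\<close>). The rationality of the product and the
  passage from orbit averages to averages over conjugates rest on the transitivity of the
  Galois group on conjugates (\<open>galois_transitive\<close>).
\<close>

section \<open>Valuation rings of the complex numbers\<close>

definition subring :: "complex set \<Rightarrow> bool" where
  "subring R \<longleftrightarrow> 1 \<in> R \<and> (\<forall>x\<in>R. \<forall>y\<in>R. x - y \<in> R \<and> x * y \<in> R)"

definition poly_over :: "complex set \<Rightarrow> complex poly \<Rightarrow> bool" where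
  "poly_over R f \<longleftrightarrow> (\<forall>i. coeff f i \<in> R)"

context
  fixes R :: "complex set"
  assumes R: "subring R"
begin

lemma subring_one: "1 \<in> R" and
  subring_diff: "x \<in> R \<Longrightarrow> y \<in> R \<Longrightarrow> x - y \<in> R" and
  subring_mult: "x \<in> R \<Longrightarrow> y \<in> R \<Longrightarrow> x * y \<in> R"
  using R by (auto simp: subring_def)

lemma subring_zero: "0 \<in> R"
  using subring_diff[OF subring_one subring_one] by simp

lemma subring_uminus: "x \<in> R \<Longrightarrow> - x \<in> R"
  using subring_diff[OF subring_zero] by simp

lemma subring_add: "x \<in> R \<Longrightarrow> y \<in> R \<Longrightarrow> x + y \<in> R"
  using subring_diff[of x "- y"] subring_uminus by simp

lemma subring_sum: "(\<And>i. i \<in> I \<Longrightarrow> f i \<in> R) \<Longrightarrow> sum f I \<in> R"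
  by (induction I rule: infinite_finite_induct)
    (auto simp: subring_zero subring_add)

lemma subring_prod: "(\<And>i. i \<in> I \<Longrightarrow> f i \<in> R) \<Longrightarrow> prod f I \<in> R"
  by (induction I rule: infinite_finite_induct)
    (auto simp: subring_one subring_mult)

lemma subring_power: "x \<in> R \<Longrightarrow> x ^ n \<in> R"
  by (induction n) (auto simp: subring_one subring_mult)

lemma subring_of_nat: "of_nat n \<in> R"
  by (induction n) (auto simp: subring_zero subring_one subring_add)

lemma subring_of_int: "of_int n \<in> R"
  by (cases n) (auto simp: subring_of_nat subring_uminus
      subring_diff subring_one simp del: of_nat_Suc of_nat_add)

lemma poly_over_add: "poly_over R f \<Longrightarrow> poly_over R g \<Longrightarrow> poly_over R (f + g)"
  by (auto simp: poly_over_def subring_add)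

lemma poly_over_diff: "poly_over R f \<Longrightarrow> poly_over R g \<Longrightarrow> poly_over R (f - g)"
  by (auto simp: poly_over_def subring_diff)

lemma poly_over_mult: "poly_over R f \<Longrightarrow> poly_over R g \<Longrightarrow> poly_over R (f * g)"
  by (auto simp: poly_over_def coeff_mult intro!: subring_sum subring_mult)

lemma poly_over_smult: "c \<in> R \<Longrightarrow> poly_over R f \<Longrightarrow> poly_over R (smult c f)"
  by (auto simp: poly_over_def subring_mult)

lemma poly_over_pCons: "c \<in> R \<Longrightarrow> poly_over R f \<Longrightarrow> poly_over R (pCons c f)"
  by (auto simp: poly_over_def coeff_pCons split: nat.splits)

lemma poly_over_zero: "poly_over R 0"
  by (auto simp: poly_over_def subring_zero)

lemma poly_over_const: "c \<in> R \<Longrightarrow> poly_over R [:c:]"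
  by (intro poly_over_pCons poly_over_zero)

lemma subring_adjoin: "subring {poly f x | f. poly_over R f}"
  unfolding subring_def
proof (intro conjI ballI)
  show "1 \<in> {poly f x | f. poly_over R f}"
    using poly_over_const[OF subring_one] by (force intro: exI[of _ "[:1:]"])
  fix a b assume "a \<in> {poly f x | f. poly_over R f}" "b \<in> {poly f x | f. poly_over R f}"
  then obtain f g where "a = poly f x" "b = poly g x" "poly_over R f" "poly_over R g"
    by blast
  then show "a - b \<in> {poly f x | f. poly_over R f}" "a * b \<in> {poly f x | f. poly_over R f}"
    using poly_over_diff[of f g] poly_over_mult[of f g]
    by (auto intro: exI[of _ "f - g"] exI[of _ "f * g"])
qed

lemma subset_adjoin: "R \<subseteq> {poly f x | f. poly_over R f}"
  using poly_over_const by (force intro: exI[of _ "[:_:]"])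

lemma mem_adjoin: "x \<in> {poly f x | f. poly_over R f}"
  using poly_over_pCons[OF subring_zero poly_over_const[OF subring_one]]
  by (force intro: exI[of _ "[:0, 1:]"])

end

text \<open>A valuation ring with fraction field \<open>\<complex>\<close> in which \<open>p\<close> is a nonunit. Membership encodes
  the inequality \<open>v(x) \<ge> 0\<close>.\<close>

definition valuation_ring_over :: "nat \<Rightarrow> complex set \<Rightarrow> bool" where
  "valuation_ring_over p R \<longleftrightarrow>
     subring R \<and> inverse (of_nat p) \<notin> R \<and> (\<forall>x. x \<in> R \<or> inverse x \<in> R)"

text \<open>This is Chevalley's extension theorem. A subring \<open>R\<close> maximal among those that do not contain
  \<open>1 / p\<close> is a valuation ring: if it contained neither \<open>x\<close> nor \<open>1 / x\<close>, both would satisfy an equation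
  with coefficients in \<open>p R\<close> on one side and 1 on the other. The equation of larger degree
  can be shortened by means of the other one, and an equation of degree 0 says that \<open>1 / p\<close>
  lies in \<open>R\<close>.\<close>

lemma ex_valuation_ring_over:
  assumes p: "p > 1"
  shows "\<exists>R. valuation_ring_over p R"
proof -
  define \<A> where "\<A> = {R. subring R \<and> inverse (of_nat p) \<notin> R}"
  define c :: complex where "c = of_nat p"
  have c0: "c \<noteq> 0" using p by (simp add: c_def)
  have "range of_int \<in> \<A>"
  proof -
    have "subring (range of_int)"
      unfolding subring_def Ints_def[symmetric] by auto
    moreover have "inverse c \<noteq> of_int k" for k
    proof
      assume "inverse c = of_int k"
      then have "of_int (int p * k) = (1 :: complex)"
        using c0 by (simp add: c_def field_simps)
      then have "int p * k = 1"
        by (simp only: of_int_eq_1_iff)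
      then have "int p dvd 1" by (metis dvd_triv_left)
      then show False using p by simp
    qed
    ultimately show ?thesis by (auto simp: \<A>_def c_def)
  qed
  then have ne: "\<A> \<noteq> {}" by blast
  have chain: "\<Union>C \<in> \<A>" if C: "C \<noteq> {}" "subset.chain \<A> C" for C
  proof -
    have CA: "subring X \<and> inverse (of_nat p) \<notin> X" if "X \<in> C" for X
      using C that by (auto simp: subset.chain_def \<A>_def)
    have "subring (\<Union>C)"
      unfolding subring_def
    proof (intro conjI ballI)
      show "1 \<in> \<Union>C" using C(1) CA subring_one by blast
      fix x y assume "x \<in> \<Union>C" "y \<in> \<Union>C"
      then obtain X Y where XY: "X \<in> C" "Y \<in> C" "x \<in> X" "y \<in> Y" by blast
      then have "X \<subseteq> Y \<or> Y \<subseteq> X" using C(2) by (auto simp: subset.chain_def)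
      then obtain Z where Z: "Z \<in> C" "x \<in> Z" "y \<in> Z" using XY by blast
      then have "x - y \<in> Z" "x * y \<in> Z"
        using CA subring_diff subring_mult by blast+
      then show "x - y \<in> \<Union>C" "x * y \<in> \<Union>C" using Z by blast+
    qed
    then show ?thesis using CA by (auto simp: \<A>_def)
  qed
  obtain R where RA: "R \<in> \<A>" and max: "\<And>X. X \<in> \<A> \<Longrightarrow> R \<subseteq> X \<Longrightarrow> X = R"
    using subset_Zorn_nonempty[OF ne chain] by blast
  have R: "subring R" and cR: "inverse c \<notin> R"
    using RA by (auto simp: \<A>_def c_def)
  note cl = subring_one[OF R] subring_diff[OF R] subring_mult[OF R]
    subring_add[OF R] subring_power[OF R] subring_zero[OF R]
    subring_uminus[OF R] subring_sum[OF R]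
  have adjoin: "\<exists>f. poly_over R f \<and> c * poly f x = 1" if x: "x \<notin> R" for x
  proof -
    have "{poly f x | f. poly_over R f} \<notin> \<A>"
      using max[of "{poly f x | f. poly_over R f}"] subset_adjoin[OF R, of x] mem_adjoin[OF R, of x] x
      by auto
    then have "inverse c \<in> {poly f x | f. poly_over R f}"
      using subring_adjoin[OF R] by (auto simp: \<A>_def c_def)
    then obtain f where "inverse c = poly f x" "poly_over R f" by blast
    then show ?thesis using c0 by (auto simp: field_simps)
  qed
  \<comment> \<open>Elements congruent to 1 modulo \<open>c R\<close> are units, by maximality.\<close>
  have unit: "inverse (1 - c * r) \<in> R" if r: "r \<in> R" for r
  proof (rule ccontr)
    define u where "u = 1 - c * r"
    assume "inverse (1 - c * r) \<notin> R"
    then obtain f where f: "poly_over R f" "c * poly f (inverse u) = 1"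
      using adjoin[of "inverse u"] unfolding u_def by blast
    have "u \<noteq> 0"
    proof
      assume "u = 0"
      then have "inverse c = r" using c0 by (simp add: u_def field_simps)
      then show False using cR r by blast
    qed
    have uR: "u \<in> R"
      using r cl by (auto simp: u_def c_def subring_of_nat[OF R])
    define k where "k = degree f"
    have "u ^ k * poly f (inverse u) = (\<Sum>i\<le>k. coeff f i * u ^ (k - i))"
      unfolding poly_altdef k_def sum_distrib_left
    proof (intro sum.cong refl)
      fix i assume "i \<in> {..degree f}"
      then have "u ^ degree f = u ^ (degree f - i) * u ^ i"
        by (simp flip: power_add)
      then show "u ^ degree f * (coeff f i * inverse u ^ i) = coeff f i * u ^ (degree f - i)"
        using \<open>u \<noteq> 0\<close> by (simp add: field_simps)
    qed
    also have "\<dots> \<in> R" using f(1) uR by (intro cl) (auto simp: poly_over_def)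
    finally obtain s where s: "s \<in> R" "u ^ k = c * s"
      using f(2) c0 by (metis mult.left_commute mult.right_neutral)
    have "\<exists>t\<in>R. u ^ j = 1 + c * t" for j
    proof (induction j)
      case 0 then show ?case using cl by (auto intro: bexI[of _ 0])
    next
      case (Suc j)
      then obtain t where "t \<in> R" "u ^ j = 1 + c * t" by blast
      then have "u ^ Suc j = 1 + c * (t - r * (1 + c * t))"
        by (simp add: u_def algebra_simps)
      moreover have "t - r * (1 + c * t) \<in> R"
        using \<open>t \<in> R\<close> r cl subring_of_nat[OF R] by (auto simp: c_def)
      ultimately show ?case by blast
    qed
    then obtain t where t: "t \<in> R" "u ^ k = 1 + c * t" by blast
    then have "c * (s - t) = 1" using s by (simp add: algebra_simps)
    then have "inverse c = s - t" using inverse_unique by blast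
    then show False using cR s t cl by auto
  qed
  \<comment> \<open>\<open>A x n\<close>: some polynomial of degree at most \<open>n\<close> over \<open>c R\<close> takes the value 1 at \<open>x\<close>.\<close>
  define A where "A x n \<longleftrightarrow> (\<exists>g. poly_over R g \<and> degree g \<le> n \<and> c * poly g x = 1)" for x n
  have A0: "\<not> A x 0" for x
  proof
    assume "A x 0"
    then obtain g where g: "poly_over R g" "degree g = 0" "c * poly g x = 1"
      by (auto simp: A_def)
    then obtain b where b: "g = [:b:]" using degree_eq_zeroE by blast
    have "b \<in> R" using g(1) unfolding b poly_over_def by (metis coeff_pCons_0)
    moreover have "inverse c = b" using g(3) b inverse_unique by auto
    ultimately show False using cR by simp
  qed
  have step: "A x (n - 1)" if A: "A x n" "A (inverse x) m" and mn: "m \<le> n" and x: "x \<noteq> 0" for x n m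
  proof -
    have n: "n > 0" "m > 0" using A A0 by (metis gr0I)+
    obtain g h where g: "poly_over R g" "degree g \<le> n" "c * poly g x = 1"
      and h: "poly_over R h" "degree h \<le> m" "c * poly h (inverse x) = 1"
      using A by (auto simp: A_def)
    define v where "v = inverse (1 - c * coeff h 0)"
    have v: "v \<in> R" using unit h(1) by (auto simp: v_def poly_over_def)
    have v0: "1 - c * coeff h 0 \<noteq> 0"
    proof
      assume "1 - c * coeff h 0 = 0"
      then have "inverse c = coeff h 0" using inverse_unique by (metis eq_iff_diff_eq_0)
      then show False using cR h(1) by (auto simp: poly_over_def)
    qed
    \<comment> \<open>The relation at \<open>1 / x\<close>, solved for 1 and multiplied by \<open>x ^ n\<close>, rewrites the leading power.\<close>
    define q where "q = (\<Sum>i=1..m. monom (v * c * coeff h i) (n - i))"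
    have q_over: "poly_over R q"
      unfolding poly_over_def q_def coeff_sum
    proof (intro allI cl)
      fix i j assume "i \<in> {1..m}"
      have "v * c * coeff h i \<in> R"
        using v h(1) subring_of_nat[OF R]
        by (auto simp: poly_over_def c_def intro!: cl)
      then show "coeff (monom (v * c * coeff h i) (n - i)) j \<in> R"
        using cl by auto
    qed
    have "degree q \<le> n - 1" unfolding q_def
      by (intro degree_sum_le) (auto intro: order.trans[OF degree_monom_le])
    have qx: "poly q x = x ^ n"
    proof -
      have "1 = c * (\<Sum>i\<le>m. coeff h i * inverse x ^ i)"
        using h(3) unfolding poly_altdef
        by (subst sum.mono_neutral_left[where S = "{..degree h}", symmetric])
          (use h(2) in \<open>auto simp: coeff_eq_0\<close>)
      also have "{..m} = insert 0 {1..m}" by auto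
      finally have "1 - c * coeff h 0 = c * (\<Sum>i=1..m. coeff h i * inverse x ^ i)"
        by (simp add: algebra_simps)
      then have one: "v * (c * (\<Sum>i=1..m. coeff h i * inverse x ^ i)) = 1"
        using v0 unfolding v_def by (metis left_inverse)
      have "poly q x = (\<Sum>i=1..m. x ^ n * (v * c * (coeff h i * inverse x ^ i)))"
        unfolding q_def poly_sum poly_monom
      proof (intro sum.cong refl)
        fix i assume "i \<in> {1..m}"
        then have "i \<le> n" using mn by simp
        then have "x ^ n = x ^ (n - i) * x ^ i" by (simp flip: power_add)
        then show "v * c * coeff h i * x ^ (n - i) = x ^ n * (v * c * (coeff h i * inverse x ^ i))"
          using x by (simp add: field_simps)
      qed
      also have "\<dots> = x ^ n * (v * (c * (\<Sum>i=1..m. coeff h i * inverse x ^ i)))"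
        by (simp add: sum_distrib_left mult.assoc)
      finally show ?thesis using one by simp
    qed
    define g' where "g' = g - monom (coeff g n) n + smult (coeff g n) q"
    have "coeff (g - monom (coeff g n) n) i = (if i = n then 0 else coeff g i)" for i
      by auto
    then have "poly_over R (g - monom (coeff g n) n)"
      using g(1) cl by (auto simp: poly_over_def)
    then have "poly_over R g'"
      unfolding g'_def using g(1) q_over
      by (intro poly_over_add[OF R] poly_over_smult[OF R]) (auto simp: poly_over_def)
    moreover have "degree g' \<le> n - 1"
      unfolding g'_def
    proof (intro degree_add_le)
      show "degree (g - monom (coeff g n) n) \<le> n - 1"
      proof (intro degree_le allI impI)
        fix i assume "n - 1 < i"
        then show "coeff (g - monom (coeff g n) n) i = 0"
          using coeff_eq_0[of g i] g(2) by auto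
      qed
      show "degree (smult (coeff g n) q) \<le> n - 1"
        using degree_smult_le[of "coeff g n" q] \<open>degree q \<le> n - 1\<close> by linarith
    qed
    moreover have "poly g' x = poly g x"
      by (simp add: g'_def poly_monom qx)
    ultimately show ?thesis using g(3) unfolding A_def by metis
  qed
  have no: "\<not> (A x n \<and> A (inverse x) m)" if "x \<noteq> 0" for x n m
    using that
  proof (induction "n + m" arbitrary: n m x rule: less_induct)
    case less
    show ?case
    proof
      assume A: "A x n \<and> A (inverse x) m"
      then have pos: "n > 0" "m > 0" using A0 by (metis gr0I)+
      show False
      proof (cases "m \<le> n")
        case True
        then have "A x (n - 1)" using step A less.prems by blast
        then show False using less.hyps[of "n - 1" m x] A pos less.prems by auto
      next
        case False
        then have "A (inverse x) (m - 1)"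
          using step[of "inverse x" m n] A less.prems by auto
        then show False using less.hyps[of n "m - 1" x] A pos less.prems by auto
      qed
    qed
  qed
  have "x \<in> R \<or> inverse x \<in> R" for x
  proof (rule ccontr)
    assume "\<not> (x \<in> R \<or> inverse x \<in> R)"
    then have x: "x \<notin> R" "inverse x \<notin> R" by auto
    then have "x \<noteq> 0" using cl by auto
    moreover have "\<exists>n. A x n" "\<exists>m. A (inverse x) m"
      using adjoin x by (meson A_def order_refl)+
    ultimately show False using no by blast
  qed
  then show ?thesis using R cR by (auto simp: valuation_ring_over_def c_def)
qed

text \<open>By Bezout, a fraction in lowest terms with denominator \<open>b > 1\<close> would put \<open>1 / b\<close> into every valuation
  ring over \<open>b\<close>.\<close>

lemma rational_in_valuation_rings_imp_int:
  assumes x: "x \<in> \<rat>"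
    and mem: "\<And>p R. valuation_ring_over p R \<Longrightarrow> x \<in> R"
  shows "x \<in> \<int>"
proof -
  obtain q where q: "x = of_rat q" using x by (auto elim: Rats_cases)
  obtain a b where ab: "quotient_of q = (a, b)" by force
  have b: "b > 0" "coprime a b" "q = of_int a / of_int b"
    using ab quotient_of_denom_pos quotient_of_coprime quotient_of_div by auto
  have xe: "x = of_int a / of_int b" by (simp add: q b(3) of_rat_divide)
  have "b = 1"
  proof (rule ccontr)
    assume "b \<noteq> 1"
    then have "nat b > 1" using b by linarith
    then obtain R where V: "valuation_ring_over (nat b) R"
      using ex_valuation_ring_over by blast
    then have R: "subring R" by (simp add: valuation_ring_over_def)
    obtain u v where "u * a + v * b = 1"
      using b(2) by (metis coprime_iff_gcd_eq_1 bezout_int)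
    then have "of_int u * of_int a + of_int v * of_int b = (1 :: complex)"
      by (metis of_int_1 of_int_add of_int_mult)
    then have "inverse (of_int b) = of_int u * x + (of_int v :: complex)"
      using b(1) by (simp add: xe field_simps)
    also have "\<dots> \<in> R"
      using mem[OF V] by (intro subring_add[OF R] subring_mult[OF R]
          subring_of_int[OF R])
    finally show False using V b(1) by (auto simp: valuation_ring_over_def)
  qed
  then show ?thesis by (simp add: xe)
qed

text \<open>Gauss's lemma for a linear factor. The coefficients of the quotient are computed from the top down
  if \<open>\<eta>\<close> lies in \<open>R\<close>, and from the constant term up if \<open>1 / \<eta>\<close> does; both recursions stay in \<open>R\<close>.\<close>

lemma poly_over_divide_linear:
  assumes V: "valuation_ring_over p R"
    and f: "poly_over R ([:- \<eta>, 1:] * q)"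
  shows "poly_over R q"
proof -
  have R: "subring R" using V by (simp add: valuation_ring_over_def)
  note cl = subring_diff[OF R] subring_mult[OF R]
    subring_add[OF R] subring_zero[OF R] subring_uminus[OF R]
  have f0: "- \<eta> * coeff q 0 \<in> R"
    using f[unfolded poly_over_def, rule_format, of 0] by (simp add: coeff_mult)
  have fS: "coeff q i - \<eta> * coeff q (Suc i) \<in> R" for i
    using f[unfolded poly_over_def, rule_format, of "Suc i"] by simp
  show ?thesis
  proof (cases "\<eta> \<in> R")
    case True
    have "coeff q (Suc (degree q) - j) \<in> R" if "j \<le> Suc (degree q)" for j
      using that
    proof (induction j)
      case 0
      then show ?case using cl by (simp add: coeff_eq_0)
    next
      case (Suc j)
      define k where "k = Suc (degree q) - Suc j"
      have "Suc (degree q) - j = Suc k" using Suc.prems by (simp add: k_def)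
      then have "coeff q (Suc k) \<in> R" using Suc by simp
      then have "(coeff q k - \<eta> * coeff q (Suc k)) + \<eta> * coeff q (Suc k) \<in> R"
        by (intro subring_add[OF R fS] subring_mult[OF R True])
      then show ?case by (simp add: k_def)
    qed
    from this[of "Suc (degree q) - _"] have "coeff q i \<in> R" if "i \<le> degree q" for i
      using that by (metis diff_diff_cancel diff_le_self le_SucI)
    then show ?thesis unfolding poly_over_def using cl coeff_eq_0 by (metis not_le)
  next
    case False
    then have inv: "inverse \<eta> \<in> R" "\<eta> \<noteq> 0" using V cl by (auto simp: valuation_ring_over_def)
    have "coeff q i \<in> R" for i
    proof (induction i)
      case 0
      have "- inverse \<eta> * (- \<eta> * coeff q 0) \<in> R"
        by (rule subring_mult[OF R subring_uminus[OF R inv(1)] f0])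
      then show ?case using inv by (simp add: mult.assoc[symmetric])
    next
      case (Suc i)
      have "inverse \<eta> * (coeff q i - (coeff q i - \<eta> * coeff q (Suc i))) \<in> R"
        by (rule subring_mult[OF R inv(1) subring_diff[OF R Suc fS]])
      then show ?case using inv by (simp add: mult.assoc[symmetric])
    qed
    then show ?thesis by (simp add: poly_over_def)
  qed
qed

text \<open>A generator of the fractional ideal \<open>R + R \<eta>\<close>: the local counterpart of \<open>max 1 |\<eta>|\<close>.\<close>

definition denom_part :: "complex set \<Rightarrow> complex \<Rightarrow> complex" where
  "denom_part R \<eta> = (if \<eta> \<in> R then 1 else \<eta>)"

lemma denom_part_nonzero: "subring R \<Longrightarrow> denom_part R \<eta> \<noteq> 0"
  using subring_zero by (auto simp: denom_part_def)

lemma denom_part_mem: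
  assumes V: "valuation_ring_over p R"
  shows "inverse (denom_part R \<eta>) \<in> R" "\<eta> / denom_part R \<eta> \<in> R"
  using V subring_one[of R] subring_zero[of R]
  by (auto simp: denom_part_def valuation_ring_over_def)

text \<open>Dividing out the linear factors of the roots outside \<open>J\<close> keeps the coefficients in \<open>R\<close>, and the
  constant coefficient of what remains is the product in question up to sign.\<close>

lemma lead_coeff_mult_roots_in_valuation_ring:
  assumes V: "valuation_ring_over p R" and fin: "finite I" and sub: "J \<subseteq> I"
    and f: "poly_over R (smult a (\<Prod>\<eta>\<in>I. [:- \<eta>, 1:]))"
  shows "a * (\<Prod>\<eta>\<in>J. \<eta>) \<in> R"
proof -
  have R: "subring R" using V by (simp add: valuation_ring_over_def)
  have drop: "poly_over R (smult a (\<Prod>\<eta>\<in>J. [:- \<eta>, 1:]))"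
    if "finite K" "finite J" "J \<inter> K = {}" "poly_over R (smult a (\<Prod>\<eta>\<in>J \<union> K. [:- \<eta>, 1:]))" for J K
    using that
  proof (induction K rule: finite_induct)
    case (insert x K)
    have "smult a (\<Prod>\<eta>\<in>J \<union> insert x K. [:- \<eta>, 1:]) = [:- x, 1:] * smult a (\<Prod>\<eta>\<in>J \<union> K. [:- \<eta>, 1:])"
      using insert by simp
    then have "poly_over R (smult a (\<Prod>\<eta>\<in>J \<union> K. [:- \<eta>, 1:]))"
      using insert.prems poly_over_divide_linear[OF V] by metis
    then show ?case using insert by simp
  qed simp
  have J: "J \<inter> (I - J) = {}" "J \<union> (I - J) = I" "finite J"
    using fin sub by (auto intro: finite_subset)
  have "poly_over R (smult a (\<Prod>\<eta>\<in>J. [:- \<eta>, 1:]))"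
    using drop[of "I - J" J] J f fin by simp
  then have "coeff (smult a (\<Prod>\<eta>\<in>J. [:- \<eta>, 1:])) 0 \<in> R" by (auto simp: poly_over_def)
  also have "coeff (smult a (\<Prod>\<eta>\<in>J. [:- \<eta>, 1:])) 0 = a * (\<Prod>\<eta>\<in>J. - \<eta>)"
    by (simp add: poly_0_coeff_0[symmetric] poly_prod)
  finally have "a * (\<Prod>\<eta>\<in>J. - \<eta>) \<in> R" .
  then have "(-1) ^ card J * (a * (\<Prod>\<eta>\<in>J. - \<eta>)) \<in> R"
    by (intro subring_mult[OF R subring_power[OF R]] subring_uminus[OF R]
        subring_one[OF R])
  also have "(-1) ^ card J * (a * (\<Prod>\<eta>\<in>J. - \<eta>)) = a * (\<Prod>\<eta>\<in>J. \<eta>)"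
    by (simp add: prod_uminus flip: power_mult_distrib)
  finally show ?thesis .
qed

text \<open>This is the inequality \<open>|a| \<Prod> max 1 |\<eta>| \<le> 1\<close> for the absolute value that belongs to \<open>R\<close>.\<close>

lemma lead_coeff_clears_denominators:
  assumes V: "valuation_ring_over p R" and fin: "finite I"
    and f: "poly_over R (smult a (\<Prod>\<eta>\<in>I. [:- \<eta>, 1:]))"
  shows "a * (\<Prod>\<eta>\<in>I. denom_part R \<eta>) \<in> R"
proof -
  have "(\<Prod>\<eta>\<in>I. denom_part R \<eta>) = (\<Prod>\<eta>\<in>{\<eta>\<in>I. \<eta> \<notin> R}. \<eta>)"
    unfolding denom_part_def using fin by (simp add: prod.If_cases Int_def)
  then show ?thesis
    using lead_coeff_mult_roots_in_valuation_ring[OF V fin _ f, of "{\<eta>\<in>I. \<eta> \<notin> R}"] by simp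
qed

text \<open>The constant coefficient is \<open>a\<close> times the product of all roots up to sign, so it cancels every inverse
  root that is not integral and leaves \<open>a\<close> times the product of the other roots.\<close>

lemma constant_coeff_clears_inverse_denominators:
  assumes V: "valuation_ring_over p R" and fin: "finite I" and nz: "0 \<notin> I"
    and f: "poly_over R (smult a (\<Prod>\<eta>\<in>I. [:- \<eta>, 1:]))"
  shows "coeff (smult a (\<Prod>\<eta>\<in>I. [:- \<eta>, 1:])) 0 * (\<Prod>\<eta>\<in>I. denom_part R (inverse \<eta>)) \<in> R"
proof -
  have R: "subring R" using V by (simp add: valuation_ring_over_def)
  define J where "J = {\<eta>\<in>I. inverse \<eta> \<in> R}"
  have J: "J \<subseteq> I" "finite J" using fin by (auto simp: J_def)
  have split: "(\<Prod>\<eta>\<in>I. \<eta>) = (\<Prod>\<eta>\<in>I - J. \<eta>) * (\<Prod>\<eta>\<in>J. \<eta>)"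
    by (rule prod.subset_diff[OF J(1) fin])
  have den: "(\<Prod>\<eta>\<in>I. denom_part R (inverse \<eta>)) = inverse (\<Prod>\<eta>\<in>I - J. \<eta>)"
  proof -
    have "(\<Prod>\<eta>\<in>I. denom_part R (inverse \<eta>)) = (\<Prod>\<eta>\<in>I - J. inverse \<eta>)"
      using fin by (intro prod.mono_neutral_cong_right) (auto simp: denom_part_def J_def)
    then show ?thesis using prod_inversef[of "\<lambda>\<eta>. \<eta>" "I - J"] by (simp add: comp_def)
  qed
  have nz': "(\<Prod>\<eta>\<in>I - J. \<eta>) \<noteq> 0" using fin nz by (subst prod_zero_iff) auto
  have c0: "coeff (smult a (\<Prod>\<eta>\<in>I. [:- \<eta>, 1:])) 0 = (-1) ^ card I * (a * (\<Prod>\<eta>\<in>I. \<eta>))"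
    by (simp add: poly_0_coeff_0[symmetric] poly_prod prod_uminus)
  have cancel: "s * (a * (x * y)) * inverse x = s * (a * y)" if "x \<noteq> 0" for s x y :: complex
    using that by simp
  have "coeff (smult a (\<Prod>\<eta>\<in>I. [:- \<eta>, 1:])) 0 * (\<Prod>\<eta>\<in>I. denom_part R (inverse \<eta>)) =
      (-1) ^ card I * (a * (\<Prod>\<eta>\<in>J. \<eta>))"
    unfolding den c0 split cancel[OF nz'] ..
  also have "\<dots> \<in> R"
    by (intro subring_mult[OF R subring_power[OF R]] subring_uminus[OF R]
        subring_one[OF R] lead_coeff_mult_roots_in_valuation_ring[OF V fin J(1) f])
  finally show ?thesis .
qed

text \<open>Each difference becomes integral after division by the denominators of its two terms. Over
  all ordered pairs the denominator of each term is used at most \<open>2 card S\<close> times, and any excess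
  is harmless because inverse denominators lie in \<open>R\<close>.\<close>

lemma difference_product_in_valuation_ring:
  fixes \<zeta> :: "'a \<Rightarrow> 'k \<Rightarrow> complex" and e :: "'k \<Rightarrow> nat" and \<beta> :: "'k \<Rightarrow> complex"
  assumes V: "valuation_ring_over p R" and fin: "finite S" "finite T"
    and \<beta>: "\<And>k. k \<in> T \<Longrightarrow> \<beta> k * (\<Prod>\<alpha>\<in>S. denom_part R (\<zeta> \<alpha> k)) \<in> R"
  defines "\<gamma> \<equiv> \<lambda>\<alpha>. \<Prod>k\<in>T. \<zeta> \<alpha> k ^ e k"
  shows "(\<Prod>(\<alpha>, \<alpha>')\<in>{(\<alpha>, \<alpha>')\<in>S \<times> S. \<gamma> \<alpha> \<noteq> \<gamma> \<alpha>'}. \<gamma> \<alpha> - \<gamma> \<alpha>')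
           * (\<Prod>k\<in>T. \<beta> k ^ (2 * card S * e k)) \<in> R"
proof -
  have R: "subring R" using V by (simp add: valuation_ring_over_def)
  note cl = subring_diff[OF R] subring_mult[OF R] subring_power[OF R]
    subring_prod[OF R]
  define m where "m \<alpha> k = denom_part R (\<zeta> \<alpha> k)" for \<alpha> k
  define \<mu> where "\<mu> \<alpha> = (\<Prod>k\<in>T. m \<alpha> k ^ e k)" for \<alpha>
  have m0: "m \<alpha> k \<noteq> 0" for \<alpha> k using denom_part_nonzero[OF R] by (simp add: m_def)
  have \<mu>0: "\<mu> \<alpha> \<noteq> 0" for \<alpha> using m0 fin by (simp add: \<mu>_def)
  have \<mu>R: "inverse (\<mu> \<alpha>) \<in> R" for \<alpha>
  proof -
    have "inverse (\<mu> \<alpha>) = (\<Prod>k\<in>T. inverse (m \<alpha> k) ^ e k)"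
      by (simp add: \<mu>_def power_inverse flip: prod_inversef)
    also have "\<dots> \<in> R" unfolding m_def by (intro cl denom_part_mem(1)[OF V])
    finally show ?thesis .
  qed
  have \<gamma>R: "\<gamma> \<alpha> / \<mu> \<alpha> \<in> R" for \<alpha>
  proof -
    have "\<gamma> \<alpha> / \<mu> \<alpha> = (\<Prod>k\<in>T. (\<zeta> \<alpha> k / m \<alpha> k) ^ e k)"
      by (simp add: \<mu>_def \<gamma>_def power_divide flip: prod_dividef)
    also have "\<dots> \<in> R" unfolding m_def by (intro cl denom_part_mem(2)[OF V])
    finally show ?thesis .
  qed
  define E where "E = {(\<alpha>, \<alpha>')\<in>S \<times> S. \<gamma> \<alpha> \<noteq> \<gamma> \<alpha>'}"
  have E: "E \<subseteq> S \<times> S" "finite (S \<times> S)" using fin by (auto simp: E_def)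
  define d where "d = (\<lambda>(\<alpha>, \<alpha>'). if (\<alpha>, \<alpha>') \<in> E then \<gamma> \<alpha> - \<gamma> \<alpha>' else 1)"
  have dR: "(case z of (\<alpha>, \<alpha>') \<Rightarrow> d z * (inverse (\<mu> \<alpha>) * inverse (\<mu> \<alpha>'))) \<in> R" for z
  proof (cases z)
    case (Pair \<alpha> \<alpha>')
    have "(\<gamma> \<alpha> - \<gamma> \<alpha>') * (inverse (\<mu> \<alpha>) * inverse (\<mu> \<alpha>')) =
      (\<gamma> \<alpha> / \<mu> \<alpha>) * inverse (\<mu> \<alpha>') - inverse (\<mu> \<alpha>) * (\<gamma> \<alpha>' / \<mu> \<alpha>')"
      by (simp add: divide_inverse algebra_simps)
    also have "\<dots> \<in> R" by (intro cl \<gamma>R \<mu>R)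
    finally show ?thesis using cl \<mu>R by (auto simp: Pair d_def)
  qed
  have prodR: "(\<Prod>z\<in>S \<times> S. case z of (\<alpha>, \<alpha>') \<Rightarrow> d z * (inverse (\<mu> \<alpha>) * inverse (\<mu> \<alpha>'))) \<in> R"
    by (rule subring_prod[OF R]) (rule dR)
  have square: "(\<Prod>(\<alpha>, \<alpha>')\<in>S \<times> S. \<iota> \<alpha> * \<iota> \<alpha>') = (\<Prod>\<alpha>\<in>S. \<iota> \<alpha>) ^ (2 * card S)"
    for \<iota> :: "'a \<Rightarrow> complex"
  proof -
    have "(\<Prod>(\<alpha>, \<alpha>')\<in>S \<times> S. \<iota> \<alpha> * \<iota> \<alpha>') = (\<Prod>\<alpha>\<in>S. \<iota> \<alpha> ^ card S) * (\<Prod>\<alpha>\<in>S. \<iota> \<alpha>) ^ card S"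
      by (simp add: prod.cartesian_product[symmetric] prod.distrib)
    then show ?thesis by (simp add: mult_2 power_add prod_power_distrib)
  qed
  have "(\<Prod>z\<in>S \<times> S. case z of (\<alpha>, \<alpha>') \<Rightarrow> d z * (inverse (\<mu> \<alpha>) * inverse (\<mu> \<alpha>'))) =
      (\<Prod>z\<in>S \<times> S. d z) * (\<Prod>(\<alpha>, \<alpha>')\<in>S \<times> S. inverse (\<mu> \<alpha>) * inverse (\<mu> \<alpha>'))"
    by (simp add: prod.distrib case_prod_unfold)
  also have "(\<Prod>z\<in>S \<times> S. d z) = (\<Prod>(\<alpha>, \<alpha>')\<in>E. \<gamma> \<alpha> - \<gamma> \<alpha>')"
    using E by (intro prod.mono_neutral_cong_right) (auto simp: d_def)
  also have "(\<Prod>(\<alpha>, \<alpha>')\<in>S \<times> S. inverse (\<mu> \<alpha>) * inverse (\<mu> \<alpha>'))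
      = (\<Prod>\<alpha>\<in>S. inverse (\<mu> \<alpha>)) ^ (2 * card S)"
    by (rule square)
  also have "(\<Prod>\<alpha>\<in>S. inverse (\<mu> \<alpha>)) = inverse (\<Prod>\<alpha>\<in>S. \<mu> \<alpha>)"
    using prod_inversef[of \<mu> S] by (simp add: comp_def)
  also have "(\<Prod>\<alpha>\<in>S. \<mu> \<alpha>) = (\<Prod>k\<in>T. (\<Prod>\<alpha>\<in>S. m \<alpha> k) ^ e k)"
    unfolding \<mu>_def by (subst prod.swap) (simp add: prod_power_distrib)
  finally have 1: "(\<Prod>(\<alpha>, \<alpha>')\<in>E. \<gamma> \<alpha> - \<gamma> \<alpha>')
      * inverse (\<Prod>k\<in>T. (\<Prod>\<alpha>\<in>S. m \<alpha> k) ^ e k) ^ (2 * card S) \<in> R"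
    using prodR by (simp only:)
  have "(\<Prod>k\<in>T. (\<beta> k * (\<Prod>\<alpha>\<in>S. m \<alpha> k)) ^ e k) ^ (2 * card S) \<in> R"
    unfolding m_def by (intro subring_power[OF R] subring_prod[OF R] \<beta>)
  also have "(\<Prod>k\<in>T. (\<beta> k * (\<Prod>\<alpha>\<in>S. m \<alpha> k)) ^ e k) ^ (2 * card S) =
      (\<Prod>k\<in>T. (\<Prod>\<alpha>\<in>S. m \<alpha> k) ^ e k) ^ (2 * card S) * (\<Prod>k\<in>T. \<beta> k ^ (2 * card S * e k))"
    by (simp add: power_mult_distrib prod.distrib power_mult[symmetric] mult_ac
        prod_power_distrib[of "\<lambda>k. \<beta> k ^ e k"])
  finally have 2: "(\<Prod>k\<in>T. (\<Prod>\<alpha>\<in>S. m \<alpha> k) ^ e k) ^ (2 * card S) * (\<Prod>k\<in>T. \<beta> k ^ (2 * card S * e k)) \<in> R" .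
  have nz: "(\<Prod>k\<in>T. (\<Prod>\<alpha>\<in>S. m \<alpha> k) ^ e k) \<noteq> 0" using fin m0 by simp
  have cancel: "a * inverse x ^ n * (x ^ n * b) = a * b" if "x \<noteq> 0" for a b x :: complex and n
    using that by (simp add: power_inverse)
  show ?thesis
    using subring_mult[OF R 1 2] unfolding E_def cancel[OF nz] .
qed

section \<open>The field of algebraic numbers\<close>

lemma rat_vector_space: "vector_space (\<lambda>(q :: rat) (x :: complex). of_rat q * x)"
  by unfold_locales (auto simp: algebra_simps of_rat_add of_rat_mult)

text \<open>More powers of \<open>x\<close> than the number of generators are linearly dependent over the rationals, and the
  dependence is an algebraic equation.\<close>

lemma algebraic_if_powers_in_span:
  assumes fin: "finite V"
    and span: "\<And>k. x ^ k \<in> module.span (\<lambda>(q :: rat) (x :: complex). of_rat q * x) V"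
  shows "algebraic x"
proof -
  interpret vs: vector_space "\<lambda>(q :: rat) (x :: complex). of_rat q * x"
    by (rule rat_vector_space)
  define n where "n = card V"
  show ?thesis
  proof (cases "inj_on (\<lambda>k. x ^ k) {..n}")
    case False
    then obtain i j where ij: "i < j" "x ^ i = x ^ j"
      unfolding inj_on_def by (metis linorder_neqE_nat)
    define p where "p = monom (1 :: complex) j - monom 1 i"
    have "coeff p j = 1" using ij by (simp add: p_def)
    then have "p \<noteq> 0" by auto
    moreover have "poly p x = 0" using ij by (simp add: p_def poly_monom)
    moreover have "coeff p k \<in> \<rat>" for k by (auto simp: p_def)
    ultimately show ?thesis by (intro algebraicI')
  next
    case True
    define B where "B = (\<lambda>k. x ^ k) ` {..n}"
    have "card B = Suc n" using card_image[OF True] by (simp add: B_def)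
    then have "\<not> vs.independent B"
      using vs.independent_span_bound[OF fin, of B] span unfolding n_def B_def by auto
    moreover have "finite B" by (simp add: B_def)
    ultimately obtain u v where u: "v \<in> B" "u v \<noteq> 0" "(\<Sum>v\<in>B. of_rat (u v) * v) = 0"
      by (auto simp: vs.dependent_finite)
    define p where "p = (\<Sum>k\<le>n. monom (of_rat (u (x ^ k)) :: complex) k)"
    have cp: "coeff p k = (if k \<le> n then of_rat (u (x ^ k)) else 0)" for k
      by (simp add: p_def coeff_sum)
    have "poly p x = 0"
      using u(3) unfolding B_def by (simp add: p_def poly_sum poly_monom sum.reindex[OF True])
    moreover have "p \<noteq> 0"
    proof -
      obtain k where "k \<le> n" "v = x ^ k" using u(1) by (auto simp: B_def)
      then have "coeff p k \<noteq> 0" using u(2) by (simp add: cp)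
      then show ?thesis by auto
    qed
    moreover have "coeff p k \<in> \<rat>" for k by (auto simp: cp)
    ultimately show ?thesis by (intro algebraicI')
  qed
qed

text \<open>An equation for \<open>x\<close> lowers the exponent of \<open>x\<close> below its degree, and likewise for \<open>y\<close>; so the
  finitely many reduced monomials span all of them.\<close>

lemma monomials_in_span:
  assumes "algebraic x" "algebraic y"
  obtains V where "finite V"
    "\<And>i j. x ^ i * y ^ j \<in> module.span (\<lambda>(q :: rat) (x :: complex). of_rat q * x) V"
proof -
  interpret vs: vector_space "\<lambda>(q :: rat) (x :: complex). of_rat q * x"
    by (rule rat_vector_space)
  have reduce: "\<exists>m. \<forall>z V. (\<forall>i<m. x ^ i * z \<in> vs.span V) \<longrightarrow> (\<forall>i. x ^ i * z \<in> vs.span V)"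
    if x: "algebraic x" for x
  proof -
    obtain p where p: "poly (map_poly of_int p) x = 0" "p \<noteq> 0"
      using algebraicE'[OF x] by metis
    define m where "m = degree p"
    define c :: "nat \<Rightarrow> rat" where "c i = of_int (coeff p i) / of_int (lead_coeff p)" for i
    have lc: "lead_coeff p \<noteq> 0" using p by simp
    have "(\<Sum>i\<le>m. of_int (coeff p i) * x ^ i) = 0"
      using p(1) by (simp add: poly_altdef m_def coeff_map_poly degree_map_poly)
    then have "(\<Sum>i<m. of_int (coeff p i) * x ^ i) + of_int (lead_coeff p) * x ^ m = 0"
      by (simp add: lessThan_Suc_atMost[symmetric] m_def)
    then have "of_int (lead_coeff p) * x ^ m = - (\<Sum>i<m. of_int (coeff p i) * x ^ i)"
      by (simp add: eq_neg_iff_add_eq_0 add.commute)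
    then have "x ^ m = - (\<Sum>i<m. of_int (coeff p i) * x ^ i) / of_int (lead_coeff p)"
      using lc by (metis nonzero_mult_div_cancel_left of_int_eq_0_iff)
    then have xm: "x ^ m = - (\<Sum>i<m. of_rat (c i) * x ^ i)"
      by (simp add: c_def of_rat_divide sum_divide_distrib field_simps)
    have "x ^ i * z \<in> vs.span V" if base: "\<forall>i<m. x ^ i * z \<in> vs.span V" for z V i
    proof (induction i rule: less_induct)
      case (less i)
      show ?case
      proof (cases "i < m")
        case False
        then have "x ^ i = x ^ (i - m) * x ^ m" by (simp flip: power_add)
        then have "x ^ i * z = - (\<Sum>j<m. of_rat (c j) * (x ^ (i - m + j) * z))"
          by (simp add: xm sum_distrib_left sum_distrib_right power_add mult_ac)
        also have "\<dots> \<in> vs.span V"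
          using False less by (intro vs.span_neg vs.span_sum vs.span_scale) auto
        finally show ?thesis .
      qed (use base in auto)
    qed
    then show ?thesis by blast
  qed
  obtain m where m: "\<And>z V. \<forall>i<m. x ^ i * z \<in> vs.span V \<Longrightarrow> \<forall>i. x ^ i * z \<in> vs.span V"
    using reduce[OF assms(1)] by blast
  obtain n where n: "\<And>z V. \<forall>i<n. y ^ i * z \<in> vs.span V \<Longrightarrow> \<forall>i. y ^ i * z \<in> vs.span V"
    using reduce[OF assms(2)] by blast
  define V where "V = (\<lambda>(i, j). x ^ i * y ^ j) ` ({..<m} \<times> {..<n})"
  have "x ^ i * y ^ j \<in> vs.span V" if "i < m" "j < n" for i j
    using that by (intro vs.span_base) (auto simp: V_def)
  then have "x ^ i * y ^ j \<in> vs.span V" if "j < n" for i j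
    using that m by blast
  then have "y ^ j * x ^ i \<in> vs.span V" for i j
    using n by (metis mult.commute)
  then have "x ^ i * y ^ j \<in> vs.span V" for i j by (metis mult.commute)
  moreover have "finite V" by (simp add: V_def)
  ultimately show ?thesis using that by blast
qed

lemma algebraic_add:
  assumes "algebraic (x :: complex)" "algebraic y"
  shows "algebraic (x + y)"
proof -
  interpret vs: vector_space "\<lambda>(q :: rat) (x :: complex). of_rat q * x"
    by (rule rat_vector_space)
  obtain V where V: "finite V" "\<And>i j. x ^ i * y ^ j \<in> vs.span V"
    using monomials_in_span[OF assms] by blast
  have "(x + y) ^ k \<in> vs.span V" for k
  proof -
    have "(x + y) ^ k = (\<Sum>i\<le>k. of_rat (of_nat (k choose i)) * (x ^ i * y ^ (k - i)))"
      by (simp add: binomial_ring mult_ac)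
    also have "\<dots> \<in> vs.span V" by (intro vs.span_sum vs.span_scale V)
    finally show ?thesis .
  qed
  then show ?thesis by (rule algebraic_if_powers_in_span[OF V(1)])
qed

lemma algebraic_mult:
  assumes "algebraic (x :: complex)" "algebraic y"
  shows "algebraic (x * y)"
proof -
  obtain V where V: "finite V"
    "\<And>i j. x ^ i * y ^ j \<in> module.span (\<lambda>(q :: rat) (x :: complex). of_rat q * x) V"
    using monomials_in_span[OF assms] by blast
  show ?thesis
    using V(2) by (intro algebraic_if_powers_in_span[OF V(1)]) (simp add: power_mult_distrib)
qed

lemma algebraic_rat: "q \<in> \<rat> \<Longrightarrow> algebraic (q :: complex)"
  by (rule algebraicI'[of "[:- q, 1:]"]) (auto simp: coeff_pCons split: nat.splits)

lemma algebraic_diff: "algebraic (x :: complex) \<Longrightarrow> algebraic y \<Longrightarrow> algebraic (x - y)"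
  using algebraic_add[of x "- y"] by auto

lemma subring_algebraic: "subring {x. algebraic x}"
  using algebraic_diff algebraic_mult algebraic_rat[of 1] by (auto simp: subring_def)

lemma poly_over_mem: "subring K \<Longrightarrow> poly_over K f \<Longrightarrow> x \<in> K \<Longrightarrow> poly f x \<in> K"
  unfolding poly_altdef poly_over_def
  by (intro subring_sum subring_mult subring_power) auto

section \<open>Conjugates of an algebraic number\<close>

definition subfield :: "complex set \<Rightarrow> bool" where
  "subfield K \<longleftrightarrow> subring K \<and> (\<forall>x\<in>K. inverse x \<in> K)"

definition min_poly_over :: "complex set \<Rightarrow> complex \<Rightarrow> complex poly \<Rightarrow> bool" where
  "min_poly_over K x p \<longleftrightarrow> poly_over K p \<and> p \<noteq> 0 \<and> poly p x = 0 \<and>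
     (\<forall>q. poly_over K q \<longrightarrow> q \<noteq> 0 \<longrightarrow> poly q x = 0 \<longrightarrow> degree p \<le> degree q)"

lemma degree_pos_of_root:
  fixes f :: "complex poly"
  assumes "f \<noteq> 0" "poly f x = 0"
  shows "degree f > 0"
proof (rule ccontr)
  assume "\<not> degree f > 0"
  then obtain c where "f = [:c:]" using degree_eq_zeroE by blast
  then show False using assms by simp
qed

lemma ex_min_poly_over:
  assumes "poly_over K f" "f \<noteq> 0" "poly f x = 0"
  shows "\<exists>p. min_poly_over K x p"
  using ex_has_least_nat[of "\<lambda>p. poly_over K p \<and> p \<noteq> 0 \<and> poly p x = 0" f degree] assms
  unfolding min_poly_over_def by blast

lemma poly_over_division:
  assumes K: "subfield K" and p: "poly_over K p" "p \<noteq> 0" and f: "poly_over K f"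
  shows "\<exists>q r. poly_over K q \<and> poly_over K r \<and> f = p * q + r \<and> (r = 0 \<or> degree r < degree p)"
  using f
proof (induction "degree f" arbitrary: f rule: less_induct)
  case less
  have R: "subring K" using K by (simp add: subfield_def)
  show ?case
  proof (cases "f = 0 \<or> degree f < degree p")
    case True
    then show ?thesis using less.prems poly_over_zero[OF R]
      by (intro exI[of _ 0] exI[of _ f]) auto
  next
    case False
    then have fp: "f \<noteq> 0" "degree p \<le> degree f" by auto
    define c where "c = lead_coeff f * inverse (lead_coeff p)"
    have c: "c \<in> K" "c \<noteq> 0" using K p less.prems fp
      by (auto simp: c_def subfield_def poly_over_def intro!: subring_mult)
    define t where "t = monom c (degree f - degree p)"
    have t: "poly_over K t"
      using c subring_zero[OF R] by (auto simp: t_def poly_over_def)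
    define g where "g = f - p * t"
    have g: "poly_over K g"
      unfolding g_def by (intro poly_over_diff[OF R] poly_over_mult[OF R] t p less.prems)
    have t0: "t \<noteq> 0" "degree t = degree f - degree p"
      using c(2) unfolding t_def by (simp_all add: degree_monom_eq)
    have dpt: "degree (p * t) = degree f" using p t0 fp by (simp add: degree_mult_eq)
    have lpt: "lead_coeff (p * t) = lead_coeff f"
    proof -
      have "lead_coeff t = c" unfolding t0(2) by (simp add: t_def)
      then show ?thesis using p by (simp add: lead_coeff_mult c_def)
    qed
    show ?thesis
    proof (cases "g = 0")
      case True
      then show ?thesis using t poly_over_zero[OF R]
        by (intro exI[of _ t] exI[of _ 0]) (auto simp: g_def)
    next
      case False
      have "degree g \<le> degree f" unfolding g_def using dpt by (intro degree_diff_le) auto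
      moreover have "coeff g (degree f) = 0" using lpt dpt by (simp add: g_def)
      ultimately have "degree g < degree f"
        using False by (metis le_neq_implies_less leading_coeff_0_iff)
      then obtain q r where "poly_over K q" "poly_over K r" "g = p * q + r"
        "r = 0 \<or> degree r < degree p"
        using less.hyps g by blast
      then show ?thesis using t
        by (intro exI[of _ "q + t"] exI[of _ r])
          (auto simp: g_def algebra_simps intro: poly_over_add[OF R])
    qed
  qed
qed

lemma min_poly_over_dvd:
  assumes K: "subfield K" and p: "min_poly_over K x p"
    and f: "poly_over K f" "poly f x = 0"
  shows "\<exists>q. poly_over K q \<and> f = p * q"
proof -
  obtain q r where qr: "poly_over K q" "poly_over K r" "f = p * q + r" "r = 0 \<or> degree r < degree p"
    using poly_over_division[OF K _ _ f(1), of p] p unfolding min_poly_over_def by blast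
  have "poly r x = 0" using qr(3) p f(2) by (simp add: min_poly_over_def)
  then have "r = 0" using qr p unfolding min_poly_over_def by (metis not_le)
  then show ?thesis using qr by auto
qed

text \<open>All roots of a minimal polynomial share it, since a proper factor would vanish at \<open>x\<close>.\<close>

lemma min_poly_over_conj:
  assumes K: "subfield K" and p: "min_poly_over K x p" and y: "poly p y = 0"
  shows "min_poly_over K y p"
proof -
  have "degree p \<le> degree q" if q: "poly_over K q" "q \<noteq> 0" "poly q y = 0" for q
  proof -
    obtain g where g: "min_poly_over K y g" using ex_min_poly_over q by blast
    obtain h where h: "poly_over K h" "p = g * h"
      using min_poly_over_dvd[OF K g] p y unfolding min_poly_over_def by blast
    have nz: "g \<noteq> 0" "h \<noteq> 0" using h p by (auto simp: min_poly_over_def)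
    have dg: "degree g > 0"
      using g nz by (intro degree_pos_of_root[of g y]) (auto simp: min_poly_over_def)
    have "poly g x = 0"
    proof (rule ccontr)
      assume "poly g x \<noteq> 0"
      then have "poly h x = 0" using p h by (simp add: min_poly_over_def)
      then have "degree p \<le> degree h" using p h nz by (auto simp: min_poly_over_def)
      then show False using h nz dg by (simp add: degree_mult_eq)
    qed
    then have "degree p \<le> degree g" using p g nz by (auto simp: min_poly_over_def)
    also have "\<dots> \<le> degree q" using g q by (auto simp: min_poly_over_def)
    finally show ?thesis .
  qed
  then show ?thesis using p y by (auto simp: min_poly_over_def)
qed

lemma subfield_Rats: "subfield \<rat>"
  by (auto simp: subfield_def subring_def)

lemma poly_over_Rats_clear_denominators:
  assumes "poly_over \<rat> q"
  shows "\<exists>c r. c \<noteq> 0 \<and> smult (of_int c) q = map_poly of_int r"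
  using assms
proof (induction q)
  case 0 then show ?case by (intro exI[of _ 1] exI[of _ 0]) auto
next
  case (pCons a q)
  have "poly_over \<rat> q" using pCons.prems unfolding poly_over_def by (metis coeff_pCons_Suc)
  then obtain c r where c: "c \<noteq> 0" "smult (of_int c) q = map_poly of_int r" using pCons by blast
  have "a \<in> \<rat>" using pCons.prems unfolding poly_over_def by (metis coeff_pCons_0)
  then obtain m n :: int where n: "n \<noteq> 0" "a = of_int m / of_int n"
    by (metis Rats_cases' of_int_0_less_iff less_irrefl of_int_eq_0_iff)
  have "smult (of_int (c * n)) (pCons a q) = pCons (of_int (c * m)) (smult (of_int n) (smult (of_int c) q))"
    using n by (simp add: mult_ac)
  also have "\<dots> = map_poly of_int (pCons (c * m) (smult n r))"
    unfolding c(2) by (simp add: map_poly_pCons map_poly_smult)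
  finally show ?case using c n by (intro exI[of _ "c * n"] exI) auto
qed

abbreviation "cmin_poly x \<equiv> map_poly complex_of_int (min_int_poly x)"

lemma is_min_int_poly_min_int_poly: "algebraic x \<Longrightarrow> is_min_int_poly x (min_int_poly x)"
  unfolding min_int_poly_def by (rule theI') (rule ex1_is_min_int_poly)

lemma min_poly_over_Rats:
  assumes x: "algebraic x"
  shows "min_poly_over \<rat> x (cmin_poly x)"
  unfolding min_poly_over_def
proof (intro conjI allI impI)
  note m = is_min_int_poly_min_int_poly[OF x, unfolded is_min_int_poly_def]
  show "poly_over \<rat> (cmin_poly x)" by (auto simp: poly_over_def coeff_map_poly)
  show "cmin_poly x \<noteq> 0" using m by (auto simp: poly_eq_iff coeff_map_poly)
  show "poly (cmin_poly x) x = 0" using m by simp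
  fix q assume q: "poly_over \<rat> q" "q \<noteq> 0" "poly q x = 0"
  obtain c r where c: "c \<noteq> 0" "smult (of_int c) q = map_poly of_int r"
    using poly_over_Rats_clear_denominators[OF q(1)] by blast
  have "poly (map_poly of_int r) x = 0" using q(3) by (simp flip: c(2))
  moreover have "r \<noteq> 0" using c q(2) by auto
  ultimately have "degree (min_int_poly x) \<le> degree r" using m by blast
  also have "degree r = degree (map_poly complex_of_int r)" by (simp add: degree_map_poly)
  also have "\<dots> = degree q" using c by (simp flip: c(2))
  finally show "degree (cmin_poly x) \<le> degree q" by (simp add: degree_map_poly)
qed

definition conjugates :: "complex \<Rightarrow> complex set" where
  "conjugates x = {y. poly (cmin_poly x) y = 0}"

lemma degree_cmin_poly: "degree (cmin_poly x) = alg_degree x"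
  by (simp add: alg_degree_def degree_map_poly)

lemma cmin_poly_nonzero: "algebraic x \<Longrightarrow> cmin_poly x \<noteq> 0"
  using min_poly_over_Rats by (auto simp: min_poly_over_def)

lemma self_in_conjugates: "algebraic x \<Longrightarrow> x \<in> conjugates x"
  using min_poly_over_Rats by (auto simp: min_poly_over_def conjugates_def)

lemma finite_conjugates: "algebraic x \<Longrightarrow> finite (conjugates x)"
  unfolding conjugates_def by (intro poly_roots_finite cmin_poly_nonzero)

lemma alg_degree_pos: "algebraic x \<Longrightarrow> alg_degree x > 0"
  using self_in_conjugates[of x] cmin_poly_nonzero[of x] degree_pos_of_root[of "cmin_poly x" x]
  by (simp add: degree_cmin_poly conjugates_def)

text \<open>The minimal polynomial is minimal for each of its roots, so its derivative, being of smaller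
  degree, vanishes at none of them.\<close>

lemma rsquarefree_cmin_poly:
  assumes x: "algebraic x"
  shows "rsquarefree (cmin_poly x)"
  unfolding rsquarefree_roots
proof (intro allI notI, elim conjE)
  fix y assume y: "poly (cmin_poly x) y = 0" "poly (pderiv (cmin_poly x)) y = 0"
  let ?p = "cmin_poly x"
  have m: "min_poly_over \<rat> y ?p"
    using min_poly_over_conj[OF subfield_Rats min_poly_over_Rats[OF x] y(1)] .
  have d: "degree ?p > 0" using alg_degree_pos[OF x] by (simp add: degree_cmin_poly)
  then have "pderiv ?p \<noteq> 0" using pderiv_eq_0_iff[of ?p] by simp
  moreover have "poly_over \<rat> (pderiv ?p)"
    using m by (auto simp: poly_over_def min_poly_over_def coeff_pderiv simp del: of_nat_Suc)
  ultimately have "degree ?p \<le> degree (pderiv ?p)" using m y by (auto simp: min_poly_over_def)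
  then show False using d degree_pderiv[of ?p] by simp
qed

lemma cmin_poly_factorization:
  assumes "algebraic x"
  shows "cmin_poly x = smult (of_int (lead_coeff (min_int_poly x))) (\<Prod>\<eta>\<in>conjugates x. [:- \<eta>, 1:])"
  using complex_poly_decompose_rsquarefree[OF rsquarefree_cmin_poly[OF assms]]
  by (simp add: conjugates_def degree_map_poly coeff_map_poly)

lemma card_conjugates:
  assumes "algebraic x"
  shows "card (conjugates x) = alg_degree x"
proof -
  have "lead_coeff (min_int_poly x) \<noteq> 0"
    using is_min_int_poly_min_int_poly[OF assms] by (auto simp: is_min_int_poly_def)
  then have "alg_degree x = degree (\<Prod>\<eta>\<in>conjugates x. [:- \<eta>, 1:])"
    using arg_cong[OF cmin_poly_factorization[OF assms], of degree] by (simp add: degree_cmin_poly)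
  also have "\<dots> = card (conjugates x)" by (simp add: degree_prod_sum_eq)
  finally show ?thesis by simp
qed

lemma proots_cmin_poly:
  assumes "algebraic x"
  shows "proots (cmin_poly x) = mset_set (conjugates x)"
proof (rule multiset_eqI)
  fix y
  show "count (proots (cmin_poly x)) y = count (mset_set (conjugates x)) y"
    using rsquarefree_cmin_poly[OF assms] cmin_poly_nonzero[OF assms] finite_conjugates[OF assms]
    by (cases "y \<in> conjugates x")
      (auto simp: conjugates_def rsquarefree_root_order order_0I)
qed

lemma alg_degree_one_imp_Rats:
  assumes x: "algebraic x" and c: "conjugates x = {x}"
  shows "x \<in> \<rat>"
proof -
  let ?a = "lead_coeff (min_int_poly x)"
  have a: "?a \<noteq> 0"
    using is_min_int_poly_min_int_poly[OF x] by (auto simp: is_min_int_poly_def)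
  have "coeff (cmin_poly x) 0 = - of_int ?a * x"
    using cmin_poly_factorization[OF x] by (simp add: c)
  then have "of_int (coeff (min_int_poly x) 0) = - of_int ?a * x" by (simp add: coeff_map_poly)
  then have "x = - (of_int (coeff (min_int_poly x) 0) / of_int ?a)" using a by (simp add: field_simps)
  also have "\<dots> \<in> \<rat>" by simp
  finally show ?thesis .
qed

section \<open>Extension of embeddings to all algebraic numbers\<close>

text \<open>An embedding of a field of algebraic numbers into \<open>\<complex>\<close>, given by its graph so that extension
  is inclusion and the union of a chain is again an embedding. Together with closure under differences,
  the last condition makes the graph single-valued.\<close>

definition hom_graph :: "(complex \<times> complex) set \<Rightarrow> bool" where
  "hom_graph G \<longleftrightarrow>
     (\<forall>(a, b)\<in>G. algebraic a) \<and> (\<forall>q\<in>\<rat>. (q, q) \<in> G) \<and>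
     (\<forall>(a, b)\<in>G. \<forall>(a', b')\<in>G. (a - a', b - b') \<in> G \<and> (a * a', b * b') \<in> G) \<and>
     (\<forall>b. (0, b) \<in> G \<longrightarrow> b = 0)"

definition graph_fun :: "(complex \<times> complex) set \<Rightarrow> complex \<Rightarrow> complex" where
  "graph_fun G a = (THE b. (a, b) \<in> G)"

context
  fixes G assumes G: "hom_graph G"
begin

lemma hom_graph_algebraic: "(a, b) \<in> G \<Longrightarrow> algebraic a"
  and hom_graph_rat: "q \<in> \<rat> \<Longrightarrow> (q, q) \<in> G"
  and hom_graph_diff: "(a, b) \<in> G \<Longrightarrow> (a', b') \<in> G \<Longrightarrow> (a - a', b - b') \<in> G"
  and hom_graph_mult: "(a, b) \<in> G \<Longrightarrow> (a', b') \<in> G \<Longrightarrow> (a * a', b * b') \<in> G"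
  and hom_graph_zero: "(0, b) \<in> G \<Longrightarrow> b = 0"
  using G unfolding hom_graph_def by blast+

lemma hom_graph_add: "(a, b) \<in> G \<Longrightarrow> (a', b') \<in> G \<Longrightarrow> (a + a', b + b') \<in> G"
  using hom_graph_diff[of a b "0 - a'" "0 - b'"] hom_graph_diff[of 0 0 a' b'] hom_graph_rat[of 0]
  by simp

lemma hom_graph_unique: "(a, b) \<in> G \<Longrightarrow> (a, b') \<in> G \<Longrightarrow> b = b'"
  using hom_graph_diff[of a b a b'] hom_graph_zero by fastforce

lemma graph_fun_eq: "(a, b) \<in> G \<Longrightarrow> graph_fun G a = b"
  unfolding graph_fun_def using hom_graph_unique by blast

lemma graph_fun_mem: "a \<in> Domain G \<Longrightarrow> (a, graph_fun G a) \<in> G"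
  using graph_fun_eq by auto

lemma graph_fun_rat: "q \<in> \<rat> \<Longrightarrow> graph_fun G q = q"
  using graph_fun_eq hom_graph_rat by blast

lemma graph_fun_zero: "graph_fun G 0 = 0"
  by (rule graph_fun_rat) auto

lemma graph_fun_add:
    "a \<in> Domain G \<Longrightarrow> b \<in> Domain G \<Longrightarrow> graph_fun G (a + b) = graph_fun G a + graph_fun G b"
  and graph_fun_diff:
    "a \<in> Domain G \<Longrightarrow> b \<in> Domain G \<Longrightarrow> graph_fun G (a - b) = graph_fun G a - graph_fun G b"
  and graph_fun_mult:
    "a \<in> Domain G \<Longrightarrow> b \<in> Domain G \<Longrightarrow> graph_fun G (a * b) = graph_fun G a * graph_fun G b"
  by (intro graph_fun_eq hom_graph_add hom_graph_diff hom_graph_mult graph_fun_mem; assumption)+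

lemma subring_Domain: "subring (Domain G)"
  unfolding subring_def
proof (intro conjI ballI)
  show "1 \<in> Domain G" using DomainI[OF hom_graph_rat[of 1]] by simp
  fix x y assume "x \<in> Domain G" "y \<in> Domain G"
  then obtain x' y' where "(x, x') \<in> G" "(y, y') \<in> G" by blast
  then show "x - y \<in> Domain G" "x * y \<in> Domain G"
    using hom_graph_diff hom_graph_mult by blast+
qed

text \<open>A ring of algebraic numbers containing the rationals is a field: a nonzero constant
  coefficient of an equation for \<open>a\<close> displays \<open>1 / a\<close> as a polynomial in \<open>a\<close>.\<close>

lemma subfield_Domain: "subfield (Domain G)"
  unfolding subfield_def
proof (intro conjI ballI subring_Domain)
  note R = subring_Domain
  have rat: "q \<in> Domain G" if "q \<in> \<rat>" for q using hom_graph_rat[OF that] by blast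
  fix a assume a: "a \<in> Domain G"
  show "inverse a \<in> Domain G"
  proof (cases "a = 0")
    case False
    have "algebraic a" using a hom_graph_algebraic by blast
    then obtain p where p: "coeff p 0 \<noteq> 0" "poly (map_poly of_int p) a = 0"
      using False algebraicE'_nonzero[of a] by blast
    obtain c f where f: "map_poly complex_of_int p = pCons c f"
      by (cases "map_poly complex_of_int p")
    have cf: "coeff (pCons c f) i = of_int (coeff p i)" for i
      by (simp add: coeff_map_poly flip: f)
    have c: "c \<in> \<rat>" "c \<noteq> 0" using cf[of 0] p(1) by auto
    have "poly_over (Domain G) f"
      unfolding poly_over_def
    proof (intro allI rat)
      show "coeff f i \<in> \<rat>" for i using cf[of "Suc i"] by simp
    qed
    then have fa: "poly f a \<in> Domain G" using poly_over_mem[OF R] a by blast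
    have "c + a * poly f a = 0" using p(2) by (simp add: f)
    then have "a * poly f a = - c" by (simp add: eq_neg_iff_add_eq_0 add.commute)
    moreover have "a * (- inverse c * poly f a) = - inverse c * (a * poly f a)" by (simp add: mult_ac)
    ultimately have "a * (- inverse c * poly f a) = 1" using c(2) by simp
    then have "inverse a = - inverse c * poly f a" by (rule inverse_unique)
    also have "\<dots> \<in> Domain G" using c by (intro subring_mult[OF R rat fa]) simp
    finally show ?thesis .
  qed (use a in simp)
qed

lemma graph_fun_nonzero:
  assumes "a \<in> Domain G" "a \<noteq> 0"
  shows "graph_fun G a \<noteq> 0"
proof -
  have i: "inverse a \<in> Domain G"
    using subfield_Domain assms(1) by (auto simp: subfield_def)
  have "graph_fun G a * graph_fun G (inverse a) = graph_fun G 1"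
    using graph_fun_mult[OF assms(1) i] assms by simp
  then show ?thesis using graph_fun_rat[of 1] by auto
qed

abbreviation "map_graph \<equiv> map_poly (graph_fun G)"

lemma coeff_map_graph: "coeff (map_graph f) i = graph_fun G (coeff f i)"
  using graph_fun_zero by (simp add: coeff_map_poly)

lemma graph_fun_sum:
  assumes "\<And>i. i \<in> I \<Longrightarrow> f i \<in> Domain G"
  shows "graph_fun G (sum f I) = (\<Sum>i\<in>I. graph_fun G (f i))"
  using assms
  by (induction I rule: infinite_finite_induct)
    (simp_all add: graph_fun_zero graph_fun_add subring_sum[OF subring_Domain])

lemma map_graph_diff:
  "poly_over (Domain G) f \<Longrightarrow> poly_over (Domain G) g \<Longrightarrow> map_graph (f - g) = map_graph f - map_graph g"
  by (intro poly_eqI) (simp add: coeff_map_graph poly_over_def graph_fun_diff)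

lemma map_graph_mult:
  assumes "poly_over (Domain G) f" "poly_over (Domain G) g"
  shows "map_graph (f * g) = map_graph f * map_graph g"
proof (rule poly_eqI)
  fix n
  have "graph_fun G (\<Sum>i\<le>n. coeff f i * coeff g (n - i)) =
      (\<Sum>i\<le>n. graph_fun G (coeff f i * coeff g (n - i)))"
    using assms subring_mult[OF subring_Domain]
    by (intro graph_fun_sum) (simp add: poly_over_def)
  also have "\<dots> = (\<Sum>i\<le>n. graph_fun G (coeff f i) * graph_fun G (coeff g (n - i)))"
    using assms by (intro sum.cong refl graph_fun_mult) (simp_all add: poly_over_def)
  finally show "coeff (map_graph (f * g)) n = coeff (map_graph f * map_graph g) n"
    by (simp add: coeff_mult coeff_map_graph)
qed

lemma map_graph_rat: "poly_over \<rat> f \<Longrightarrow> map_graph f = f"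
  by (intro poly_eqI) (simp add: coeff_map_graph graph_fun_rat poly_over_def)

text \<open>One step of the extension: \<open>x\<close> may be sent to any root of the transported minimal
  polynomial.\<close>

lemma hom_graph_adjoin:
  assumes p: "min_poly_over (Domain G) x p" and y: "poly (map_graph p) y = 0"
    and x: "algebraic x"
  shows "\<exists>G'. hom_graph G' \<and> G \<subseteq> G' \<and> (x, y) \<in> G'"
proof (intro exI conjI)
  let ?K = "Domain G"
  define G' where "G' = {(poly f x, poly (map_graph f) y) | f. poly_over ?K f}"
  note R = subring_Domain
  have rat: "q \<in> ?K" if "q \<in> \<rat>" for q using hom_graph_rat[OF that] by blast
  have map_const: "map_graph [:a:] = [:graph_fun G a:]" for a
    by (intro poly_eqI) (auto simp: coeff_map_graph coeff_pCons graph_fun_zero split: nat.splits)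
  show sub: "G \<subseteq> G'"
  proof
    fix z assume z: "z \<in> G"
    obtain a b where ab: "z = (a, b)" by (cases z)
    then have "poly_over ?K [:a:]" using z by (intro poly_over_const[OF R]) auto
    moreover have "z = (poly [:a:] x, poly (map_graph [:a:]) y)"
      using z ab graph_fun_eq by (simp add: map_const)
    ultimately show "z \<in> G'" unfolding G'_def by blast
  qed
  have "poly_over ?K [:0, 1:]"
    using rat by (intro poly_over_pCons[OF R] poly_over_zero[OF R]) auto
  moreover have "map_graph [:0, 1:] = [:0, 1:]"
    by (rule map_graph_rat) (auto simp: poly_over_def coeff_pCons split: nat.splits)
  ultimately show "(x, y) \<in> G'" unfolding G'_def
    by (auto intro!: exI[of _ "[:0, 1:]"])
  show "hom_graph G'"
    unfolding hom_graph_def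
  proof (intro conjI)
    show "\<forall>(a, b)\<in>G'. algebraic a"
    proof (clarify)
      fix a b assume "(a, b) \<in> G'"
      then obtain f where f: "poly_over ?K f" "a = poly f x" by (auto simp: G'_def)
      then have "poly_over {x. algebraic x} f"
        using hom_graph_algebraic unfolding poly_over_def by blast
      then show "algebraic a" using poly_over_mem[OF subring_algebraic] x f by auto
    qed
    show "\<forall>q\<in>\<rat>. (q, q) \<in> G'" using hom_graph_rat sub by blast
    show "\<forall>(a, b)\<in>G'. \<forall>(a', b')\<in>G'. (a - a', b - b') \<in> G' \<and> (a * a', b * b') \<in> G'"
    proof clarify
      fix a b a' b' assume "(a, b) \<in> G'" "(a', b') \<in> G'"
      then obtain f g where fg: "poly_over ?K f" "poly_over ?K g"
        "a = poly f x" "b = poly (map_graph f) y" "a' = poly g x" "b' = poly (map_graph g) y"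
        by (auto simp: G'_def)
      then have "a - a' = poly (f - g) x" "b - b' = poly (map_graph (f - g)) y"
        "a * a' = poly (f * g) x" "b * b' = poly (map_graph (f * g)) y"
        by (auto simp: map_graph_diff map_graph_mult)
      then show "(a - a', b - b') \<in> G' \<and> (a * a', b * b') \<in> G'"
        using poly_over_diff[OF R fg(1,2)] poly_over_mult[OF R fg(1,2)]
        unfolding G'_def by blast
    qed
    show "\<forall>b. (0, b) \<in> G' \<longrightarrow> b = 0"
    proof (intro allI impI)
      fix b assume "(0, b) \<in> G'"
      then obtain f where f: "poly_over ?K f" "poly f x = 0" "b = poly (map_graph f) y"
        by (auto simp: G'_def)
      obtain q where q: "poly_over ?K q" "f = p * q"
        using min_poly_over_dvd[OF subfield_Domain p f(1,2)] by blast
      have "map_graph f = map_graph p * map_graph q"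
        unfolding q(2) using p q(1) by (intro map_graph_mult) (auto simp: min_poly_over_def)
      then show "b = 0" using y by (simp add: f(3))
    qed
  qed
qed

end

lemma hom_graph_Rats: "hom_graph {(q, q) | q. q \<in> \<rat>}"
  by (auto simp: hom_graph_def algebraic_rat)

text \<open>Zorn's lemma gives a maximal extension, and by \<open>hom_graph_adjoin\<close> no algebraic number can be missing
  from its domain.\<close>

lemma hom_graph_extends:
  assumes G: "hom_graph G"
  shows "\<exists>M. hom_graph M \<and> G \<subseteq> M \<and> Domain M = {x. algebraic x}"
proof -
  define \<A> where "\<A> = {X. hom_graph X \<and> G \<subseteq> X}"
  have ne: "\<A> \<noteq> {}" using G by (auto simp: \<A>_def)
  have chain: "\<Union>C \<in> \<A>" if C: "C \<noteq> {}" "subset.chain \<A> C" for C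
  proof -
    have CA: "hom_graph X" "G \<subseteq> X" if "X \<in> C" for X
      using C that by (auto simp: subset.chain_def \<A>_def)
    have two: "\<exists>Z\<in>C. u \<in> Z \<and> v \<in> Z" if "u \<in> \<Union>C" "v \<in> \<Union>C" for u v
      using that C(2) unfolding subset.chain_def by blast
    have "hom_graph (\<Union>C)"
      unfolding hom_graph_def
    proof (intro conjI)
      show "\<forall>(a, b)\<in>\<Union>C. algebraic a" using CA hom_graph_algebraic by blast
      show "\<forall>q\<in>\<rat>. (q, q) \<in> \<Union>C" using C(1) CA hom_graph_rat by blast
      show "\<forall>(a, b)\<in>\<Union>C. \<forall>(a', b')\<in>\<Union>C. (a - a', b - b') \<in> \<Union>C \<and> (a * a', b * b') \<in> \<Union>C"
      proof clarify
        fix a b a' b' X Y assume "(a, b) \<in> X" "X \<in> C" "(a', b') \<in> Y" "Y \<in> C"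
        then obtain Z where Z: "Z \<in> C" "(a, b) \<in> Z" "(a', b') \<in> Z"
          using two[of "(a, b)" "(a', b')"] by blast
        then show "(a - a', b - b') \<in> \<Union>C \<and> (a * a', b * b') \<in> \<Union>C"
          using hom_graph_diff[OF CA(1)[OF Z(1)] Z(2,3)] hom_graph_mult[OF CA(1)[OF Z(1)] Z(2,3)]
          by blast
      qed
      show "\<forall>b. (0, b) \<in> \<Union>C \<longrightarrow> b = 0" using CA hom_graph_zero by blast
    qed
    then show ?thesis using CA C(1) by (auto simp: \<A>_def)
  qed
  obtain M where MA: "M \<in> \<A>" and max: "\<And>X. X \<in> \<A> \<Longrightarrow> M \<subseteq> X \<Longrightarrow> X = M"
    using subset_Zorn_nonempty[OF ne chain] by blast
  have M: "hom_graph M" "G \<subseteq> M" using MA by (auto simp: \<A>_def)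
  have "x \<in> Domain M" if x: "algebraic x" for x
  proof -
    note m = min_poly_over_Rats[OF x, unfolded min_poly_over_def]
    have "\<rat> \<subseteq> Domain M" using hom_graph_rat[OF M(1)] by blast
    then have "poly_over (Domain M) (cmin_poly x)"
      using m unfolding poly_over_def by blast
    then obtain p where p: "min_poly_over (Domain M) x p"
      using ex_min_poly_over m by blast
    note pm = p[unfolded min_poly_over_def]
    have "degree p > 0" using pm by (intro degree_pos_of_root[of p x]) auto
    moreover have "coeff (map_poly (graph_fun M) p) (degree p) \<noteq> 0"
      unfolding coeff_map_graph[OF M(1)]
      using pm by (intro graph_fun_nonzero[OF M(1)]) (simp_all add: poly_over_def)
    ultimately have "degree (map_poly (graph_fun M) p) > 0"
      by (meson le_degree less_le_trans)
    then obtain y where "poly (map_poly (graph_fun M) p) y = 0"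
      using alg_closed_imp_poly_has_root by blast
    then obtain G' where G': "hom_graph G'" "M \<subseteq> G'" "(x, y) \<in> G'"
      using hom_graph_adjoin[OF M(1) p _ x] by blast
    then have "G' = M" using max M by (auto simp: \<A>_def)
    then show ?thesis using G' by blast
  qed
  then show ?thesis using M hom_graph_algebraic[OF M(1)] by blast
qed

section \<open>The Galois action\<close>

lemma hom_image_root:
  assumes add: "\<And>a b. algebraic a \<Longrightarrow> algebraic b \<Longrightarrow> s (a + b) = s a + s b"
    and mult: "\<And>a b. algebraic a \<Longrightarrow> algebraic b \<Longrightarrow> s (a * b) = s a * s b"
    and rat: "\<And>q. q \<in> \<rat> \<Longrightarrow> s q = q"
    and x: "algebraic x" and P: "poly_over \<rat> P" "poly P x = 0"
  shows "poly P (s x) = 0"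
proof -
  have "s (poly f x) = poly f (s x) \<and> algebraic (poly f x)" if "poly_over \<rat> f" for f
    using that
  proof (induction f)
    case 0
    then show ?case using rat[of 0] by simp
  next
    case (pCons c f)
    have c: "c \<in> \<rat>" "poly_over \<rat> f"
      using pCons.prems unfolding poly_over_def by (metis coeff_pCons_0, metis coeff_pCons_Suc)
    then show ?case
      using pCons.IH x algebraic_rat[OF c(1)] algebraic_add algebraic_mult add mult rat by simp
  qed
  from this[OF P(1)] show ?thesis using P(2) rat[of 0] by simp
qed

lemma poly_over_Rats_cmin_poly: "poly_over \<rat> (cmin_poly x)"
  by (auto simp: poly_over_def coeff_map_poly)

lemma galois_conjugates:
  assumes "s \<in> absolute_galois" "algebraic x"
  shows "s x \<in> conjugates x"
proof -
  have "poly (cmin_poly x) (s x) = 0"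
    by (rule hom_image_root)
      (use assms poly_over_Rats_cmin_poly min_poly_over_Rats in
        \<open>auto simp: absolute_galois_def min_poly_over_def\<close>)
  then show ?thesis by (simp add: conjugates_def)
qed

lemma algebraic_conjugates: "algebraic x \<Longrightarrow> y \<in> conjugates x \<Longrightarrow> algebraic y"
  using poly_over_Rats_cmin_poly[of x] cmin_poly_nonzero[of x]
  by (intro algebraicI'[of "cmin_poly x"]) (auto simp: poly_over_def conjugates_def)

text \<open>The embedding of \<open>\<rat>(x)\<close> that sends \<open>x\<close> to \<open>y\<close> extends to all algebraic numbers. The extension is
  surjective because it permutes the finite set of conjugates of each number.\<close>

theorem galois_transitive:
  assumes x: "algebraic x" and y: "y \<in> conjugates x"
  shows "\<exists>s\<in>absolute_galois. s x = y"
proof -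
  define Q :: "(complex \<times> complex) set" where "Q = {(q, q) | q. q \<in> \<rat>}"
  have Q: "hom_graph Q" "Domain Q = \<rat>" using hom_graph_Rats by (auto simp: Q_def)
  have "min_poly_over (Domain Q) x (cmin_poly x)" using min_poly_over_Rats[OF x] Q by simp
  moreover have "poly (map_poly (graph_fun Q) (cmin_poly x)) y = 0"
    using y map_graph_rat[OF Q(1) poly_over_Rats_cmin_poly] by (simp add: conjugates_def)
  ultimately obtain G where G: "hom_graph G" "(x, y) \<in> G"
    using hom_graph_adjoin[OF Q(1) _ _ x] by blast
  obtain M where M: "hom_graph M" "G \<subseteq> M" "Domain M = {x. algebraic x}"
    using hom_graph_extends[OF G(1)] by blast
  define s where "s = graph_fun M"
  note hom = graph_fun_add[OF M(1)] graph_fun_mult[OF M(1)] graph_fun_rat[OF M(1)]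
  have root: "poly P (s a) = 0" if "algebraic a" "poly_over \<rat> P" "poly P a = 0" for P a
    unfolding s_def by (rule hom_image_root) (use hom M(3) that in auto)
  have alg: "algebraic (s a)" if a: "algebraic a" for a
    using root[OF a poly_over_Rats_cmin_poly[of a]] self_in_conjugates[OF a]
    by (intro algebraic_conjugates[OF a]) (simp add: conjugates_def)
  have inj: "inj_on s {x. algebraic x}"
  proof (rule inj_onI)
    fix a b assume ab: "a \<in> {x. algebraic x}" "b \<in> {x. algebraic x}" "s a = s b"
    have D: "a - b \<in> Domain M" using ab algebraic_diff M(3) by simp
    have "s (a - b) = 0" using ab graph_fun_diff[OF M(1)] M(3) by (simp add: s_def)
    then show "a = b" using graph_fun_nonzero[OF M(1) D] by (auto simp: s_def)
  qed
  have surj: "b \<in> s ` {x. algebraic x}" if b: "algebraic b" for b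
  proof -
    have "s ` conjugates b \<subseteq> conjugates b"
      using root[OF _ poly_over_Rats_cmin_poly[of b]] algebraic_conjugates[OF b]
      by (auto simp: conjugates_def)
    moreover have "inj_on s (conjugates b)"
      using inj algebraic_conjugates[OF b] by (auto intro: inj_on_subset)
    ultimately have "s ` conjugates b = conjugates b"
      using endo_inj_surj[OF finite_conjugates[OF b]] by blast
    then show ?thesis using self_in_conjugates[OF b] algebraic_conjugates[OF b] by blast
  qed
  have "bij_betw s {x. algebraic x} {x. algebraic x}"
    using inj surj alg by (auto simp: bij_betw_def)
  then have "s \<in> absolute_galois"
    using hom M(3) by (auto simp: absolute_galois_def s_def)
  moreover have "s x = y" using graph_fun_eq[OF M(1)] G M by (auto simp: s_def)
  ultimately show ?thesis by blast
qed

definition galois_act :: "(complex \<Rightarrow> complex) \<Rightarrow> complex ^ 'n \<Rightarrow> complex ^ 'n" where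
  "galois_act s \<alpha> = (\<chi> j. s (\<alpha> $ j))"

lemma absolute_galois_add:
    "s \<in> absolute_galois \<Longrightarrow> algebraic x \<Longrightarrow> algebraic y \<Longrightarrow> s (x + y) = s x + s y"
  and absolute_galois_mult:
    "s \<in> absolute_galois \<Longrightarrow> algebraic x \<Longrightarrow> algebraic y \<Longrightarrow> s (x * y) = s x * s y"
  and absolute_galois_rat: "s \<in> absolute_galois \<Longrightarrow> q \<in> \<rat> \<Longrightarrow> s q = q"
  and absolute_galois_inj: "s \<in> absolute_galois \<Longrightarrow> inj_on s {x. algebraic x}"
  and absolute_galois_algebraic: "s \<in> absolute_galois \<Longrightarrow> algebraic x \<Longrightarrow> algebraic (s x)"
  unfolding absolute_galois_def bij_betw_def by blast+

lemma absolute_galois_diff: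
  assumes "s \<in> absolute_galois" "algebraic x" "algebraic y"
  shows "s (x - y) = s x - s y"
  using absolute_galois_add[OF assms(1) algebraic_diff[OF assms(2,3)] assms(3)] by simp

lemma absolute_galois_zero: "s \<in> absolute_galois \<Longrightarrow> s 0 = 0"
  and absolute_galois_one: "s \<in> absolute_galois \<Longrightarrow> s 1 = 1"
  by (auto intro: absolute_galois_rat)

lemma absolute_galois_inverse:
  assumes s: "s \<in> absolute_galois" and x: "algebraic x"
  shows "s (inverse x) = inverse (s x)"
proof (cases "x = 0")
  case True
  then show ?thesis using absolute_galois_zero[OF s] by simp
next
  case False
  have "s x * s (inverse x) = 1"
    using absolute_galois_mult[OF s x algebraic_inverse[OF x]] False absolute_galois_one[OF s] by simp
  then show ?thesis using inverse_unique by metis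
qed

lemma algebraic_power: "algebraic (x :: complex) \<Longrightarrow> algebraic (x ^ k)"
  by (induction k) (auto intro: algebraic_mult algebraic_rat)

lemma absolute_galois_power:
  "s \<in> absolute_galois \<Longrightarrow> algebraic x \<Longrightarrow> s (x ^ k) = s x ^ k"
  by (induction k) (auto simp: absolute_galois_mult algebraic_power absolute_galois_one)

lemma algebraic_prod: "(\<And>i. i \<in> I \<Longrightarrow> algebraic (f i :: complex)) \<Longrightarrow> algebraic (prod f I)"
  by (induction I rule: infinite_finite_induct) (auto intro: algebraic_mult algebraic_rat)

lemma absolute_galois_prod:
  "s \<in> absolute_galois \<Longrightarrow> (\<And>i. i \<in> I \<Longrightarrow> algebraic (f i)) \<Longrightarrow> s (prod f I) = (\<Prod>i\<in>I. s (f i))"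
  by (induction I rule: infinite_finite_induct)
    (auto simp: absolute_galois_mult algebraic_prod absolute_galois_one)

lemma absolute_galois_id: "(\<lambda>x. x) \<in> absolute_galois"
  by (auto simp: absolute_galois_def bij_betw_def)

lemma absolute_galois_comp:
  assumes "s \<in> absolute_galois" "t \<in> absolute_galois"
  shows "(\<lambda>x. s (t x)) \<in> absolute_galois"
proof -
  have "bij_betw (s \<circ> t) {x. algebraic x} {x. algebraic x}"
    using assms by (intro bij_betw_trans[of t _ "{x. algebraic x}"]) (auto simp: absolute_galois_def)
  then show ?thesis
    using assms absolute_galois_algebraic[OF assms(2)]
    by (auto simp: absolute_galois_def comp_def)
qed

text \<open>Both minimal polynomials are minimal for \<open>y\<close>, so each divides the other.\<close>

lemma conjugates_eq:
  assumes x: "algebraic x" and y: "y \<in> conjugates x"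
  shows "conjugates y = conjugates x"
proof -
  have ya: "algebraic y" using algebraic_conjugates[OF x y] .
  have "min_poly_over \<rat> y (cmin_poly x)"
    using min_poly_over_conj[OF subfield_Rats min_poly_over_Rats[OF x]] y
    by (simp add: conjugates_def)
  moreover have "min_poly_over \<rat> y (cmin_poly y)" by (rule min_poly_over_Rats[OF ya])
  ultimately obtain f g where "cmin_poly x = cmin_poly y * f" "cmin_poly y = cmin_poly x * g"
    using min_poly_over_dvd[OF subfield_Rats] unfolding min_poly_over_def by metis
  then have "poly (cmin_poly x) z = poly (cmin_poly y) z * poly f z"
    "poly (cmin_poly y) z = poly (cmin_poly x) z * poly g z" for z
    by (metis poly_mult)+
  then have "poly (cmin_poly x) z = 0 \<longleftrightarrow> poly (cmin_poly y) z = 0" for z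
    by (metis mult_eq_0_iff)
  then show ?thesis unfolding conjugates_def by auto
qed

locale galois_setting =
  fixes \<xi> :: "complex ^ 'n"
  assumes xi_algebraic: "algebraic (\<xi> $ j)"
begin

definition S where "S = galois_orbit \<xi>"

lemma S_eq: "S = (\<lambda>s. galois_act s \<xi>) ` absolute_galois"
  by (simp add: S_def galois_orbit_def galois_act_def)

lemma xi_in_S: "\<xi> \<in> S"
  unfolding S_eq by (rule image_eqI[OF _ absolute_galois_id]) (simp add: galois_act_def)

lemma S_conjugates: "\<alpha> \<in> S \<Longrightarrow> \<alpha> $ j \<in> conjugates (\<xi> $ j)"
  unfolding S_eq galois_act_def using galois_conjugates[OF _ xi_algebraic] by auto

lemma S_algebraic: "\<alpha> \<in> S \<Longrightarrow> algebraic (\<alpha> $ j)"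
  using algebraic_conjugates[OF xi_algebraic S_conjugates] .

lemma finite_S: "finite S"
proof (rule finite_subset)
  show "S \<subseteq> vec_lambda ` (\<Pi>\<^sub>E j\<in>UNIV. conjugates (\<xi> $ j))"
  proof
    fix \<alpha> assume "\<alpha> \<in> S"
    then have "(\<lambda>j. \<alpha> $ j) \<in> (\<Pi>\<^sub>E j\<in>UNIV. conjugates (\<xi> $ j))" using S_conjugates by auto
    moreover have "\<alpha> = vec_lambda (\<lambda>j. \<alpha> $ j)" by simp
    ultimately show "\<alpha> \<in> vec_lambda ` (\<Pi>\<^sub>E j\<in>UNIV. conjugates (\<xi> $ j))" by (metis image_eqI)
  qed
  show "finite (vec_lambda ` (\<Pi>\<^sub>E j\<in>UNIV. conjugates (\<xi> $ j)))"
    by (intro finite_imageI finite_PiE finite_conjugates xi_algebraic) auto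
qed

definition M where "M = card S"

lemma M_pos: "M > 0"
  using finite_S xi_in_S by (auto simp: M_def card_gt_0_iff)

lemma galois_act_S: "s \<in> absolute_galois \<Longrightarrow> \<alpha> \<in> S \<Longrightarrow> galois_act s \<alpha> \<in> S"
  unfolding S_eq using absolute_galois_comp
  by (auto simp: galois_act_def intro!: image_eqI)

lemma galois_act_inj: "s \<in> absolute_galois \<Longrightarrow> inj_on (galois_act s) S"
  using absolute_galois_inj S_algebraic
  by (auto simp: inj_on_def galois_act_def vec_eq_iff)

text \<open>Functions on the orbit that commute with the Galois action, such as coordinates and monomials. They
  transport averages over the orbit to averages over conjugates.\<close>

definition equivariant :: "(complex ^ 'n \<Rightarrow> complex) \<Rightarrow> bool" where
  "equivariant \<phi> \<longleftrightarrow> (\<forall>\<alpha>\<in>S. algebraic (\<phi> \<alpha>) \<and>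
     (\<forall>s\<in>absolute_galois. \<phi> (galois_act s \<alpha>) = s (\<phi> \<alpha>)))"

lemma equivariant_algebraic: "equivariant \<phi> \<Longrightarrow> \<alpha> \<in> S \<Longrightarrow> algebraic (\<phi> \<alpha>)"
  by (simp add: equivariant_def)

lemma equivariant_image:
  assumes \<phi>: "equivariant \<phi>"
  shows "\<phi> ` S = conjugates (\<phi> \<xi>)"
proof
  show "\<phi> ` S \<subseteq> conjugates (\<phi> \<xi>)"
    using \<phi> xi_in_S galois_conjugates unfolding equivariant_def S_eq by auto
  show "conjugates (\<phi> \<xi>) \<subseteq> \<phi> ` S"
  proof
    fix y assume "y \<in> conjugates (\<phi> \<xi>)"
    then obtain s where s: "s \<in> absolute_galois" "s (\<phi> \<xi>) = y"
      using galois_transitive \<phi> xi_in_S by (metis equivariant_def)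
    then have "y = \<phi> (galois_act s \<xi>)" using \<phi> xi_in_S by (simp add: equivariant_def)
    then show "y \<in> \<phi> ` S" using galois_act_S[OF s(1) xi_in_S] by blast
  qed
qed

text \<open>An automorphism that maps \<open>a\<close> to \<open>b\<close> maps the fibre over \<open>a\<close> injectively into the fibre over \<open>b\<close>, so
  all fibres have the same size.\<close>

lemma equivariant_fibre:
  assumes \<phi>: "equivariant \<phi>" and y: "y \<in> conjugates (\<phi> \<xi>)"
  shows "card {\<alpha>\<in>S. \<phi> \<alpha> = y} * alg_degree (\<phi> \<xi>) = M"
proof -
  let ?x = "\<phi> \<xi>"
  have x: "algebraic ?x" using \<phi> xi_in_S by (simp add: equivariant_def)
  have le: "card {\<alpha>\<in>S. \<phi> \<alpha> = a} \<le> card {\<alpha>\<in>S. \<phi> \<alpha> = b}"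
    if ab: "a \<in> conjugates ?x" "b \<in> conjugates ?x" for a b
  proof -
    have "algebraic a" "b \<in> conjugates a"
      using algebraic_conjugates[OF x ab(1)] conjugates_eq[OF x ab(1)] ab by auto
    then obtain s where s: "s \<in> absolute_galois" "s a = b" using galois_transitive by blast
    show ?thesis
    proof (rule card_inj_on_le[of "galois_act s"])
      show "inj_on (galois_act s) {\<alpha>\<in>S. \<phi> \<alpha> = a}"
        using galois_act_inj[OF s(1)] by (auto intro: inj_on_subset)
      show "galois_act s ` {\<alpha>\<in>S. \<phi> \<alpha> = a} \<subseteq> {\<alpha>\<in>S. \<phi> \<alpha> = b}"
        using galois_act_S[OF s(1)] \<phi> s by (auto simp: equivariant_def)
    qed (use finite_S in auto)
  qed
  have "M = (\<Sum>b\<in>conjugates ?x. card {\<alpha>\<in>S. \<phi> \<alpha> = b})"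
    using sum_fun_comp[OF finite_S finite_conjugates[OF x], of \<phi> "\<lambda>_. 1 :: nat"]
      equivariant_image[OF \<phi>] by (simp add: M_def)
  also have "\<dots> = (\<Sum>b\<in>conjugates ?x. card {\<alpha>\<in>S. \<phi> \<alpha> = y})"
    using le y by (intro sum.cong refl antisym) auto
  also have "\<dots> = card {\<alpha>\<in>S. \<phi> \<alpha> = y} * alg_degree ?x"
    by (simp add: card_conjugates[OF x])
  finally show ?thesis by simp
qed

definition fibre_size where "fibre_size \<phi> = M div alg_degree (\<phi> \<xi>)"

lemma fibre_size:
  assumes "equivariant \<phi>"
  shows "fibre_size \<phi> * alg_degree (\<phi> \<xi>) = M"
    and "y \<in> conjugates (\<phi> \<xi>) \<Longrightarrow> card {\<alpha>\<in>S. \<phi> \<alpha> = y} = fibre_size \<phi>"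
proof -
  have x: "algebraic (\<phi> \<xi>)" using assms xi_in_S by (simp add: equivariant_def)
  have *: "card {\<alpha>\<in>S. \<phi> \<alpha> = y} = fibre_size \<phi>" if "y \<in> conjugates (\<phi> \<xi>)" for y
    using equivariant_fibre[OF assms that] alg_degree_pos[OF x] unfolding fibre_size_def
    by (metis div_mult_self_is_m)
  show "y \<in> conjugates (\<phi> \<xi>) \<Longrightarrow> card {\<alpha>\<in>S. \<phi> \<alpha> = y} = fibre_size \<phi>" by (rule *)
  show "fibre_size \<phi> * alg_degree (\<phi> \<xi>) = M"
    using equivariant_fibre[OF assms self_in_conjugates[OF x]] *[OF self_in_conjugates[OF x]] by simp
qed

lemma equivariant_sum:
  fixes g :: "complex \<Rightarrow> real"
  assumes "equivariant \<phi>"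
  shows "(\<Sum>\<alpha>\<in>S. g (\<phi> \<alpha>)) = real (fibre_size \<phi>) * (\<Sum>y\<in>conjugates (\<phi> \<xi>). g y)"
proof -
  have x: "algebraic (\<phi> \<xi>)" using assms xi_in_S by (simp add: equivariant_def)
  have "(\<Sum>\<alpha>\<in>S. g (\<phi> \<alpha>)) = (\<Sum>y\<in>conjugates (\<phi> \<xi>). of_nat (card {\<alpha>\<in>S. \<phi> \<alpha> = y}) * g y)"
    using sum_fun_comp[OF finite_S finite_conjugates[OF x], of \<phi> g] equivariant_image[OF assms] by simp
  also have "\<dots> = (\<Sum>y\<in>conjugates (\<phi> \<xi>). real (fibre_size \<phi>) * g y)"
    using fibre_size(2)[OF assms] by (intro sum.cong) auto
  finally show ?thesis by (simp add: sum_distrib_left)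
qed

lemma equivariant_prod:
  fixes g :: "complex \<Rightarrow> complex"
  assumes "equivariant \<phi>"
  shows "(\<Prod>\<alpha>\<in>S. g (\<phi> \<alpha>)) = (\<Prod>y\<in>conjugates (\<phi> \<xi>). g y) ^ fibre_size \<phi>"
proof -
  have x: "algebraic (\<phi> \<xi>)" using assms xi_in_S by (simp add: equivariant_def)
  have "(\<Prod>\<alpha>\<in>S. g (\<phi> \<alpha>)) = (\<Prod>y\<in>\<phi> ` S. \<Prod>\<alpha>\<in>{\<alpha>\<in>S. \<phi> \<alpha> = y}. g (\<phi> \<alpha>))"
    by (rule prod.image_gen[OF finite_S])
  also have "\<dots> = (\<Prod>y\<in>conjugates (\<phi> \<xi>). g y ^ fibre_size \<phi>)"
    using fibre_size(2)[OF assms] by (intro prod.cong equivariant_image[OF assms]) auto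
  finally show ?thesis by (simp add: prod_power_distrib)
qed

lemma card_equal_pairs:
  assumes \<phi>: "equivariant \<phi>"
  shows "card {(\<alpha>, \<alpha>')\<in>S \<times> S. \<phi> \<alpha> = \<phi> \<alpha>'} = M * fibre_size \<phi>"
proof -
  have "{(\<alpha>, \<alpha>')\<in>S \<times> S. \<phi> \<alpha> = \<phi> \<alpha>'} = (SIGMA \<alpha>:S. {\<alpha>'\<in>S. \<phi> \<alpha>' = \<phi> \<alpha>})" by auto
  also have "card \<dots> = (\<Sum>\<alpha>\<in>S. card {\<alpha>'\<in>S. \<phi> \<alpha>' = \<phi> \<alpha>})"
    using finite_S by (intro card_SigmaI) auto
  also have "\<dots> = (\<Sum>\<alpha>\<in>S. fibre_size \<phi>)"
    using equivariant_image[OF \<phi>] by (intro sum.cong refl fibre_size(2)[OF \<phi>]) auto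
  finally show ?thesis by (simp add: M_def)
qed

lemma equivariant_coordinate: "equivariant (\<lambda>\<alpha>. \<alpha> $ j)"
  using S_algebraic by (simp add: equivariant_def galois_act_def)

lemma equivariant_power: "equivariant \<phi> \<Longrightarrow> equivariant (\<lambda>\<alpha>. \<phi> \<alpha> ^ k)"
  by (simp add: equivariant_def algebraic_power absolute_galois_power)

lemma equivariant_inverse: "equivariant \<phi> \<Longrightarrow> equivariant (\<lambda>\<alpha>. inverse (\<phi> \<alpha>))"
  by (auto simp: equivariant_def absolute_galois_inverse)

lemma equivariant_prodI:
  "(\<And>i. i \<in> I \<Longrightarrow> equivariant (f i)) \<Longrightarrow> equivariant (\<lambda>\<alpha>. \<Prod>i\<in>I. f i \<alpha>)"
  unfolding equivariant_def
  by (auto intro!: algebraic_prod simp: absolute_galois_prod)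

text \<open>An expression in the orbit that the Galois action merely permutes is rational.\<close>

lemma difference_product_rational:
  assumes \<phi>: "equivariant \<phi>"
  shows "(\<Prod>(\<alpha>, \<alpha>')\<in>{(\<alpha>, \<alpha>')\<in>S \<times> S. \<phi> \<alpha> \<noteq> \<phi> \<alpha>'}. \<phi> \<alpha> - \<phi> \<alpha>') \<in> \<rat>"
proof -
  define E where "E = {(\<alpha>, \<alpha>')\<in>S \<times> S. \<phi> \<alpha> \<noteq> \<phi> \<alpha>'}"
  define D where "D = (\<Prod>z\<in>E. \<phi> (fst z) - \<phi> (snd z))"
  note alg = equivariant_algebraic[OF \<phi>]
  have finE: "finite E" using finite_S by (auto simp: E_def intro: finite_subset[of _ "S \<times> S"])
  have D_alg: "algebraic D"
    unfolding D_def by (intro algebraic_prod algebraic_diff alg) (auto simp: E_def)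
  have fixed: "s D = D" if s: "s \<in> absolute_galois" for s
  proof -
    let ?m = "map_prod (galois_act s) (galois_act s)"
    have eq: "\<phi> (galois_act s \<alpha>) = s (\<phi> \<alpha>)" if "\<alpha> \<in> S" for \<alpha>
      using \<phi> s that by (simp add: equivariant_def)
    have "s D = (\<Prod>z\<in>E. s (\<phi> (fst z) - \<phi> (snd z)))"
      unfolding D_def by (intro absolute_galois_prod[OF s] algebraic_diff alg) (auto simp: E_def)
    also have "\<dots> = (\<Prod>z\<in>E. \<phi> (fst (?m z)) - \<phi> (snd (?m z)))"
      by (intro prod.cong refl) (auto simp: E_def absolute_galois_diff[OF s] alg eq)
    also have "\<dots> = (\<Prod>z\<in>?m ` E. \<phi> (fst z) - \<phi> (snd z))"
    proof (rule prod.reindex[symmetric, unfolded comp_def])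
      show "inj_on ?m E"
        using galois_act_inj[OF s] by (auto simp: E_def inj_on_def)
    qed
    also have "?m ` E = E"
    proof (rule endo_inj_surj[OF finE])
      show "inj_on ?m E" using galois_act_inj[OF s] by (auto simp: E_def inj_on_def)
      show "?m ` E \<subseteq> E"
        using galois_act_S[OF s] alg inj_onD[OF absolute_galois_inj[OF s]]
        by (auto simp: E_def eq)
    qed
    finally show ?thesis by (simp add: D_def)
  qed
  then have "conjugates D = {D}"
    using galois_transitive[OF D_alg] self_in_conjugates[OF D_alg] by fastforce
  then have "D \<in> \<rat>" using alg_degree_one_imp_Rats[OF D_alg] by blast
  then show ?thesis by (simp add: D_def E_def case_prod_unfold)
qed

end

section \<open>An energy inequality\<close>

lemma cmod_sum_squared: "(cmod (\<Sum>i\<in>A. v i))\<^sup>2 = (\<Sum>i\<in>A. \<Sum>j\<in>A. Re (v i * cnj (v j)))"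
proof -
  have "(\<Sum>i\<in>A. \<Sum>j\<in>A. Re (v i * cnj (v j))) = Re ((\<Sum>i\<in>A. v i) * cnj (\<Sum>j\<in>A. v j))"
    by (simp only: sum_product cnj_sum Re_sum)
  also have "\<dots> = (cmod (\<Sum>i\<in>A. v i))\<^sup>2"
    unfolding complex_norm_square[symmetric] by (rule Re_complex_of_real)
  finally show ?thesis by simp
qed

text \<open>The smallest value \<open>m\<close> of \<open>r\<close> contributes \<open>m\<close> times a square. After subtracting it, the kernel lives
  on the points where \<open>r > m\<close>, which are fewer.\<close>

lemma sum_min_kernel_nonneg:
  fixes r :: "'a \<Rightarrow> real" and v :: "'a \<Rightarrow> complex"
  assumes "finite A" "\<And>i. i \<in> A \<Longrightarrow> r i \<ge> 0"
  shows "(\<Sum>i\<in>A. \<Sum>j\<in>A. min (r i) (r j) * Re (v i * cnj (v j))) \<ge> 0"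
  using assms
proof (induction "card A" arbitrary: A r rule: less_induct)
  case less
  show ?case
  proof (cases "A = {}")
    case False
    define m where "m = Min (r ` A)"
    have m: "\<And>i. i \<in> A \<Longrightarrow> m \<le> r i" "m \<in> r ` A"
      unfolding m_def using less.prems False by auto
    define B where "B = {i\<in>A. r i \<noteq> m}"
    have B: "B \<subseteq> A" "finite B" using less.prems by (auto simp: B_def)
    have "B \<subset> A" using m(2) by (auto simp: B_def)
    then have "card B < card A" using less.prems(1) by (rule psubset_card_mono[rotated])
    then have IH: "(\<Sum>i\<in>B. \<Sum>j\<in>B. min (r i - m) (r j - m) * Re (v i * cnj (v j))) \<ge> 0"
      using less.hyps[of B "\<lambda>i. r i - m"] B m by auto
    have "m \<ge> 0" using m(2) less.prems(2) by auto
    have "(\<Sum>i\<in>A. \<Sum>j\<in>A. min (r i) (r j) * Re (v i * cnj (v j))) =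
        (\<Sum>i\<in>A. \<Sum>j\<in>A. m * Re (v i * cnj (v j)))
        + (\<Sum>i\<in>A. \<Sum>j\<in>A. min (r i - m) (r j - m) * Re (v i * cnj (v j)))"
      unfolding sum.distrib[symmetric]
      by (intro sum.cong refl) (simp add: min_def algebra_simps)
    also have "(\<Sum>i\<in>A. \<Sum>j\<in>A. m * Re (v i * cnj (v j))) = m * (cmod (\<Sum>i\<in>A. v i))\<^sup>2"
      by (simp only: cmod_sum_squared sum_distrib_left)
    also have "(\<Sum>i\<in>A. \<Sum>j\<in>A. min (r i - m) (r j - m) * Re (v i * cnj (v j))) =
        (\<Sum>i\<in>B. \<Sum>j\<in>B. min (r i - m) (r j - m) * Re (v i * cnj (v j)))"
    proof -
      have z: "min (r i - m) (r j - m) = 0" if "i \<in> A" "j \<in> A" "i \<notin> B \<or> j \<notin> B" for i j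
        using that m(1)[of i] m(1)[of j] by (auto simp: B_def min_def)
      have "(\<Sum>i\<in>A. \<Sum>j\<in>A. min (r i - m) (r j - m) * Re (v i * cnj (v j))) =
        (\<Sum>i\<in>B. \<Sum>j\<in>A. min (r i - m) (r j - m) * Re (v i * cnj (v j)))"
        using B less.prems z by (intro sum.mono_neutral_right) auto
      also have "\<dots> = (\<Sum>i\<in>B. \<Sum>j\<in>B. min (r i - m) (r j - m) * Re (v i * cnj (v j)))"
        using B less.prems z by (intro sum.cong refl sum.mono_neutral_right) auto
      finally show ?thesis .
    qed
    finally show ?thesis using IH \<open>m \<ge> 0\<close> by simp
  qed simp
qed

definition radial_ratio :: "complex \<Rightarrow> complex \<Rightarrow> real" where
  "radial_ratio x y = min (cmod x) (cmod y) / max (cmod x) (cmod y)"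

lemma radial_ratio_bounds:
  assumes "x \<noteq> 0" "y \<noteq> 0"
  shows "0 < radial_ratio x y" "radial_ratio x y \<le> 1"
  using assms by (auto simp: radial_ratio_def min_def max_def field_simps)

text \<open>The quotient \<open>min a b / max a b\<close> equals \<open>(min a b)\<^sup>2 / (a b)\<close>, so its powers are min-kernels
  after rescaling the vectors.\<close>

lemma radial_ratio_kernel_nonneg:
  fixes z u :: "'a \<Rightarrow> complex"
  assumes fin: "finite A" and z: "\<And>i. i \<in> A \<Longrightarrow> z i \<noteq> 0"
  shows "(\<Sum>i\<in>A. \<Sum>j\<in>A. radial_ratio (z i) (z j) ^ k * Re (u i * cnj (u j))) \<ge> 0"
proof -
  define v where "v i = u i / of_real (cmod (z i) ^ k)" for i
  have "radial_ratio (z i) (z j) ^ k * Re (u i * cnj (u j)) =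
      min (cmod (z i) ^ (2 * k)) (cmod (z j) ^ (2 * k)) * Re (v i * cnj (v j))"
    if ij: "i \<in> A" "j \<in> A" for i j
  proof -
    define a b where "a = cmod (z i)" and "b = cmod (z j)"
    have ab: "a > 0" "b > 0" using z ij by (auto simp: a_def b_def)
    have minp: "min (a ^ n) (b ^ n) = min a b ^ n" for n
      using ab power_mono[of a b n] power_mono[of b a n] by (auto simp: min_def)
    have "min a b / max a b = (min a b)\<^sup>2 / (a * b)"
      using ab by (auto simp: min_def max_def power2_eq_square field_simps)
    then have "(min a b / max a b) ^ k = min a b ^ (2 * k) / (a ^ k * b ^ k)"
      by (simp add: power_divide power_mult power_mult_distrib)
    moreover have "Re (v i * cnj (v j)) = Re (u i * cnj (u j)) / (a ^ k * b ^ k)"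
    proof -
      have "v i * cnj (v j) = (u i * cnj (u j)) / of_real (a ^ k * b ^ k)"
        by (simp add: v_def a_def b_def)
      then show ?thesis by (simp only: Re_divide_of_real)
    qed
    ultimately show ?thesis
      by (simp add: radial_ratio_def minp flip: a_def b_def)
  qed
  then have "(\<Sum>i\<in>A. \<Sum>j\<in>A. radial_ratio (z i) (z j) ^ k * Re (u i * cnj (u j))) =
      (\<Sum>i\<in>A. \<Sum>j\<in>A. min (cmod (z i) ^ (2 * k)) (cmod (z j) ^ (2 * k)) * Re (v i * cnj (v j)))"
    by (intro sum.cong refl) auto
  then show ?thesis using sum_min_kernel_nonneg[OF fin, of "\<lambda>i. cmod (z i) ^ (2 * k)" v] by simp
qed

lemma neg_ln_cmod_one_minus_sums:
  assumes "cmod w < 1"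
  shows "(\<lambda>k. Re (w ^ k) / k) sums (- ln (cmod (1 - w)))"
proof -
  have "(\<lambda>n. (-1) ^ Suc n / of_nat n * (- w) ^ n) sums Ln (1 + (- w))"
    using assms by (intro Ln_series) simp
  then have "(\<lambda>n. - (Re ((-1) ^ Suc n / of_nat n * (- w) ^ n))) sums - Re (Ln (1 + (- w)))"
    by (intro sums_minus sums_Re)
  moreover have "(\<lambda>n. - Re ((-1) ^ Suc n / of_nat n * (- w) ^ n)) = (\<lambda>n. Re (w ^ n) / n)"
  proof
    fix n
    have "(-1) ^ Suc n / of_nat n * (- w) ^ n = - (w ^ n / of_nat n)"
      by (cases "even n") simp_all
    then have "- Re ((-1) ^ Suc n / of_nat n * (- w) ^ n) = Re (w ^ n / of_nat n)"
      by (simp only: uminus_complex.sel minus_minus)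
    then show "- Re ((-1) ^ Suc n / of_nat n * (- w) ^ n) = Re (w ^ n) / n"
      by (simp only: Re_divide_of_nat)
  qed
  ultimately have "(\<lambda>n. Re (w ^ n) / n) sums - Re (Ln (1 + (- w)))" by (simp only:)
  moreover have "1 - w \<noteq> 0" using assms by auto
  ultimately show ?thesis by (simp add: Re_Ln)
qed

text \<open>The first Fourier mode is dominated by the regularised logarithmic energy because every mode
  contributes a nonnegative amount.\<close>

lemma first_mode_le_energy:
  fixes z u :: "'a \<Rightarrow> complex"
  assumes fin: "finite A" and z: "\<And>i. i \<in> A \<Longrightarrow> z i \<noteq> 0"
    and u: "\<And>i. i \<in> A \<Longrightarrow> cmod (u i) = 1" and \<tau>: "0 < \<tau>" "\<tau> < 1"
  shows "\<tau> * (\<Sum>i\<in>A. \<Sum>j\<in>A. radial_ratio (z i) (z j) * Re (u i * cnj (u j)))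
    \<le> (\<Sum>i\<in>A. \<Sum>j\<in>A. - ln (cmod (1 - of_real (\<tau> * radial_ratio (z i) (z j)) * (u i * cnj (u j)))))"
proof -
  define w where "w i j = of_real (\<tau> * radial_ratio (z i) (z j)) * (u i * cnj (u j))" for i j
  define c where "c k = (\<Sum>i\<in>A. \<Sum>j\<in>A. Re (w i j ^ k) / real k)" for k
  have w1: "cmod (w i j) < 1" if "i \<in> A" "j \<in> A" for i j
  proof -
    have "cmod (w i j) = \<tau> * radial_ratio (z i) (z j)"
      using that u \<tau> radial_ratio_bounds[of "z i" "z j"] z
      by (simp add: w_def norm_mult)
    also have "\<dots> \<le> \<tau> * 1"
      using that \<tau> radial_ratio_bounds[of "z i" "z j"] z by (intro mult_left_mono) auto
    finally show ?thesis using \<tau> by simp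
  qed
  have sums: "c sums (\<Sum>i\<in>A. \<Sum>j\<in>A. - ln (cmod (1 - w i j)))"
    unfolding c_def by (intro sums_sum neg_ln_cmod_one_minus_sums w1)
  have ceq: "c k = \<tau> ^ k / k * (\<Sum>i\<in>A. \<Sum>j\<in>A. radial_ratio (z i) (z j) ^ k * Re (u i ^ k * cnj (u j ^ k)))" for k
  proof -
    have "Re (w i j ^ k) = \<tau> ^ k * (radial_ratio (z i) (z j) ^ k * Re (u i ^ k * cnj (u j ^ k)))" for i j
    proof -
      have "w i j ^ k = of_real (\<tau> ^ k * radial_ratio (z i) (z j) ^ k) * (u i ^ k * cnj (u j ^ k))"
        by (simp add: w_def power_mult_distrib)
      moreover have "Re (of_real a * b) = a * Re b" for a b by simp
      ultimately show ?thesis by (simp only: mult.assoc)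
    qed
    then show ?thesis by (simp add: c_def sum_distrib_left)
  qed
  have c0: "c k \<ge> 0" for k
    unfolding ceq using \<tau> radial_ratio_kernel_nonneg[OF fin z, where k = k and u = "\<lambda>i. u i ^ k"] by simp
  have "sum c {1} \<le> suminf c"
    by (intro sum_le_suminf) (use sums c0 in \<open>auto simp: sums_iff\<close>)
  then show ?thesis using sums ceq[of 1] by (simp add: sums_iff w_def)
qed

text \<open>Contracting by \<open>\<tau> < 1\<close> tames the singularity of \<open>log|1 - w|\<close> at \<open>w = 1\<close>. The price is a factor
  that is attained at \<open>w = -1\<close> and tends to 1 as \<open>\<tau>\<close> does.\<close>

lemma cmod_one_minus_le:
  assumes \<tau>: "0 < \<tau>" "\<tau> < 1" and w: "cmod w \<le> 1"
  shows "cmod (1 - w) \<le> 2 / (1 + \<tau>) * cmod (1 - of_real \<tau> * w)"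
proof -
  define x y where "x = Re w" and "y = Im w"
  have xy: "x\<^sup>2 + y\<^sup>2 \<le> 1" using w by (simp add: x_def y_def cmod_def)
  have "x\<^sup>2 \<le> 1" using xy by (smt (verit) zero_le_power2)
  then have x: "x \<ge> -1" using abs_square_le_1[of x] by linarith
  have "0 \<le> (1 - \<tau>) * ((3 + \<tau>) + 2 * x * (1 - \<tau>) - (x\<^sup>2 + y\<^sup>2) * (1 + 3 * \<tau>))"
  proof (rule mult_nonneg_nonneg)
    have "(x\<^sup>2 + y\<^sup>2) * (1 + 3 * \<tau>) \<le> 1 * (1 + 3 * \<tau>)" using xy \<tau> by (intro mult_right_mono) auto
    moreover have "(-1) * (1 - \<tau>) \<le> x * (1 - \<tau>)" using x \<tau> by (intro mult_right_mono) auto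
    ultimately show "0 \<le> (3 + \<tau>) + 2 * x * (1 - \<tau>) - (x\<^sup>2 + y\<^sup>2) * (1 + 3 * \<tau>)" by simp
  qed (use \<tau> in simp)
  also have "\<dots> = 4 * ((1 - \<tau> * x)\<^sup>2 + (\<tau> * y)\<^sup>2) - (1 + \<tau>)\<^sup>2 * ((1 - x)\<^sup>2 + y\<^sup>2)"
    by (simp add: power2_eq_square algebra_simps)
  finally have "((1 + \<tau>) * cmod (1 - w))\<^sup>2 \<le> (2 * cmod (1 - of_real \<tau> * w))\<^sup>2"
    by (simp add: power_mult_distrib cmod_power2 x_def y_def)
  then have "(1 + \<tau>) * cmod (1 - w) \<le> 2 * cmod (1 - of_real \<tau> * w)"
    by (rule power2_le_imp_le) simp
  then show ?thesis using \<tau> by (simp add: field_simps)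
qed

lemma cmod_diff_radial:
  assumes "x \<noteq> 0" "y \<noteq> 0"
  shows "cmod (x - y) = max (cmod x) (cmod y) * cmod (1 - of_real (radial_ratio x y) * (sgn x * cnj (sgn y)))"
proof -
  have *: "cmod (x - y) = cmod y * cmod (1 - of_real (cmod x / cmod y) * (sgn x * cnj (sgn y)))"
    if "x \<noteq> 0" "y \<noteq> 0" for x y
  proof -
    have "cmod (sgn y) = 1" using that by (simp add: norm_sgn)
    then have s: "sgn y * cnj (sgn y) = 1" by (simp add: complex_norm_square[symmetric])
    have xy: "x = of_real (cmod x) * sgn x" "y = of_real (cmod y) * sgn y"
      using that by (simp_all add: sgn_eq)
    have "of_real (cmod y) * sgn y * (1 - of_real (cmod x / cmod y) * (sgn x * cnj (sgn y)))
        = of_real (cmod y) * sgn y - of_real (cmod x) * sgn x * (sgn y * cnj (sgn y))"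
      using that by (simp add: algebra_simps)
    also have "\<dots> = y - x" using xy s by simp
    finally have "cmod (y - x) = cmod (of_real (cmod y) * sgn y * (1 - of_real (cmod x / cmod y) * (sgn x * cnj (sgn y))))"
      by simp
    then show ?thesis using that by (simp add: norm_mult norm_sgn norm_minus_commute)
  qed
  show ?thesis
  proof (cases "cmod x \<le> cmod y")
    case True
    then show ?thesis using *[OF assms] by (simp add: radial_ratio_def)
  next
    case False
    have "cmod (1 - of_real (radial_ratio x y) * (sgn x * cnj (sgn y))) =
        cmod (cnj (1 - of_real (radial_ratio x y) * (sgn x * cnj (sgn y))))"
      by (simp only: complex_mod_cnj)
    also have "\<dots> = cmod (1 - of_real (cmod y / cmod x) * (sgn y * cnj (sgn x)))"
      using False by (simp add: radial_ratio_def mult_ac)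
    finally show ?thesis using *[OF assms(2,1)] False by (simp add: norm_minus_commute)
  qed
qed

lemma log_plus_max: "x > 0 \<Longrightarrow> y > 0 \<Longrightarrow> ln (max x y) \<le> log_plus x + log_plus y"
  by (auto simp: log_plus_def max_def)

lemma one_minus_radial_ratio_le:
  assumes "x \<noteq> 0" "y \<noteq> 0"
  shows "1 - radial_ratio x y \<le> \<bar>ln (cmod x)\<bar> + \<bar>ln (cmod y)\<bar>"
proof -
  have "- ln (radial_ratio x y) \<ge> 1 - radial_ratio x y"
    using ln_le_minus_one[of "radial_ratio x y"] radial_ratio_bounds[OF assms] by simp
  moreover have "- ln (radial_ratio x y) \<le> \<bar>ln (cmod x)\<bar> + \<bar>ln (cmod y)\<bar>"
    using assms by (auto simp: radial_ratio_def min_def max_def ln_div)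
  ultimately show ?thesis by linarith
qed
text \<open>In the application, \<open>z\<close> runs through the conjugates of a monomial in \<open>\<xi>\<close>, each repeated \<open>f\<close> times, \<open>B\<close> measures
  denominators and \<open>L\<close> the absolute values. The energy with contraction \<open>\<tau> = 1 - 1 / d\<close> is at
  most \<open>M\<^sup>2 (1 / d + 2 (B + L) + ln d / d)\<close>: the pairs with distinct points are bounded by the hypothesis on
  the differences, and each of the \<open>M f\<close> pairs with equal points contributes \<open>ln d\<close>. It dominates the
  first mode, which differs from the square of the exponential sum by the cost of ignoring the radii.\<close>

theorem unit_vector_sum_bound:
  fixes z :: "'a \<Rightarrow> complex" and B L :: real
  assumes fin: "finite A" and ne: "A \<noteq> {}" and z: "\<And>i. i \<in> A \<Longrightarrow> z i \<noteq> 0"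
    and d: "d \<ge> 1" and M: "M = card A" "M = f * d"
    and diag: "card {(i, j)\<in>A \<times> A. z i = z j} = M * f"
    and disc: "- 2 * real M ^ 2 * B \<le> (\<Sum>(i, j)\<in>{(i, j)\<in>A \<times> A. z i \<noteq> z j}. ln (cmod (z i - z j)))"
    and L: "(\<Sum>i\<in>A. log_plus (cmod (z i))) \<le> real M * L"
    and h: "(\<Sum>i\<in>A. \<bar>ln (cmod (z i))\<bar>) \<le> 2 * real M * (B + L)"
  shows "(cmod (\<Sum>i\<in>A. sgn (z i)))\<^sup>2 \<le> real M ^ 2 * (24 * (B + L) + 8 * (ln (2 * real d) / real d))"
proof -
  have M0: "real M > 0" using fin ne M(1) by (simp add: card_gt_0_iff)
  have h0: "B + L \<ge> 0"
  proof -
    have "0 \<le> 2 * real M * (B + L)" using h by (rule order.trans[rotated]) (simp add: sum_nonneg)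
    then show ?thesis using M0 by (simp add: zero_le_mult_iff)
  qed
  have ln2: "ln 2 \<ge> (1 / 2 :: real)" using ln2_ge_two_thirds by simp
  have lnd: "ln (2 * real d) = ln 2 + ln d" using d by (simp add: ln_mult)
  have ln0: "ln (real d) \<ge> 0" using d by simp
  define u where "u i = sgn (z i)" for i
  have u: "cmod (u i) = 1" if "i \<in> A" for i using z[OF that] by (simp add: u_def norm_sgn)
  \<comment> \<open>For \<open>d = 1\<close> the contraction would be \<open>\<tau> = 0\<close>, but then the trivial bound suffices.\<close>
  show ?thesis
  proof (cases "d = 1")
    case True
    have "cmod (\<Sum>i\<in>A. sgn (z i)) \<le> (\<Sum>i\<in>A. 1)"
      using u by (intro order.trans[OF norm_sum] sum_mono) (auto simp: u_def)
    then have "(cmod (\<Sum>i\<in>A. sgn (z i)))\<^sup>2 \<le> (real M)\<^sup>2 * 1"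
      using M by (simp add: power_mono)
    also have "\<dots> \<le> (real M)\<^sup>2 * (24 * (B + L) + 8 * (ln (2 * real d) / real d))"
      using ln2 h0 True by (intro mult_left_mono) auto
    finally show ?thesis .
  next
    case False
    then have d2: "real d \<ge> 2" using d by simp
    define \<tau> :: real where "\<tau> = 1 - 1 / d"
    have \<tau>: "1 / 2 \<le> \<tau>" "\<tau> < 1" "0 < \<tau>" "1 - \<tau> = 1 / d" using d2 by (auto simp: \<tau>_def field_simps)
    define c where "c = ln (2 / (1 + \<tau>))"
    have c0: "c \<ge> 0" using \<tau> by (auto simp: c_def field_simps)
    have c1: "c \<le> 1 / d"
    proof -
      have "c \<le> 2 / (1 + \<tau>) - 1" unfolding c_def using \<tau> by (intro ln_le_minus_one) auto
      also have "\<dots> = (1 - \<tau>) / (1 + \<tau>)" using \<tau> by (simp add: field_simps)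
      also have "\<dots> \<le> (1 - \<tau>) / 1" using \<tau> by (intro divide_left_mono) auto
      finally show ?thesis using \<tau> by simp
    qed
    define lp where "lp i = log_plus (cmod (z i))" for i
    have lp0: "lp i \<ge> 0" for i by (simp add: lp_def log_plus_def)
    define \<rho> where "\<rho> i j = radial_ratio (z i) (z j)" for i j
    define t where "t i j = - ln (cmod (1 - of_real (\<tau> * \<rho> i j) * (u i * cnj (u j))))" for i j
    define E where "E = {(i, j)\<in>A \<times> A. z i \<noteq> z j}"
    define \<Delta> where "\<Delta> = {(i, j)\<in>A \<times> A. z i = z j}"
    have split: "A \<times> A = E \<union> \<Delta>" "E \<inter> \<Delta> = {}" by (auto simp: E_def \<Delta>_def)
    have finE: "finite E" "finite \<Delta>" using fin split by (metis finite_SigmaI finite_Un)+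
    have tE: "t i j \<le> c + lp i + lp j - ln (cmod (z i - z j))" if "(i, j) \<in> E" for i j
    proof -
      have ij: "z i \<noteq> 0" "z j \<noteq> 0" "z i \<noteq> z j" "i \<in> A" "j \<in> A" using that z by (auto simp: E_def)
      define w where "w = of_real (\<rho> i j) * (u i * cnj (u j))"
      have mx: "max (cmod (z i)) (cmod (z j)) > 0" using ij by (simp add: less_max_iff_disj)
      have "cmod w \<le> 1" unfolding w_def \<rho>_def
        using u ij radial_ratio_bounds[of "z i" "z j"] by (simp add: norm_mult)
      then have le: "cmod (1 - w) \<le> 2 / (1 + \<tau>) * cmod (1 - of_real \<tau> * w)"
        using cmod_one_minus_le \<tau> by blast
      have eq: "cmod (z i - z j) = max (cmod (z i)) (cmod (z j)) * cmod (1 - w)"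
        using cmod_diff_radial[OF ij(1,2)] by (simp add: w_def \<rho>_def u_def)
      then have w0: "cmod (1 - w) > 0" using ij(3) by (auto simp: zero_less_mult_iff)
      have "0 < 2 / (1 + \<tau>) * cmod (1 - of_real \<tau> * w)" using w0 le by linarith
      then have w1: "cmod (1 - of_real \<tau> * w) > 0" using \<tau> by (auto simp: zero_less_mult_iff)
      have "ln (cmod (1 - w)) \<le> ln (2 / (1 + \<tau>) * cmod (1 - of_real \<tau> * w))"
        using le w0 by (intro ln_mono) auto
      also have "\<dots> = c - t i j"
        using \<tau> w1 by (subst ln_mult) (auto simp: c_def t_def w_def mult.assoc)
      finally have "t i j \<le> c - ln (cmod (1 - w))" by simp
      also have "ln (cmod (1 - w)) = ln (cmod (z i - z j)) - ln (max (cmod (z i)) (cmod (z j)))"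
        unfolding eq using mx w0 by (simp add: ln_mult)
      also have "ln (max (cmod (z i)) (cmod (z j))) \<le> lp i + lp j"
        unfolding lp_def using ij by (intro log_plus_max) auto
      finally show ?thesis by simp
    qed
    have t\<Delta>: "t i j = ln d" if "(i, j) \<in> \<Delta>" for i j
    proof -
      have ij: "z i \<noteq> 0" "z i = z j" "i \<in> A" using that z by (auto simp: \<Delta>_def)
      then have "u i = u j" by (simp add: u_def)
      moreover have "u i * cnj (u i) = 1" using u ij by (simp add: complex_norm_square[symmetric])
      moreover have "\<rho> i j = 1" using ij by (simp add: \<rho>_def radial_ratio_def)
      ultimately have "t i j = - ln (cmod (of_real (1 - \<tau>)))" by (simp add: t_def)
      also have "\<dots> = - ln (1 - \<tau>)" using \<tau> by (simp only: norm_of_real)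
      finally show ?thesis using d2 by (simp add: \<tau> ln_div)
    qed
    have T: "(\<Sum>i\<in>A. \<Sum>j\<in>A. t i j) \<le> real M ^ 2 * (1 / d + 2 * (B + L) + ln d / d)"
    proof -
      have "(\<Sum>i\<in>A. \<Sum>j\<in>A. t i j) = (\<Sum>(i, j)\<in>E. t i j) + (\<Sum>(i, j)\<in>\<Delta>. t i j)"
        unfolding sum.cartesian_product split(1) using finE split(2) by (rule sum.union_disjoint)
      also have "(\<Sum>(i, j)\<in>\<Delta>. t i j) = (\<Sum>(i, j)\<in>\<Delta>. ln (real d))"
        using t\<Delta> by (intro sum.cong refl) auto
      also have "\<dots> = real M * real f * ln d"
        using diag by (simp add: case_prod_unfold \<Delta>_def)
      also have "(\<Sum>(i, j)\<in>E. t i j) \<le> (\<Sum>(i, j)\<in>E. c + lp i + lp j - ln (cmod (z i - z j)))"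
        using tE by (intro sum_mono) auto
      also have "\<dots> = (\<Sum>(i, j)\<in>E. c + lp i + lp j) - (\<Sum>(i, j)\<in>E. ln (cmod (z i - z j)))"
        by (simp add: case_prod_unfold sum_subtractf)
      also have "(\<Sum>(i, j)\<in>E. c + lp i + lp j) \<le> (\<Sum>(i, j)\<in>A \<times> A. c + lp i + lp j)"
        using fin c0 lp0 by (intro sum_mono2) (auto simp: E_def intro!: add_nonneg_nonneg)
      also have "\<dots> = real M * (real M * c + 2 * (\<Sum>i\<in>A. lp i))"
        by (simp add: sum.cartesian_product[symmetric] sum.distrib M(1) distrib_left
            sum_distrib_left[symmetric])
      also have "\<dots> \<le> real M * (real M * (1 / d) + 2 * (real M * L))"
        using c1 L unfolding lp_def by (intro mult_left_mono add_mono) auto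
      finally have "(\<Sum>i\<in>A. \<Sum>j\<in>A. t i j) \<le>
          real M * (real M * (1 / d) + 2 * (real M * L)) - (\<Sum>(i, j)\<in>E. ln (cmod (z i - z j)))
          + real M * real f * ln d" by simp
      moreover have "- (\<Sum>(i, j)\<in>E. ln (cmod (z i - z j))) \<le> 2 * real M ^ 2 * B"
        using disc unfolding E_def by simp
      ultimately have "(\<Sum>i\<in>A. \<Sum>j\<in>A. t i j) \<le>
          real M * (real M * (1 / d) + 2 * (real M * L)) + 2 * real M ^ 2 * B + real M * real f * ln d"
        by simp
      also have "\<dots> = real M ^ 2 * (1 / d + 2 * (B + L) + ln d / d)"
        using d2 M(2) by (simp add: power2_eq_square field_simps)
      finally show ?thesis .
    qed
    define X where "X = (\<Sum>i\<in>A. \<Sum>j\<in>A. \<rho> i j * Re (u i * cnj (u j)))"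
    have "\<tau> * X \<le> (\<Sum>i\<in>A. \<Sum>j\<in>A. t i j)"
      unfolding X_def t_def \<rho>_def using first_mode_le_energy[OF fin z u \<tau>(3,2)] .
    moreover have "X \<ge> 0"
      unfolding X_def \<rho>_def using radial_ratio_kernel_nonneg[OF fin z, where k = 1 and u = u] by simp
    then have "1 / 2 * X \<le> \<tau> * X" using \<tau> by (intro mult_right_mono) auto
    ultimately have X: "X \<le> 2 * (real M ^ 2 * (1 / d + 2 * (B + L) + ln d / d))" using T by linarith
    have "(cmod (\<Sum>i\<in>A. u i))\<^sup>2 = (\<Sum>i\<in>A. \<Sum>j\<in>A. Re (u i * cnj (u j)))"
      by (rule cmod_sum_squared)
    also have "\<dots> \<le> (\<Sum>i\<in>A. \<Sum>j\<in>A. \<rho> i j * Re (u i * cnj (u j)) + (\<bar>ln (cmod (z i))\<bar> + \<bar>ln (cmod (z j))\<bar>))"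
    proof (intro sum_mono)
      fix i j assume ij: "i \<in> A" "j \<in> A"
      have "Re (u i * cnj (u j)) \<le> cmod (u i * cnj (u j))" by (rule complex_Re_le_cmod)
      also have "\<dots> = 1" using u ij by (simp add: norm_mult)
      finally have "(1 - \<rho> i j) * Re (u i * cnj (u j)) \<le> (1 - \<rho> i j) * 1"
        using radial_ratio_bounds[of "z i" "z j"] z ij by (intro mult_left_mono) (auto simp: \<rho>_def)
      also have "\<dots> \<le> \<bar>ln (cmod (z i))\<bar> + \<bar>ln (cmod (z j))\<bar>"
        using one_minus_radial_ratio_le[of "z i" "z j"] z ij by (simp add: \<rho>_def)
      finally show "Re (u i * cnj (u j)) \<le>
          \<rho> i j * Re (u i * cnj (u j)) + (\<bar>ln (cmod (z i))\<bar> + \<bar>ln (cmod (z j))\<bar>)"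
        by (simp add: algebra_simps)
    qed
    also have "\<dots> = X + 2 * real M * (\<Sum>i\<in>A. \<bar>ln (cmod (z i))\<bar>)"
      by (simp add: X_def sum.distrib M(1) sum_distrib_left[symmetric])
    also have "\<dots> \<le> 2 * (real M ^ 2 * (1 / d + 2 * (B + L) + ln d / d)) + 2 * real M * (2 * real M * (B + L))"
      using X h by (intro add_mono mult_left_mono) auto
    also have "\<dots> = real M ^ 2 * (8 * (B + L) + (2 + 2 * ln d) / d)"
      using d2 by (simp add: power2_eq_square field_simps)
    also have "\<dots> \<le> real M ^ 2 * (24 * (B + L) + 8 * (ln (2 * real d) / real d))"
    proof (intro mult_left_mono add_mono)
      have "(2 + 2 * ln d) / d \<le> (8 * ln (2 * real d)) / d"
      proof (intro divide_right_mono)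
        have "2 + 2 * ln (real d) \<le> 8 * ln 2 + 8 * ln (real d)" using ln2 ln0 by linarith
        then show "2 + 2 * ln (real d) \<le> 8 * ln (2 * real d)" by (simp add: lnd)
      qed simp
      then show "(2 + 2 * ln d) / d \<le> 8 * (ln (2 * real d) / real d)" by simp
    qed (use h0 in auto)
    finally show ?thesis by (simp add: u_def)
  qed
qed

section \<open>The exponential sum of a monomial over a Galois orbit\<close>

lemma sum_weil_height:
  assumes x: "algebraic x"
  shows "ln \<bar>of_int (lead_coeff (min_int_poly x))\<bar> + (\<Sum>y\<in>conjugates x. log_plus (cmod y))
    = alg_degree x * weil_height x"
  using alg_degree_pos[OF x] unfolding weil_height_def proots_cmin_poly[OF x]
  by (simp add: sum_unfold_sum_mset)

lemma log_plus_inverse: "x > 0 \<Longrightarrow> log_plus (inverse x) = log_plus x - ln x"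
  by (auto simp: log_plus_def ln_inverse)

lemma log_plus_nonneg: "log_plus x \<ge> 0"
  by (simp add: log_plus_def)

lemma log_plus_mult: "x > 0 \<Longrightarrow> y > 0 \<Longrightarrow> log_plus (x * y) \<le> log_plus x + log_plus y"
  by (auto simp: log_plus_def ln_mult)

lemma log_plus_power: "x > 0 \<Longrightarrow> log_plus (x ^ k) = k * log_plus x"
  by (auto simp: log_plus_def ln_realpow max_def mult_le_0_iff zero_le_mult_iff)

lemma log_plus_prod:
  "finite I \<Longrightarrow> (\<And>i. i \<in> I \<Longrightarrow> f i > 0) \<Longrightarrow> log_plus (prod f I) \<le> (\<Sum>i\<in>I. log_plus (f i))"
proof (induction I rule: finite_induct)
  case (insert i I)
  then have "log_plus (f i * prod f I) \<le> log_plus (f i) + log_plus (prod f I)"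
    by (intro log_plus_mult prod_pos) auto
  then show ?case using insert by simp
qed (simp add: log_plus_def)

lemma abs_constant_coeff_min_int_poly:
  assumes x: "algebraic x"
  shows "\<bar>of_int (coeff (min_int_poly x) 0)\<bar> =
    \<bar>of_int (lead_coeff (min_int_poly x)) :: real\<bar> * (\<Prod>y\<in>conjugates x. cmod y)"
proof -
  have "cmod (coeff (cmin_poly x) 0) =
      cmod (of_int (lead_coeff (min_int_poly x))) * (\<Prod>y\<in>conjugates x. cmod y)"
    by (subst cmin_poly_factorization[OF x])
      (simp add: poly_0_coeff_0[symmetric] poly_prod norm_mult flip: prod_norm)
  then show ?thesis by (simp add: coeff_map_poly)
qed

locale galois_units = galois_setting \<xi> for \<xi> :: "complex ^ 'n" +
  assumes xi_nonzero: "\<xi> $ j \<noteq> 0"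
begin

lemma S_nonzero: "\<alpha> \<in> S \<Longrightarrow> \<alpha> $ j \<noteq> 0"
proof -
  assume "\<alpha> \<in> S"
  then obtain s where s: "s \<in> absolute_galois" "\<alpha> $ j = s (\<xi> $ j)"
    by (auto simp: S_eq galois_act_def)
  have "s (\<xi> $ j) \<noteq> s 0"
    using inj_onD[OF absolute_galois_inj[OF s(1)], of "\<xi> $ j" 0] xi_algebraic xi_nonzero by auto
  then show ?thesis using s absolute_galois_zero[OF s(1)] by simp
qed

lemma conjugates_coordinate: "conjugates (\<xi> $ k) = (\<lambda>\<alpha>. \<alpha> $ k) ` S"
  using equivariant_image[OF equivariant_coordinate] by simp

lemma conjugates_nonzero: "y \<in> conjugates (\<xi> $ k) \<Longrightarrow> y \<noteq> 0"
  unfolding conjugates_coordinate using S_nonzero by auto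

text \<open>Writing a monomial with nonnegative exponents in the coordinates or their inverses reduces negative
  exponents to the reciprocal polynomial.\<close>

definition unit_power :: "int \<Rightarrow> complex \<Rightarrow> complex" where
  "unit_power m x = (if m \<ge> 0 then x else inverse x)"

lemma monomial_char_eq: "monomial_char n \<alpha> = (\<Prod>k\<in>UNIV. unit_power (n $ k) (\<alpha> $ k) ^ nat \<bar>n $ k\<bar>)"
  unfolding monomial_char_def
  by (intro prod.cong refl) (auto simp: power_int_def unit_power_def)

text \<open>The leading coefficient, up to sign, of the minimal polynomial of \<open>unit_power m x\<close>, for nonzero \<open>x\<close>.\<close>

definition end_coeff :: "int \<Rightarrow> complex \<Rightarrow> int" where
  "end_coeff m x = (if m \<ge> 0 then lead_coeff (min_int_poly x) else coeff (min_int_poly x) 0)"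

abbreviation "deg k \<equiv> alg_degree (\<xi> $ k)"
abbreviation "fib k \<equiv> fibre_size (\<lambda>\<alpha>. \<alpha> $ k)"

lemma fib_deg: "fib k * deg k = M"
  using fibre_size(1)[OF equivariant_coordinate] by simp

lemma deg_pos: "deg k > 0"
  by (rule alg_degree_pos[OF xi_algebraic])

lemma lead_coeff_nonzero: "lead_coeff (min_int_poly (\<xi> $ k)) \<noteq> 0"
  using is_min_int_poly_min_int_poly[OF xi_algebraic] by (auto simp: is_min_int_poly_def)

lemma end_coeff_nonzero: "end_coeff m (\<xi> $ k) \<noteq> 0"
proof -
  have "poly (cmin_poly (\<xi> $ k)) 0 \<noteq> 0"
    using conjugates_nonzero by (auto simp: conjugates_def)
  then have "coeff (min_int_poly (\<xi> $ k)) 0 \<noteq> 0"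
    by (auto simp: poly_0_coeff_0 coeff_map_poly)
  then show ?thesis using lead_coeff_nonzero by (simp add: end_coeff_def)
qed

lemma ln_end_coeff_nonneg: "ln \<bar>of_int (end_coeff m (\<xi> $ k)) :: real\<bar> \<ge> 0"
proof -
  have "1 \<le> \<bar>end_coeff m (\<xi> $ k)\<bar>" using end_coeff_nonzero[of m k] by linarith
  then have "1 \<le> \<bar>of_int (end_coeff m (\<xi> $ k)) :: real\<bar>" by linarith
  then show ?thesis by simp
qed

text \<open>Inverting all conjugates exchanges the two end coefficients of the minimal polynomial and
  preserves the height.\<close>

lemma height_end_coeff:
  "ln \<bar>of_int (end_coeff m (\<xi> $ k))\<bar> + (\<Sum>y\<in>conjugates (\<xi> $ k). log_plus (cmod (unit_power m y)))
    = deg k * weil_height (\<xi> $ k)"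
proof (cases "m \<ge> 0")
  case True
  then show ?thesis using sum_weil_height[OF xi_algebraic] by (simp add: end_coeff_def unit_power_def)
next
  case False
  let ?C = "conjugates (\<xi> $ k)" and ?a = "lead_coeff (min_int_poly (\<xi> $ k))"
  have fin: "finite ?C" by (rule finite_conjugates[OF xi_algebraic])
  have "ln \<bar>of_int (end_coeff m (\<xi> $ k)) :: real\<bar> = ln (\<bar>of_int ?a\<bar> * (\<Prod>y\<in>?C. cmod y))"
    using False by (simp add: end_coeff_def abs_constant_coeff_min_int_poly[OF xi_algebraic])
  also have "\<dots> = ln \<bar>of_int ?a\<bar> + ln (\<Prod>y\<in>?C. cmod y)"
    using lead_coeff_nonzero[of k] fin conjugates_nonzero by (intro ln_mult_pos prod_pos) auto
  also have "ln (\<Prod>y\<in>?C. cmod y) = (\<Sum>y\<in>?C. ln (cmod y))"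
    using fin conjugates_nonzero by (intro ln_prod) auto
  finally have "ln \<bar>of_int (end_coeff m (\<xi> $ k)) :: real\<bar> = ln \<bar>of_int ?a\<bar> + (\<Sum>y\<in>?C. ln (cmod y))" .
  moreover have "(\<Sum>y\<in>?C. log_plus (cmod (unit_power m y))) = (\<Sum>y\<in>?C. log_plus (cmod y) - ln (cmod y))"
    using False conjugates_nonzero[of _ k]
    by (intro sum.cong refl) (simp add: unit_power_def norm_inverse log_plus_inverse)
  ultimately show ?thesis using sum_weil_height[OF xi_algebraic, of k] by (simp add: sum_subtractf)
qed

lemma sum_log_plus_orbit:
  "(\<Sum>\<alpha>\<in>S. log_plus (cmod (unit_power m (\<alpha> $ k)))) =
     M * (weil_height (\<xi> $ k) - ln \<bar>of_int (end_coeff m (\<xi> $ k))\<bar> / deg k)"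
proof -
  have "(\<Sum>\<alpha>\<in>S. log_plus (cmod (unit_power m (\<alpha> $ k)))) =
      fib k * (\<Sum>y\<in>conjugates (\<xi> $ k). log_plus (cmod (unit_power m y)))"
    by (rule equivariant_sum[OF equivariant_coordinate])
  also have "\<dots> = fib k * (deg k * weil_height (\<xi> $ k) - ln \<bar>of_int (end_coeff m (\<xi> $ k))\<bar>)"
  proof -
    have "(\<Sum>y\<in>conjugates (\<xi> $ k). log_plus (cmod (unit_power m y))) =
        deg k * weil_height (\<xi> $ k) - ln \<bar>of_int (end_coeff m (\<xi> $ k))\<bar>"
      using height_end_coeff[of m k] by linarith
    then show ?thesis by (simp only:)
  qed
  also have "\<dots> = real (fib k * deg k) * (weil_height (\<xi> $ k) - ln \<bar>of_int (end_coeff m (\<xi> $ k))\<bar> / deg k)"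
    using deg_pos[of k] by (simp add: field_simps)
  finally show ?thesis by (simp only: fib_deg)
qed

lemma weil_height_coordinate_nonneg: "weil_height (\<xi> $ k) \<ge> 0"
proof -
  have "0 \<le> deg k * weil_height (\<xi> $ k)"
    unfolding height_end_coeff[of 0 k, symmetric]
    by (intro add_nonneg_nonneg ln_end_coeff_nonneg sum_nonneg log_plus_nonneg)
  then show ?thesis using deg_pos[of k] by (simp add: zero_le_mult_iff)
qed

lemma sum_abs_ln_orbit: "(\<Sum>\<alpha>\<in>S. \<bar>ln (cmod (\<alpha> $ k))\<bar>) \<le> 2 * real M * weil_height (\<xi> $ k)"
proof -
  have "\<bar>ln (cmod (\<alpha> $ k))\<bar> =
      log_plus (cmod (unit_power 1 (\<alpha> $ k))) + log_plus (cmod (unit_power (-1) (\<alpha> $ k)))"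
    if "\<alpha> \<in> S" for \<alpha>
    using S_nonzero[OF that, of k]
    by (auto simp: unit_power_def norm_inverse log_plus_inverse) (auto simp: log_plus_def)
  then have "(\<Sum>\<alpha>\<in>S. \<bar>ln (cmod (\<alpha> $ k))\<bar>) =
      M * (weil_height (\<xi> $ k) - ln \<bar>of_int (end_coeff 1 (\<xi> $ k))\<bar> / deg k)
      + M * (weil_height (\<xi> $ k) - ln \<bar>of_int (end_coeff (-1) (\<xi> $ k))\<bar> / deg k)"
    by (simp add: sum.distrib sum_log_plus_orbit)
  also have "\<dots> \<le> M * weil_height (\<xi> $ k) + M * weil_height (\<xi> $ k)"
    using ln_end_coeff_nonneg[of _ k] by (intro add_mono mult_left_mono) auto
  finally show ?thesis by simp
qed

lemma end_coeff_clears_denominators: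
  assumes V: "valuation_ring_over p R"
  shows "of_int (end_coeff m (\<xi> $ k)) ^ fib k * (\<Prod>\<alpha>\<in>S. denom_part R (unit_power m (\<alpha> $ k))) \<in> R"
proof -
  have R: "subring R" using V by (simp add: valuation_ring_over_def)
  let ?C = "conjugates (\<xi> $ k)" and ?a = "complex_of_int (lead_coeff (min_int_poly (\<xi> $ k)))"
  have fin: "finite ?C" by (rule finite_conjugates[OF xi_algebraic])
  have over: "poly_over R (smult ?a (\<Prod>\<eta>\<in>?C. [:- \<eta>, 1:]))"
    unfolding cmin_poly_factorization[OF xi_algebraic, symmetric]
    by (auto simp: poly_over_def coeff_map_poly subring_of_int[OF R])
  have "of_int (end_coeff m (\<xi> $ k)) * (\<Prod>y\<in>?C. denom_part R (unit_power m y)) \<in> R"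
  proof (cases "m \<ge> 0")
    case True
    then show ?thesis using lead_coeff_clears_denominators[OF V fin over]
      by (simp add: unit_power_def end_coeff_def)
  next
    case False
    have "0 \<notin> ?C" using conjugates_nonzero by blast
    then show ?thesis using constant_coeff_clears_inverse_denominators[OF V fin _ over] False
      unfolding cmin_poly_factorization[OF xi_algebraic, symmetric]
      by (simp add: unit_power_def end_coeff_def coeff_map_poly)
  qed
  then have "(of_int (end_coeff m (\<xi> $ k)) * (\<Prod>y\<in>?C. denom_part R (unit_power m y))) ^ fib k \<in> R"
    by (rule subring_power[OF R])
  then show ?thesis
    using equivariant_prod[OF equivariant_coordinate, of "\<lambda>y. denom_part R (unit_power m y)" k]
    by (simp add: power_mult_distrib)
qed

lemma equivariant_monomial_char: "equivariant (monomial_char n)"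
proof -
  have "equivariant (\<lambda>\<alpha>. unit_power m (\<alpha> $ k))" for m k
    by (cases "m \<ge> 0") (simp_all add: unit_power_def equivariant_coordinate equivariant_inverse)
  then have "equivariant (\<lambda>\<alpha>. \<Prod>k\<in>UNIV. unit_power (n $ k) (\<alpha> $ k) ^ nat \<bar>n $ k\<bar>)"
    by (intro equivariant_prodI equivariant_power)
  then show ?thesis by (simp add: monomial_char_eq[abs_def])
qed

lemma monomial_char_nonzero: "\<alpha> \<in> S \<Longrightarrow> monomial_char n \<alpha> \<noteq> 0"
  using S_nonzero by (simp add: monomial_char_def)

definition end_height :: "int ^ 'n \<Rightarrow> real" where
  "end_height n = (\<Sum>k\<in>UNIV. nat \<bar>n $ k\<bar> * (ln \<bar>of_int (end_coeff (n $ k) (\<xi> $ k))\<bar> / deg k))"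

definition char_height :: "int ^ 'n \<Rightarrow> real" where
  "char_height n = (\<Sum>k\<in>UNIV. nat \<bar>n $ k\<bar> * weil_height (\<xi> $ k))"

text \<open>The product of the differences is rational by Galois invariance. Multiplied by suitable powers
  of the end coefficients it lies in every valuation ring, hence is a nonzero integer and has
  absolute value at least 1; this is the claim after taking logarithms.\<close>

lemma discriminant_lower_bound:
  "- 2 * real M ^ 2 * end_height n \<le>
    (\<Sum>(\<alpha>, \<alpha>')\<in>{(\<alpha>, \<alpha>')\<in>S \<times> S. monomial_char n \<alpha> \<noteq> monomial_char n \<alpha>'}.
       ln (cmod (monomial_char n \<alpha> - monomial_char n \<alpha>')))"
proof -
  let ?\<gamma> = "monomial_char n"
  define E where "E = {(\<alpha>, \<alpha>')\<in>S \<times> S. ?\<gamma> \<alpha> \<noteq> ?\<gamma> \<alpha>'}"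
  have finE: "finite E" using finite_S by (auto simp: E_def intro: finite_subset[of _ "S \<times> S"])
  define D where "D = (\<Prod>(\<alpha>, \<alpha>')\<in>E. ?\<gamma> \<alpha> - ?\<gamma> \<alpha>')"
  define b :: "'n \<Rightarrow> int" where "b k = end_coeff (n $ k) (\<xi> $ k)" for k
  define Q where "Q = (\<Prod>k\<in>UNIV. b k ^ (fib k * (2 * M * nat \<bar>n $ k\<bar>)))"
  have "D * of_int Q \<in> \<int>"
  proof (rule rational_in_valuation_rings_imp_int)
    have "D \<in> \<rat>" unfolding D_def E_def
      by (rule difference_product_rational[OF equivariant_monomial_char])
    then show "D * of_int Q \<in> \<rat>" by simp
    fix p R assume V: "valuation_ring_over p R"
    have "(\<Prod>(\<alpha>, \<alpha>')\<in>E. ?\<gamma> \<alpha> - ?\<gamma> \<alpha>') * (\<Prod>k\<in>UNIV. (of_int (b k) ^ fib k) ^ (2 * card S * nat \<bar>n $ k\<bar>)) \<in> R"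
      unfolding E_def monomial_char_eq b_def
      by (rule difference_product_in_valuation_ring[OF V finite_S finite_class.finite_UNIV,
            where \<zeta> = "\<lambda>\<alpha> k. unit_power (n $ k) (\<alpha> $ k)" and e = "\<lambda>k. nat \<bar>n $ k\<bar>"
              and \<beta> = "\<lambda>k. of_int (end_coeff (n $ k) (\<xi> $ k)) ^ fib k"])
        (rule end_coeff_clears_denominators[OF V])
    then show "D * of_int Q \<in> R"
      by (simp add: D_def Q_def M_def power_mult)
  qed
  moreover have D0: "D \<noteq> 0" using finE by (auto simp: D_def E_def)
  have b0: "b k \<noteq> 0" for k unfolding b_def by (rule end_coeff_nonzero)
  then have Q0: "Q \<noteq> 0" by (simp add: Q_def)
  ultimately obtain N where N: "D * of_int Q = of_int N" by (auto elim!: Ints_cases)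
  have "D * of_int Q \<noteq> 0" using D0 Q0 by simp
  then have "N \<noteq> 0" unfolding N by simp
  then have "1 \<le> \<bar>N\<bar>" by linarith
  then have "1 \<le> cmod (of_int N)" by (simp add: norm_of_int)
  then have "1 \<le> cmod D * \<bar>of_int Q\<bar>" by (simp add: norm_mult flip: N)
  then have "0 \<le> ln (cmod D * \<bar>of_int Q\<bar>)" by simp
  also have "\<dots> = ln (cmod D) + ln \<bar>of_int Q\<bar>"
    using D0 Q0 by (intro ln_mult_pos) auto
  also have "ln (cmod D) = (\<Sum>(\<alpha>, \<alpha>')\<in>E. ln (cmod (?\<gamma> \<alpha> - ?\<gamma> \<alpha>')))"
    unfolding D_def prod_norm[symmetric] case_prod_unfold
    by (intro ln_prod finE) (auto simp: E_def)
  also have "ln \<bar>of_int Q :: real\<bar> = (\<Sum>k\<in>UNIV. ln (\<bar>of_int (b k)\<bar> ^ (fib k * (2 * M * nat \<bar>n $ k\<bar>))))"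
    unfolding Q_def of_int_prod abs_prod of_int_power power_abs
    using b0 by (intro ln_prod) auto
  also have "\<dots> = 2 * real M ^ 2 * end_height n"
    unfolding end_height_def sum_distrib_left
  proof (intro sum.cong refl)
    fix k
    have "real (fib k) = real M / deg k" using deg_pos[of k] by (simp flip: fib_deg[of k])
    then show "ln (\<bar>real_of_int (b k)\<bar> ^ (fib k * (2 * M * nat \<bar>n $ k\<bar>))) =
        2 * real M ^ 2 * (nat \<bar>n $ k\<bar> * (ln \<bar>of_int (end_coeff (n $ k) (\<xi> $ k))\<bar> / deg k))"
      using b0[of k] by (simp add: ln_realpow b_def power2_eq_square)
  qed
  finally show ?thesis by (simp add: E_def)
qed

lemma sum_log_plus_monomial:
  "(\<Sum>\<alpha>\<in>S. log_plus (cmod (monomial_char n \<alpha>))) \<le> real M * (char_height n - end_height n)"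
proof -
  have "log_plus (cmod (monomial_char n \<alpha>)) \<le>
      (\<Sum>k\<in>UNIV. nat \<bar>n $ k\<bar> * log_plus (cmod (unit_power (n $ k) (\<alpha> $ k))))" if "\<alpha> \<in> S" for \<alpha>
  proof -
    have pos: "cmod (unit_power m (\<alpha> $ k)) > 0" for m k
      using S_nonzero[OF that] by (simp add: unit_power_def)
    have "log_plus (cmod (monomial_char n \<alpha>)) =
        log_plus (\<Prod>k\<in>UNIV. cmod (unit_power (n $ k) (\<alpha> $ k)) ^ nat \<bar>n $ k\<bar>)"
      by (simp add: monomial_char_eq norm_power flip: prod_norm)
    also have "\<dots> \<le> (\<Sum>k\<in>UNIV. log_plus (cmod (unit_power (n $ k) (\<alpha> $ k)) ^ nat \<bar>n $ k\<bar>))"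
      using pos by (intro log_plus_prod) auto
    finally show ?thesis using pos by (simp add: log_plus_power)
  qed
  then have "(\<Sum>\<alpha>\<in>S. log_plus (cmod (monomial_char n \<alpha>))) \<le>
      (\<Sum>\<alpha>\<in>S. \<Sum>k\<in>UNIV. nat \<bar>n $ k\<bar> * log_plus (cmod (unit_power (n $ k) (\<alpha> $ k))))"
    by (rule sum_mono)
  also have "\<dots> = (\<Sum>k\<in>UNIV. nat \<bar>n $ k\<bar> * (\<Sum>\<alpha>\<in>S. log_plus (cmod (unit_power (n $ k) (\<alpha> $ k)))))"
    by (subst sum.swap) (simp add: sum_distrib_left)
  also have "\<dots> = real M * (char_height n - end_height n)"
    unfolding sum_log_plus_orbit
    by (simp add: char_height_def end_height_def sum_subtractf[symmetric] sum_distrib_left algebra_simps)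
  finally show ?thesis .
qed

lemma sum_abs_ln_monomial:
  "(\<Sum>\<alpha>\<in>S. \<bar>ln (cmod (monomial_char n \<alpha>))\<bar>) \<le> 2 * real M * char_height n"
proof -
  have "\<bar>ln (cmod (monomial_char n \<alpha>))\<bar> \<le> (\<Sum>k\<in>UNIV. nat \<bar>n $ k\<bar> * \<bar>ln (cmod (\<alpha> $ k))\<bar>)"
    if "\<alpha> \<in> S" for \<alpha>
  proof -
    have "ln (cmod (monomial_char n \<alpha>)) = (\<Sum>k\<in>UNIV. ln (cmod (unit_power (n $ k) (\<alpha> $ k) ^ nat \<bar>n $ k\<bar>)))"
      unfolding monomial_char_eq prod_norm[symmetric]
      using S_nonzero[OF that] by (intro ln_prod) (auto simp: unit_power_def)
    also have "\<bar>\<dots>\<bar> \<le> (\<Sum>k\<in>UNIV. \<bar>ln (cmod (unit_power (n $ k) (\<alpha> $ k) ^ nat \<bar>n $ k\<bar>))\<bar>)"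
      by (rule sum_abs)
    also have "\<dots> = (\<Sum>k\<in>UNIV. nat \<bar>n $ k\<bar> * \<bar>ln (cmod (\<alpha> $ k))\<bar>)"
      using S_nonzero[OF that]
      by (intro sum.cong refl) (auto simp: unit_power_def norm_power norm_inverse ln_realpow ln_inverse abs_mult)
    finally show ?thesis by simp
  qed
  then have "(\<Sum>\<alpha>\<in>S. \<bar>ln (cmod (monomial_char n \<alpha>))\<bar>) \<le>
      (\<Sum>\<alpha>\<in>S. \<Sum>k\<in>UNIV. nat \<bar>n $ k\<bar> * \<bar>ln (cmod (\<alpha> $ k))\<bar>)"
    by (rule sum_mono)
  also have "\<dots> = (\<Sum>k\<in>UNIV. nat \<bar>n $ k\<bar> * (\<Sum>\<alpha>\<in>S. \<bar>ln (cmod (\<alpha> $ k))\<bar>))"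
    by (subst sum.swap) (simp add: sum_distrib_left)
  also have "\<dots> \<le> (\<Sum>k\<in>UNIV. nat \<bar>n $ k\<bar> * (2 * real M * weil_height (\<xi> $ k)))"
    by (intro sum_mono mult_left_mono sum_abs_ln_orbit) auto
  also have "\<dots> = 2 * real M * char_height n"
    by (simp add: char_height_def sum_distrib_left mult_ac)
  finally show ?thesis .
qed

lemma char_height_le: "char_height n \<le> l1_norm n * height \<xi>"
proof -
  have "weil_height (\<xi> $ k) \<le> height \<xi>" for k
    unfolding height_def using weil_height_coordinate_nonneg by (intro member_le_sum) auto
  then have "char_height n \<le> (\<Sum>k\<in>UNIV. nat \<bar>n $ k\<bar> * height \<xi>)"
    unfolding char_height_def by (intro sum_mono mult_left_mono) auto
  then show ?thesis by (simp add: l1_norm_def sum_distrib_right)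
qed

lemma height_nonneg: "height \<xi> \<ge> 0"
  unfolding height_def by (intro sum_nonneg weil_height_coordinate_nonneg)

lemma alg_degree_monomial_pos: "alg_degree (monomial_char n \<xi>) > 0"
  by (intro alg_degree_pos equivariant_algebraic[OF equivariant_monomial_char xi_in_S])

lemma generalized_degree_le:
  "n \<noteq> 0 \<Longrightarrow> generalized_degree \<xi> \<le> l1_norm n * alg_degree (monomial_char n \<xi>)"
  unfolding generalized_degree_def by (intro cINF_lower) auto

lemma l1_norm_pos: "n \<noteq> 0 \<Longrightarrow> l1_norm n > 0"
proof -
  assume "n \<noteq> 0"
  then obtain j where "n $ j \<noteq> 0" by (auto simp: vec_eq_iff)
  then have "0 < nat \<bar>n $ j\<bar>" by simp
  also have "nat \<bar>n $ j\<bar> \<le> l1_norm n" unfolding l1_norm_def by (intro member_le_sum) auto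
  finally show ?thesis .
qed

lemma generalized_degree_pos: "generalized_degree \<xi> > 0"
proof -
  have "(1 :: int ^ 'n) \<noteq> 0" by (simp add: vec_eq_iff)
  then have ne: "- {0 :: int ^ 'n} \<noteq> {}" by blast
  have "generalized_degree \<xi> \<in> (\<lambda>n. l1_norm n * alg_degree (monomial_char n \<xi>)) ` (- {0})"
    unfolding generalized_degree_def by (rule Inf_nat_def1) (use ne in blast)
  then obtain n where "n \<noteq> 0" "generalized_degree \<xi> = l1_norm n * alg_degree (monomial_char n \<xi>)"
    by blast
  then show ?thesis using l1_norm_pos[of n] alg_degree_monomial_pos[of n] by simp
qed

lemma height_D_pos: "height_D \<xi> > 0"
proof -
  have "ln (2 * real (generalized_degree \<xi>)) > 0" using generalized_degree_pos by simp
  then show ?thesis using height_nonneg generalized_degree_pos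
    by (simp add: height_D_def add_nonneg_pos)
qed

end

text \<open>As a function of a real variable, \<open>ln (2 x) / x\<close> increases up to \<open>x = exp 1 / 2\<close>; on the integers it
  decreases from the start, with equal values at 1 and 2.\<close>

lemma ln_double_div_antimono:
  assumes "1 \<le> (a :: nat)" "a \<le> b"
  shows "ln (2 * real b) / b \<le> ln (2 * real a) / a"
  using assms(2)
proof (induction b rule: dec_induct)
  case (step b)
  have b: "real b \<ge> 1" using step assms(1) by linarith
  have ln2: "ln 2 \<ge> (2 / 3 :: real)" by (rule ln2_ge_two_thirds)
  have key: "b * ln (1 + 1 / real b) \<le> ln (2 * real b)"
  proof (cases "b = 1")
    case False
    then have b2: "real b \<ge> 2" using b by simp
    have "b * ln (1 + 1 / real b) \<le> b * (1 / real b)"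
      using b by (intro mult_left_mono ln_add_one_self_le_self) auto
    also have "\<dots> \<le> 2 * ln 2" using b ln2 by simp
    also have "\<dots> = ln (2 * 2 :: real)" by (subst ln_mult) auto
    also have "\<dots> \<le> ln (2 * real b)" using b2 by (intro ln_mono) auto
    finally show ?thesis .
  qed simp
  have "2 * real (Suc b) = 2 * real b * (1 + 1 / real b)"
    using b by (simp add: field_simps)
  then have "ln (2 * real (Suc b)) = ln (2 * real b * (1 + 1 / real b))" by (simp only:)
  also have "\<dots> = ln (2 * real b) + ln (1 + 1 / real b)"
    using b by (intro ln_mult_pos add_pos_nonneg) auto
  finally have "b * ln (2 * real (Suc b)) \<le> Suc b * ln (2 * real b)"
    using key by (simp add: algebra_simps)
  then have "ln (2 * real (Suc b)) / Suc b \<le> ln (2 * real b) / b"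
    using b by (simp add: field_simps)
  then show ?case using step by simp
qed simp

context galois_units
begin

text \<open>The energy bound in terms of the degree \<open>d\<close> of the monomial becomes one in terms of the generalized
  degree, because \<open>\<parallel>n\<parallel>\<^sub>1 d\<close> is at least the generalized degree and \<open>ln (2 x) / x\<close> decreases on the
  positive integers.\<close>

theorem character_sum_bound:
  assumes n: "n \<noteq> 0"
  shows "(cmod (\<Sum>\<alpha>\<in>S. sgn (monomial_char n \<alpha>)))\<^sup>2 \<le> real M ^ 2 * (24 * (l1_norm n * height_D \<xi>))"
proof -
  let ?\<gamma> = "monomial_char n" and ?l = "real (l1_norm n)" and ?D = "generalized_degree \<xi>"
  define d where "d = alg_degree (?\<gamma> \<xi>)"
  have d: "d \<ge> 1" using alg_degree_monomial_pos[of n] by (simp add: d_def)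
  note eq = equivariant_monomial_char[of n]
  have "(cmod (\<Sum>\<alpha>\<in>S. sgn (?\<gamma> \<alpha>)))\<^sup>2 \<le>
      real M ^ 2 * (24 * (end_height n + (char_height n - end_height n)) + 8 * (ln (2 * real d) / real d))"
  proof (rule unit_vector_sum_bound[OF finite_S _ monomial_char_nonzero d M_def])
    show "M = fibre_size ?\<gamma> * d" using fibre_size(1)[OF eq] by (simp add: d_def)
    show "card {(\<alpha>, \<alpha>')\<in>S \<times> S. ?\<gamma> \<alpha> = ?\<gamma> \<alpha>'} = M * fibre_size ?\<gamma>"
      by (rule card_equal_pairs[OF eq])
  qed (use xi_in_S discriminant_lower_bound sum_log_plus_monomial sum_abs_ln_monomial in auto)
  also have "\<dots> \<le> real M ^ 2 * (24 * (?l * height \<xi>) + 8 * (?l * (ln (2 * real ?D) / ?D)))"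
  proof (intro mult_left_mono add_mono)
    have "ln (2 * real d) / d \<le> ln (2 * real (l1_norm n * d)) / d"
      using d l1_norm_pos[OF n] by (intro divide_right_mono ln_mono) auto
    also have "\<dots> = ?l * (ln (2 * real (l1_norm n * d)) / real (l1_norm n * d))"
      using l1_norm_pos[OF n] by simp
    also have "\<dots> \<le> ?l * (ln (2 * real ?D) / ?D)"
      using generalized_degree_pos generalized_degree_le[OF n]
      by (intro mult_left_mono ln_double_div_antimono) (auto simp: d_def)
    finally show "ln (2 * real d) / real d \<le> ?l * (ln (2 * real ?D) / ?D)" .
  qed (use char_height_le in auto)
  also have "\<dots> = real M ^ 2 * (24 * (?l * height_D \<xi>))"
    by (simp add: height_D_def field_simps)
  finally show ?thesis .
qed

end

section \<open>Characters of the torus\<close>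

definition torus_char :: "int ^ 'n \<Rightarrow> real ^ 'n \<Rightarrow> complex" where
  "torus_char n \<theta> = exp (2 * of_real pi * \<i> * of_real (\<Sum>j\<in>UNIV. of_int (n $ j) * \<theta> $ j))"

lemma torus_char_cis: "torus_char n \<theta> = cis (2 * pi * (\<Sum>j\<in>UNIV. of_int (n $ j) * \<theta> $ j))"
  by (simp add: torus_char_def cis_conv_exp mult_ac)

lemma norm_torus_char [simp]: "cmod (torus_char n \<theta>) = 1"
  by (simp add: torus_char_cis)

lemma torus_char_zero [simp]: "torus_char 0 \<theta> = 1"
  by (simp add: torus_char_def)

lemma torus_char_add: "torus_char (m + n) \<theta> = torus_char m \<theta> * torus_char n \<theta>"
  by (simp add: torus_char_cis cis_mult algebra_simps sum.distrib)

lemma torus_char_continuous [continuous_intros]: "continuous_on A (torus_char n)"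
  unfolding torus_char_def by (intro continuous_intros)

lemma torus_char_periodic: "torus_periodic (torus_char (n :: int ^ 'n))"
  unfolding torus_periodic_def
proof (intro allI)
  fix \<theta> :: "real ^ 'n" and k :: "int ^ 'n"
  have "(\<Sum>j\<in>UNIV. of_int (n $ j) * (\<theta> + (\<chi> j. of_int (k $ j))) $ j) =
      (\<Sum>j\<in>UNIV. of_int (n $ j) * \<theta> $ j) + of_int (\<Sum>j\<in>UNIV. n $ j * k $ j)"
    by (simp add: distrib_left sum.distrib)
  then have "torus_char n (\<theta> + (\<chi> j. of_int (k $ j))) =
      torus_char n \<theta> * cis (2 * pi * of_int (\<Sum>j\<in>UNIV. n $ j * k $ j))"
    by (simp only: torus_char_cis cis_mult distrib_left)
  then show "torus_char n (\<theta> + (\<chi> j. of_int (k $ j))) = torus_char n \<theta>"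
    by (simp only: cis_multiple_2pi[OF Ints_of_int] mult_1_right)
qed

lemma torus_integral_eq:
  assumes "continuous_on UNIV f"
  shows "torus_integral f = integral (cbox 0 1) f"
proof -
  have "integrable lborel (\<lambda>x. indicator (cbox 0 1) x *\<^sub>R f x)"
    using assms by (intro borel_integrable_compact compact_cbox) (auto intro: continuous_on_subset)
  then show ?thesis
    unfolding torus_integral_def by (intro set_borel_integral_eq_integral) (simp add: set_integrable_def)
qed

lemma torus_fourier_eq:
  assumes "continuous_on UNIV f"
  shows "torus_fourier f n = integral (cbox 0 1) (\<lambda>\<theta>. f \<theta> * torus_char (- n) \<theta>)"
proof -
  have "torus_fourier f n = torus_integral (\<lambda>\<theta>. f \<theta> * torus_char (- n) \<theta>)"
    by (simp add: torus_fourier_def torus_char_def sum_negf)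
  then show ?thesis
    using assms by (simp add: torus_integral_eq continuous_on_mult torus_char_continuous)
qed

lemma content_unit_cube: "measure lborel (cbox 0 (1 :: real ^ 'n)) = 1"
  by (subst content_cbox_cart) (auto simp: interval_eq_empty_cart)

lemma integral_cis_interval:
  assumes "m \<noteq> 0"
  shows "(LINT t:{0..1}|lborel. cis (2 * pi * of_int m * t)) = 0"
proof -
  let ?c = "2 * pi * of_int m * \<i>"
  have c: "?c \<noteq> 0" using assms by simp
  have "((\<lambda>t. exp (?c * of_real t)) has_integral (exp (?c * of_real 1) / ?c - exp (?c * of_real 0) / ?c)) {0..1}"
  proof (rule fundamental_theorem_of_calculus)
    fix x :: real
    have "((\<lambda>z. exp (?c * z) / ?c) has_field_derivative exp (?c * of_real x)) (at (of_real x))"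
      using c by (auto intro!: derivative_eq_intros)
    then show "((\<lambda>t. exp (?c * of_real t) / ?c) has_vector_derivative exp (?c * of_real x)) (at x within {0..1})"
      by (rule has_vector_derivative_real_field)
  qed simp
  also have "exp (?c * of_real 1) = 1"
    using cis_multiple_2pi[of "of_int m"] by (simp add: cis_conv_exp mult_ac)
  finally have I: "((\<lambda>t. cis (2 * pi * of_int m * t)) has_integral 0) {0..1}"
    by (simp add: cis_conv_exp mult_ac)
  have "integrable lborel (\<lambda>t. indicator {0..1} t *\<^sub>R cis (2 * pi * of_int m * t))"
    by (intro borel_integrable_compact) (auto intro!: continuous_intros)
  then have "(LINT t:{0..1}|lborel. cis (2 * pi * of_int m * t)) = integral {0..1} (\<lambda>t. cis (2 * pi * of_int m * t))"
    by (intro set_borel_integral_eq_integral) (simp add: set_integrable_def)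
  then show ?thesis using I by (simp add: integral_unique)
qed

text \<open>Lebesgue measure is a product measure and a character is a product of functions of one coordinate each,
  one of which has integral 0 if the character is nontrivial.\<close>

lemma integral_torus_char:
  "integral (cbox 0 1) (torus_char (n :: int ^ 'n)) = (if n = 0 then 1 else 0)"
proof (cases "n = 0")
  case True
  then have "torus_char n = (\<lambda>\<theta>. 1)" by (intro ext) simp
  then show ?thesis using True by (simp add: content_unit_cube)
next
  case False
  then obtain j where j: "n $ j \<noteq> 0" by (auto simp: vec_eq_iff)
  interpret product_sigma_finite "\<lambda>_. lborel :: real measure"
    by unfold_locales
  define \<nu> :: "real ^ 'n" where "\<nu> = (\<chi> j. of_int (n $ j))"
  define h where "h b t = indicator {0..1} t *\<^sub>R cis (2 * pi * (\<nu> \<bullet> b) * t)" for b :: "real ^ 'n" and t :: real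
  have h_int: "integrable lborel (h b)" for b
    unfolding h_def by (intro borel_integrable_compact) (auto intro!: continuous_intros)
  have "integral (cbox 0 1) (torus_char n) = torus_integral (torus_char n)"
    by (simp add: torus_integral_eq torus_char_continuous)
  also have "\<dots> = (LINT \<theta>|distr (\<Pi>\<^sub>M b\<in>Basis. lborel) borel (\<lambda>f. \<Sum>b\<in>Basis. f b *\<^sub>R b).
      indicator (cbox 0 1) \<theta> *\<^sub>R torus_char n \<theta>)"
    unfolding torus_integral_def set_lebesgue_integral_def by (subst lborel_eq) simp
  also have "\<dots> = (LINT f|(\<Pi>\<^sub>M b\<in>Basis. lborel).
      indicator (cbox 0 1) (\<Sum>b\<in>Basis. f b *\<^sub>R b) *\<^sub>R torus_char n (\<Sum>b\<in>Basis. f b *\<^sub>R b))"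
    by (intro integral_distr borel_measurable_scaleR borel_measurable_indicator
        borel_measurable_continuous_onI torus_char_continuous) auto
  also have "\<dots> = (LINT f|(\<Pi>\<^sub>M b\<in>Basis. lborel). (\<Prod>b\<in>Basis. h b (f b)))"
  proof (intro Bochner_Integration.integral_cong refl)
    fix f :: "real ^ 'n \<Rightarrow> real"
    define \<theta> where "\<theta> = (\<Sum>b\<in>Basis. f b *\<^sub>R b)"
    have \<theta>b: "\<theta> \<bullet> b = f b" if "b \<in> Basis" for b
      using that by (simp add: \<theta>_def inner_sum_left inner_Basis if_distrib cong: if_cong)
    have one: "(1 :: real ^ 'n) \<bullet> b = 1" if "b \<in> Basis" for b
      using that by (auto simp: Basis_vec_def inner_axis)
    have ind: "indicator (cbox 0 1) \<theta> = (\<Prod>b\<in>Basis. indicator {0..1} (f b) :: real)"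
      using \<theta>b one by (auto simp: indicator_def mem_box prod.If_cases)
    have "(\<Sum>j\<in>UNIV. of_int (n $ j) * \<theta> $ j) = \<nu> \<bullet> \<theta>"
      by (simp add: \<nu>_def inner_vec_def)
    also have "\<dots> = (\<Sum>b\<in>Basis. (\<nu> \<bullet> b) * (\<theta> \<bullet> b))"
      by (rule euclidean_inner)
    also have "\<dots> = (\<Sum>b\<in>Basis. (\<nu> \<bullet> b) * f b)" using \<theta>b by simp
    finally have "torus_char n \<theta> = (\<Prod>b\<in>Basis. cis (2 * pi * (\<nu> \<bullet> b) * f b))"
      by (simp add: torus_char_cis cis_conv_exp exp_sum[symmetric] sum_distrib_left mult_ac)
    then show "indicator (cbox 0 1) \<theta> *\<^sub>R torus_char n \<theta> = (\<Prod>b\<in>Basis. h b (f b))"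
      unfolding ind h_def by (simp add: scaleR_conv_of_real prod.distrib)
  qed
  also have "\<dots> = (\<Prod>b\<in>Basis. LINT t|lborel. h b t)"
    by (intro product_integral_prod h_int) auto
  also have "\<dots> = 0"
  proof (rule prod_zero)
    show "\<exists>b\<in>Basis. (LINT t|lborel. h b t) = 0"
    proof
      show "axis j 1 \<in> (Basis :: (real ^ 'n) set)" by (simp add: axis_in_Basis_iff)
      have "\<nu> \<bullet> axis j 1 = of_int (n $ j)" by (simp add: \<nu>_def inner_axis)
      then show "(LINT t|lborel. h (axis j 1) t) = 0"
        using integral_cis_interval[OF j] by (simp add: h_def set_lebesgue_integral_def)
    qed
  qed simp
  finally show ?thesis using False by simp
qed

section \<open>Uniqueness of Fourier coefficients and Fourier inversion\<close>

text \<open>A nonnegative trigonometric polynomial whose maximum 1 is attained only at the lattice translates of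
  \<open>a\<close>; its powers concentrate there.\<close>

definition peak :: "real ^ 'n \<Rightarrow> real ^ 'n \<Rightarrow> real" where
  "peak a \<theta> = (\<Prod>j\<in>UNIV. (1 + cos (2 * pi * (\<theta> $ j - a $ j))) / 2)"

lemma peak_continuous [continuous_intros]: "continuous_on A (peak a)"
  unfolding peak_def by (intro continuous_intros) auto

lemma half_one_plus_cos_bounds: "0 \<le> (1 + cos x) / 2" "(1 + cos x) / 2 \<le> 1" for x :: real
proof -
  have "0 \<le> 1 + cos x" using cos_ge_minus_one[of x] by linarith
  then show "0 \<le> (1 + cos x) / 2" by simp
  show "(1 + cos x) / 2 \<le> 1" using cos_le_one[of x] by simp
qed

lemma peak_bounds: "0 \<le> peak a \<theta>" "peak a \<theta> \<le> 1"
  unfolding peak_def by (intro prod_nonneg prod_le_1 ballI conjI half_one_plus_cos_bounds)+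

lemma peak_self: "peak a a = 1"
  by (simp add: peak_def)

lemma peak_less_one:
  assumes a: "a \<in> box 0 1" and \<theta>: "\<theta> \<in> cbox 0 1" and ne: "\<theta> \<noteq> a"
  shows "peak a \<theta> < 1"
proof -
  obtain j where j: "\<theta> $ j \<noteq> a $ j" using ne by (auto simp: vec_eq_iff)
  define x where "x = \<theta> $ j - a $ j"
  have x: "x \<noteq> 0" "\<bar>x\<bar> < 1"
    using a \<theta> j by (auto simp: x_def mem_box_cart abs_if) (smt (verit))+
  have "cos (2 * pi * x) \<noteq> 1"
  proof
    assume "cos (2 * pi * x) = 1"
    then obtain k :: int where "2 * pi * x = of_int k * 2 * pi"
      unfolding cos_one_2pi_int by blast
    then have "x = of_int k" by simp
    then show False using x by (simp flip: of_int_abs)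
  qed
  then have "cos (2 * pi * x) < 1" by (simp only: order.strict_iff_order) simp
  then have c: "(1 + cos (2 * pi * x)) / 2 < 1" by simp
  have "peak a \<theta> = (1 + cos (2 * pi * x)) / 2 * (\<Prod>j\<in>UNIV - {j}. (1 + cos (2 * pi * (\<theta> $ j - a $ j))) / 2)"
    unfolding peak_def x_def by (rule prod.remove) auto
  also have "\<dots> \<le> (1 + cos (2 * pi * x)) / 2 * 1"
    by (intro mult_left_mono prod_le_1 conjI half_one_plus_cos_bounds)
  finally show ?thesis using c by simp
qed

text \<open>Orthogonality of \<open>g\<close> to \<open>T\<close> times every character is stable under multiplying \<open>T\<close> by a
  trigonometric polynomial, which makes it suitable for induction.\<close>

definition annihilates :: "(real ^ 'n \<Rightarrow> complex) \<Rightarrow> (real ^ 'n \<Rightarrow> complex) \<Rightarrow> bool" where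
  "annihilates g T \<longleftrightarrow> continuous_on UNIV T \<and>
     (\<forall>n. integral (cbox 0 1) (\<lambda>\<theta>. g \<theta> * T \<theta> * torus_char n \<theta>) = 0)"

lemma annihilates_cos:
  fixes g :: "real ^ 'n \<Rightarrow> complex"
  assumes g: "continuous_on UNIV g" and T: "annihilates g T"
  shows "annihilates g (\<lambda>\<theta>. T \<theta> * of_real ((1 + cos (2 * pi * (\<theta> $ j - a))) / 2))"
  unfolding annihilates_def
proof (intro conjI allI)
  let ?k = "\<lambda>\<theta>. complex_of_real ((1 + cos (2 * pi * (\<theta> $ j - a))) / 2)"
  have Tc: "continuous_on UNIV T" using T by (simp add: annihilates_def)
  show "continuous_on UNIV (\<lambda>\<theta>. T \<theta> * ?k \<theta>)"
    by (intro continuous_intros Tc) auto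
  fix n
  let ?e = "axis j 1 :: int ^ 'n"
  have ax: "torus_char ?e \<theta> = cis (2 * pi * \<theta> $ j)" "torus_char (- ?e) \<theta> = cis (- (2 * pi * \<theta> $ j))" for \<theta>
    by (simp_all add: torus_char_cis axis_def if_distrib[of of_int] if_distrib[of "\<lambda>x. x * _"] sum_negf
        cong: if_cong)
  define c where "c = cis (- (2 * pi * a))"
  define c' where "c' = cis (2 * pi * a)"
  define I where "I m \<theta> = g \<theta> * T \<theta> * torus_char m \<theta>" for m \<theta>
  have I: "I m integrable_on cbox 0 1" "integral (cbox 0 1) (I m) = 0" for m
  proof -
    show "I m integrable_on cbox 0 1"
      unfolding I_def
      by (intro integrable_continuous continuous_intros continuous_on_subset[OF g]
          continuous_on_subset[OF Tc]) auto
    show "integral (cbox 0 1) (I m) = 0" using T by (simp add: annihilates_def I_def[abs_def])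
  qed
  have "g \<theta> * (T \<theta> * ?k \<theta>) * torus_char n \<theta> =
      (1 / 2) * I n \<theta> + (c / 4) * I (n + ?e) \<theta> + (c' / 4) * I (n - ?e) \<theta>" for \<theta>
  proof -
    have "complex_of_real (cos (2 * pi * (\<theta> $ j - a))) =
        (c * torus_char ?e \<theta> + c' * torus_char (- ?e) \<theta>) / 2"
    proof -
      define y where "y = 2 * pi * (\<theta> $ j - a)"
      have "c * torus_char ?e \<theta> = cis y" "c' * torus_char (- ?e) \<theta> = cis (- y)"
        by (simp_all add: ax c_def c'_def cis_mult y_def algebra_simps)
      then show ?thesis by (simp add: complex_eq_iff flip: y_def)
    qed
    then show ?thesis
      by (simp add: I_def torus_char_add torus_char_add[of n "- ?e", simplified] algebra_simps
          add_divide_distrib)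
  qed
  then have "integral (cbox 0 1) (\<lambda>\<theta>. g \<theta> * (T \<theta> * ?k \<theta>) * torus_char n \<theta>)
    = integral (cbox 0 1) (\<lambda>\<theta>. (1 / 2) * I n \<theta> + (c / 4) * I (n + ?e) \<theta> + (c' / 4) * I (n - ?e) \<theta>)"
    by (simp only:)
  also have "\<dots> = (1 / 2) * integral (cbox 0 1) (I n) + (c / 4) * integral (cbox 0 1) (I (n + ?e))
      + (c' / 4) * integral (cbox 0 1) (I (n - ?e))"
    by (simp add: Henstock_Kurzweil_Integration.integral_add integrable_add integrable_on_mult_right I)
  also have "\<dots> = 0" by (simp add: I)
  finally show "integral (cbox 0 1) (\<lambda>\<theta>. g \<theta> * (T \<theta> * ?k \<theta>) * torus_char n \<theta>) = 0" .
qed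

lemma annihilates_peak_power:
  assumes g: "continuous_on UNIV g" and z: "\<And>n. integral (cbox 0 1) (\<lambda>\<theta>. g \<theta> * torus_char n \<theta>) = 0"
  shows "annihilates g (\<lambda>\<theta>. of_real (peak a \<theta> ^ m))"
proof (induction m)
  case 0
  then show ?case using z by (simp add: annihilates_def)
next
  case (Suc m)
  have "annihilates g (\<lambda>\<theta>. of_real (peak a \<theta> ^ m) *
      (\<Prod>j\<in>J. of_real ((1 + cos (2 * pi * (\<theta> $ j - a $ j))) / 2)))" if "finite J" for J
    using that
  proof (induction J rule: finite_induct)
    case empty
    then show ?case using Suc by simp
  next
    case (insert j J)
    then show ?case using annihilates_cos[OF g insert.IH, of j "a $ j"]
      by (simp add: mult_ac del: of_real_divide of_real_add)
  qed
  from this[of UNIV] show ?case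
    by (simp add: peak_def mult_ac)
qed

text \<open>If \<open>g\<close> did not vanish at \<open>a\<close>, the real part of \<open>g\<close>, rotated to be positive at \<open>a\<close>, would have positive
  integral against a high power of the peak function. Points of the open cube are used because the
  closed cube contains no second translate of \<open>a\<close> where the peak function attains its maximum.\<close>

lemma fourier_uniqueness_interior:
  fixes g :: "real ^ 'n \<Rightarrow> complex"
  assumes g: "continuous_on UNIV g" and z: "\<And>n. integral (cbox 0 1) (\<lambda>\<theta>. g \<theta> * torus_char n \<theta>) = 0"
    and a: "a \<in> box 0 1"
  shows "g a = 0"
proof (rule ccontr)
  assume "g a \<noteq> 0"
  define f where "f \<theta> = Re (cnj (g a) * g \<theta>)" for \<theta>
  have f: "continuous_on A f" for A
    unfolding f_def by (intro continuous_intros continuous_on_subset[OF g]) auto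
  define c where "c = f a"
  have c: "c > 0" using \<open>g a \<noteq> 0\<close>
    by (simp add: c_def f_def mult.commute[of "cnj _"] complex_norm_square[symmetric] del: of_real_power)
  have zero: "integral (cbox 0 1) (\<lambda>\<theta>. f \<theta> * peak a \<theta> ^ m) = 0" for m
  proof -
    have i: "(\<lambda>\<theta>. g \<theta> * of_real (peak a \<theta> ^ m)) integrable_on cbox 0 1"
      by (intro integrable_continuous continuous_intros continuous_on_subset[OF g]) auto
    have "integral (cbox 0 1) (\<lambda>\<theta>. g \<theta> * of_real (peak a \<theta> ^ m)) = 0"
      using annihilates_peak_power[OF g z, of a m] unfolding annihilates_def
      by (metis (no_types, lifting) ext mult.right_neutral torus_char_zero)
    then have "((\<lambda>\<theta>. g \<theta> * of_real (peak a \<theta> ^ m)) has_integral 0) (cbox 0 1)"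
      using i by (metis has_integral_integral)
    then have "((\<lambda>\<theta>. Re (cnj (g a) * (g \<theta> * of_real (peak a \<theta> ^ m)))) has_integral Re (cnj (g a) * 0)) (cbox 0 1)"
      by (intro has_integral_Re has_integral_mult_right)
    moreover have "Re (cnj (g a) * (g \<theta> * of_real (peak a \<theta> ^ m))) = f \<theta> * peak a \<theta> ^ m" for \<theta>
      unfolding f_def by (simp add: algebra_simps)
    ultimately show ?thesis by (simp add: integral_unique)
  qed
  define C where "C = {\<theta>\<in>cbox 0 1. f \<theta> \<le> c / 2}"
  have "closed {\<theta>. f \<theta> \<le> c / 2}" using f[of UNIV] by (intro closed_Collect_le) auto
  then have C: "compact C" unfolding C_def using compact_Int_closed[OF compact_cbox] by (simp add: Collect_conj_eq)
  have "\<exists>r. 0 \<le> r \<and> r < 1 \<and> (\<forall>\<theta>\<in>C. peak a \<theta> \<le> r)"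
  proof (cases "C = {}")
    case False
    then obtain \<theta>0 where \<theta>0: "\<theta>0 \<in> C" "\<And>\<theta>. \<theta> \<in> C \<Longrightarrow> peak a \<theta> \<le> peak a \<theta>0"
      using continuous_attains_sup[OF C _ peak_continuous] by blast
    have "\<theta>0 \<noteq> a" using \<theta>0(1) c by (auto simp: C_def c_def)
    then have "peak a \<theta>0 < 1" using \<theta>0(1) by (intro peak_less_one[OF a]) (auto simp: C_def)
    then show ?thesis using \<theta>0 peak_bounds(1) by blast
  qed (auto intro: exI[of _ 0])
  then obtain r where r: "0 \<le> r" "r < 1" "\<And>\<theta>. \<theta> \<in> C \<Longrightarrow> peak a \<theta> \<le> r" by blast
  have "bounded (f ` cbox 0 1)" by (intro compact_imp_bounded compact_continuous_image f compact_cbox)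
  then obtain B where B: "B > 0" "\<And>\<theta>. \<theta> \<in> cbox 0 1 \<Longrightarrow> \<bar>f \<theta>\<bar> \<le> B"
    by (auto simp: bounded_pos)
  define q where "q = (1 + r) / 2"
  have q: "r < q" "q < 1" "0 < q" using r by (auto simp: q_def)
  define V where "V = box 0 1 \<inter> {\<theta>. c / 2 < f \<theta>} \<inter> {\<theta>. q < peak a \<theta>}"
  have "open V" unfolding V_def
    by (intro open_Int open_box open_Collect_less continuous_intros f)
  moreover have "a \<in> V" using a c q by (auto simp: V_def peak_self c_def)
  ultimately obtain u v where uv: "a \<in> box u v" "cbox u v \<subseteq> V"
    by (meson open_contains_cbox)
  have uv_sub: "cbox u v \<subseteq> cbox 0 1" using uv(2) box_subset_cbox by (auto simp: V_def)
  have content: "measure lborel (cbox u v) > 0" using uv(1) by (intro content_pos_lt) (auto simp: mem_box intro: less_trans)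
  \<comment> \<open>On \<open>C\<close> the integrand is at least \<open>- B r\<^sup>m\<close>, elsewhere it is nonnegative, and near \<open>a\<close> it is at least
    \<open>c q\<^sup>m / 2\<close> with \<open>q > r\<close>.\<close>
  have bound: "measure lborel (cbox u v) * (c / 2 * q ^ m) \<le> B * r ^ m" for m
  proof -
    let ?h = "\<lambda>\<theta>. f \<theta> * peak a \<theta> ^ m + B * r ^ m"
    have hc: "continuous_on A ?h" for A by (intro continuous_intros f)
    have h0: "0 \<le> ?h \<theta>" if \<theta>: "\<theta> \<in> cbox 0 1" for \<theta>
    proof (cases "\<theta> \<in> C")
      case True
      have "- (f \<theta> * peak a \<theta> ^ m) \<le> B * r ^ m"
      proof -
        have "- (f \<theta> * peak a \<theta> ^ m) = (- f \<theta>) * peak a \<theta> ^ m" by simp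
        also have "\<dots> \<le> \<bar>f \<theta>\<bar> * peak a \<theta> ^ m"
          using peak_bounds[of a \<theta>] by (intro mult_right_mono) auto
        also have "\<dots> \<le> B * r ^ m"
          using B \<theta> r True peak_bounds[of a \<theta>] by (intro mult_mono power_mono) auto
        finally show ?thesis .
      qed
      then show ?thesis by simp
    next
      case False
      then have "f \<theta> > 0" using \<theta> c by (auto simp: C_def)
      then show ?thesis using peak_bounds[of a \<theta>] B r by simp
    qed
    have "measure lborel (cbox u v) * (c / 2 * q ^ m) = integral (cbox u v) (\<lambda>\<theta>. c / 2 * q ^ m)"
      by simp
    also have "\<dots> \<le> integral (cbox u v) ?h"
    proof (intro integral_le integrable_continuous hc continuous_on_const)
      fix \<theta> assume "\<theta> \<in> cbox u v"
      then have "c / 2 < f \<theta>" "q < peak a \<theta>" using uv(2) by (auto simp: V_def)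
      then have "c / 2 * q ^ m \<le> f \<theta> * peak a \<theta> ^ m"
        using c q by (intro mult_mono power_mono) auto
      moreover have "0 \<le> B * r ^ m" using B r by simp
      ultimately show "c / 2 * q ^ m \<le> ?h \<theta>" by linarith
    qed
    also have "\<dots> \<le> integral (cbox 0 1) ?h"
      by (intro integral_subset_le uv_sub integrable_continuous hc ballI h0)
    also have "\<dots> = integral (cbox 0 1) (\<lambda>\<theta>. f \<theta> * peak a \<theta> ^ m) + integral (cbox 0 1) (\<lambda>\<theta> :: real ^ 'n. B * r ^ m)"
      by (intro Henstock_Kurzweil_Integration.integral_add integrable_continuous continuous_intros f)
    also have "\<dots> = B * r ^ m" by (simp add: zero content_unit_cube)
    finally show ?thesis .
  qed
  have "measure lborel (cbox u v) * (c / 2) \<le> B * (r / q) ^ m" for m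
    using bound[of m] q by (simp add: power_divide field_simps)
  moreover have "(\<lambda>m. B * (r / q) ^ m) \<longlonglongrightarrow> B * 0"
    using r q by (intro tendsto_intros LIMSEQ_realpow_zero) auto
  ultimately have "measure lborel (cbox u v) * (c / 2) \<le> B * 0"
    by (intro LIMSEQ_le_const[of "\<lambda>m. B * (r / q) ^ m"]) auto
  then show False using content c by (simp add: mult_le_0_iff)
qed

theorem fourier_uniqueness:
  fixes g :: "real ^ 'n \<Rightarrow> complex"
  assumes g: "continuous_on UNIV g" and per: "torus_periodic g"
    and z: "\<And>n. integral (cbox 0 1) (\<lambda>\<theta>. g \<theta> * torus_char n \<theta>) = 0"
  shows "g \<theta> = 0"
proof -
  have ne: "box 0 (1 :: real ^ 'n) \<noteq> {}" by (auto simp: interval_eq_empty_cart not_le)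
  have cube: "g \<theta> = 0" if "\<theta> \<in> cbox 0 1" for \<theta>
  proof (rule continuous_constant_on_closure[of "box 0 1" g])
    show "continuous_on (closure (box 0 1)) g" using g by (rule continuous_on_subset) auto
    show "\<theta> \<in> closure (box 0 1)" using that ne by (simp add: closure_box)
  qed (use fourier_uniqueness_interior[OF g z] in auto)
  define k :: "int ^ 'n" where "k = (\<chi> j. - \<lfloor>\<theta> $ j\<rfloor>)"
  have "\<theta> + (\<chi> j. of_int (k $ j)) \<in> cbox 0 1"
  proof -
    have "0 \<le> x + of_int (- \<lfloor>x\<rfloor>)" for x :: real
      unfolding of_int_minus using of_int_floor_le[of x] by linarith
    moreover have "x + of_int (- \<lfloor>x\<rfloor>) \<le> 1" for x :: real
      unfolding of_int_minus using real_of_int_floor_add_one_gt[of x] by linarith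
    ultimately show ?thesis by (simp add: mem_box_cart k_def)
  qed
  then have "g (\<theta> + (\<chi> j. of_int (k $ j))) = 0" by (rule cube)
  then show ?thesis using per by (simp add: torus_periodic_def)
qed

text \<open>The series converges uniformly, so its sum is continuous and has the same Fourier coefficients as \<open>f\<close>.\<close>

theorem fourier_inversion:
  fixes f :: "real ^ 'n \<Rightarrow> complex"
  assumes f: "continuous_on UNIV f" and per: "torus_periodic f"
    and summ: "(\<lambda>n. cmod (torus_fourier f n)) summable_on UNIV"
  shows "((\<lambda>n. torus_fourier f n * torus_char n \<theta>) has_sum f \<theta>) UNIV"
proof -
  define c where "c = torus_fourier f"
  have abs: "(\<lambda>n. c n * torus_char n \<theta>) summable_on UNIV" for \<theta>
    by (rule abs_summable_summable) (use summ in \<open>simp add: norm_mult c_def\<close>)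
  define G where "G \<theta> = (\<Sum>\<^sub>\<infinity>n. c n * torus_char n \<theta>)" for \<theta>
  have G: "((\<lambda>n. c n * torus_char n \<theta>) has_sum G \<theta>) UNIV" for \<theta>
    unfolding G_def using abs by (rule has_sum_infsum)
  have "uniform_limit UNIV (\<lambda>X \<theta>. \<Sum>n\<in>X. c n * torus_char n \<theta>) G (finite_subsets_at_top UNIV)"
    by (rule Weierstrass_m_test_general'[OF _ G summ]) (simp add: norm_mult c_def)
  then have Gc: "continuous_on UNIV G"
    by (rule uniform_limit_theorem[rotated]) (auto intro!: always_eventually continuous_intros)
  have G_per: "torus_periodic G"
  proof -
    have "torus_periodic (torus_char n)" for n :: "int ^ 'n" by (rule torus_char_periodic)
    then show ?thesis by (simp add: torus_periodic_def G_def)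
  qed
  have coeff: "integral (cbox 0 1) (\<lambda>\<theta>. G \<theta> * torus_char m \<theta>) = c (- m)" for m
  proof -
    define S where "S X \<theta> = (\<Sum>n\<in>X. c n * torus_char n \<theta> * torus_char m \<theta>)" for X \<theta>
    have "uniform_limit (cbox 0 1) S (\<lambda>\<theta>. G \<theta> * torus_char m \<theta>) (finite_subsets_at_top UNIV)"
      unfolding S_def
      by (rule Weierstrass_m_test_general'[OF _ has_sum_cmult_left[OF G] summ])
        (simp add: norm_mult c_def)
    then obtain I J where IJ: "\<And>X. (S X has_integral I X) (cbox 0 1)"
      "((\<lambda>\<theta>. G \<theta> * torus_char m \<theta>) has_integral J) (cbox 0 1)" "(I \<longlongrightarrow> J) (finite_subsets_at_top UNIV)"
      by (rule uniform_limit_integral_cbox) (auto simp: S_def[abs_def] intro!: continuous_intros)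
    have "I X = (\<Sum>n\<in>X. if n = - m then c n else 0)" for X
    proof -
      have "I X = integral (cbox 0 1) (\<lambda>\<theta>. \<Sum>n\<in>X. c n * torus_char (n + m) \<theta>)"
        using IJ(1)[of X] by (simp add: integral_unique S_def[abs_def] torus_char_add mult.assoc)
      also have "\<dots> = (\<Sum>n\<in>X. integral (cbox 0 1) (\<lambda>\<theta>. c n * torus_char (n + m) \<theta>))"
      proof (cases "finite X")
        case True
        then show ?thesis
          by (intro Henstock_Kurzweil_Integration.integral_sum integrable_continuous continuous_intros) auto
      qed simp
      also have "\<dots> = (\<Sum>n\<in>X. if n = - m then c n else 0)"
        by (intro sum.cong refl) (simp add: integral_torus_char eq_neg_iff_add_eq_0)
      finally show ?thesis .
    qed
    then have "\<forall>\<^sub>F X in finite_subsets_at_top UNIV. I X = c (- m)"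
      unfolding eventually_finite_subsets_at_top by (intro exI[of _ "{- m}"]) auto
    then have "(I \<longlongrightarrow> c (- m)) (finite_subsets_at_top UNIV)" by (rule tendsto_eventually)
    then have "J = c (- m)" using IJ(3) tendsto_unique finite_subsets_at_top_neq_bot by blast
    then show ?thesis using IJ(2) by (simp add: integral_unique)
  qed
  have "f \<theta> - G \<theta> = 0"
  proof (rule fourier_uniqueness)
    show "continuous_on UNIV (\<lambda>\<theta>. f \<theta> - G \<theta>)" using f Gc by (intro continuous_intros)
    show "torus_periodic (\<lambda>\<theta>. f \<theta> - G \<theta>)" using per G_per by (simp add: torus_periodic_def)
    fix n
    have "integral (cbox 0 1) (\<lambda>\<theta>. (f \<theta> - G \<theta>) * torus_char n \<theta>) =
        integral (cbox 0 1) (\<lambda>\<theta>. f \<theta> * torus_char n \<theta>) - integral (cbox 0 1) (\<lambda>\<theta>. G \<theta> * torus_char n \<theta>)"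
      unfolding left_diff_distrib
      by (intro Henstock_Kurzweil_Integration.integral_diff integrable_continuous continuous_intros
          continuous_on_subset[OF f] continuous_on_subset[OF Gc]) auto
    also have "\<dots> = 0" using torus_fourier_eq[OF f, of "- n"] by (simp add: coeff c_def)
    finally show "integral (cbox 0 1) (\<lambda>\<theta>. (f \<theta> - G \<theta>) * torus_char n \<theta>) = 0" .
  qed
  then show ?thesis using G[of \<theta>] by (simp add: c_def)
qed

section \<open>The equidistribution estimate\<close>

lemma torus_char_angular_part:
  assumes "\<And>j. \<alpha> $ j \<noteq> 0"
  shows "torus_char n (angular_part \<alpha>) = sgn (monomial_char n \<alpha>)"
proof -
  define r where "r = (\<Prod>j\<in>UNIV. cmod (\<alpha> $ j) powi (n $ j))"
  have r: "r > 0" unfolding r_def using assms by (intro prod_pos) (simp add: zero_less_power_int)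
  have "\<alpha> $ j powi (n $ j) = of_real (cmod (\<alpha> $ j) powi (n $ j)) * cis (of_int (n $ j) * Arg (\<alpha> $ j))" for j
  proof -
    have "\<alpha> $ j = of_real (cmod (\<alpha> $ j)) * cis (Arg (\<alpha> $ j))"
      using rcis_cmod_Arg[of "\<alpha> $ j"] by (simp add: rcis_def)
    then have "\<alpha> $ j powi (n $ j) = (of_real (cmod (\<alpha> $ j)) * cis (Arg (\<alpha> $ j))) powi (n $ j)"
      by (simp only:)
    then show ?thesis by (simp only: power_int_mult_distrib cis_power_int of_real_power_int)
  qed
  then have "monomial_char n \<alpha> = of_real r * (\<Prod>j\<in>UNIV. cis (of_int (n $ j) * Arg (\<alpha> $ j)))"
    by (simp add: monomial_char_def r_def prod.distrib)
  also have "(\<Prod>j\<in>UNIV. cis (of_int (n $ j) * Arg (\<alpha> $ j))) = torus_char n (angular_part \<alpha>)"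
    by (simp add: torus_char_cis angular_part_def cis_conv_exp exp_sum[symmetric] sum_distrib_left mult_ac)
  finally have "monomial_char n \<alpha> = of_real r * torus_char n (angular_part \<alpha>)" .
  then have "sgn (monomial_char n \<alpha>) = sgn (torus_char n (angular_part \<alpha>))"
    using r by (simp add: sgn_mult sgn_of_real)
  then show ?thesis by (simp add: torus_char_cis)
qed

lemma has_sum_finite_sum:
  fixes f :: "'a \<Rightarrow> 'b \<Rightarrow> complex"
  assumes "finite A" "\<And>a. a \<in> A \<Longrightarrow> (f a has_sum s a) B"
  shows "((\<lambda>x. \<Sum>a\<in>A. f a x) has_sum (\<Sum>a\<in>A. s a)) B"
  using assms by (induction A rule: finite_induct) (auto intro: has_sum_add has_sum_0)

lemma concave_average_le:
  fixes \<omega> :: "real \<Rightarrow> real"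
  assumes \<omega>: "concave_on {0..} \<omega>" and S: "finite S" "S \<noteq> {}" and f: "\<And>i. i \<in> S \<Longrightarrow> f i \<ge> 0"
  shows "(\<Sum>i\<in>S. \<omega> (f i)) / card S \<le> \<omega> ((\<Sum>i\<in>S. f i) / card S)"
proof -
  have c: "real (card S) > 0" using S by (simp add: card_gt_0_iff)
  have "- \<omega> (\<Sum>i\<in>S. (1 / card S) *\<^sub>R f i) \<le> (\<Sum>i\<in>S. (1 / card S) * - \<omega> (f i))"
    using c \<omega> f S by (intro convex_on_sum[of S "{0..}" "\<lambda>x. - \<omega> x"]) (auto simp: concave_on_def)
  then show ?thesis by (simp add: sum_negf flip: sum_divide_distrib)
qed

lemma summable_of_infsum_ennreal_finite:
  fixes w :: "'a \<Rightarrow> real"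
  assumes w: "\<And>x. x \<in> A \<Longrightarrow> w x \<ge> 0" and B: "(\<Sum>\<^sub>\<infinity>x\<in>A. ennreal (w x)) = ennreal B" "B \<ge> 0"
  shows "w summable_on A" "infsum w A \<le> B"
proof -
  have le: "sum w X \<le> B" if X: "finite X" "X \<subseteq> A" for X
  proof -
    have "ennreal (sum w X) = (\<Sum>x\<in>X. ennreal (w x))"
      using w X by (intro sum_ennreal[symmetric]) auto
    also have "\<dots> \<le> (\<Sum>\<^sub>\<infinity>x\<in>A. ennreal (w x))"
      using X by (subst nonneg_infsum_complete) (auto intro!: SUP_upper)
    finally show ?thesis using B by simp
  qed
  show "w summable_on A"
    by (rule nonneg_bdd_above_summable_on) (use w le in \<open>auto simp: bdd_above_def\<close>)
  then show "infsum w A \<le> B" by (rule infsum_le_finite_sums) (use le in auto)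
qed

context galois_units
begin

lemma sum_norm_radial_part: "(\<Sum>\<alpha>\<in>S. norm (radial_part \<alpha>)) \<le> real M * (2 * height \<xi>)"
proof -
  have "(\<Sum>\<alpha>\<in>S. norm (radial_part \<alpha>)) \<le> (\<Sum>\<alpha>\<in>S. \<Sum>j\<in>UNIV. \<bar>ln (cmod (\<alpha> $ j))\<bar>)"
    by (intro sum_mono order.trans[OF norm_le_l1_cart]) (simp add: radial_part_def)
  also have "\<dots> = (\<Sum>j\<in>UNIV. \<Sum>\<alpha>\<in>S. \<bar>ln (cmod (\<alpha> $ j))\<bar>)" by (rule sum.swap)
  also have "\<dots> \<le> (\<Sum>j\<in>UNIV. 2 * real M * weil_height (\<xi> $ j))"
    by (intro sum_mono sum_abs_ln_orbit)
  also have "\<dots> = real M * (2 * height \<xi>)"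
    by (simp add: height_def sum_distrib_left mult_ac)
  finally show ?thesis .
qed

lemma average_radial_modulus:
  assumes nonneg: "\<And>x. x \<ge> 0 \<Longrightarrow> \<omega> x \<ge> (0 :: real)" and mono: "mono_on {0..} \<omega>"
    and concave: "concave_on {0..} \<omega>"
  shows "(\<Sum>\<alpha>\<in>S. \<omega> (norm (radial_part \<alpha>))) / M \<le> \<omega> (2 * height \<xi>)"
proof -
  have "(\<Sum>\<alpha>\<in>S. \<omega> (norm (radial_part \<alpha>))) / M \<le> \<omega> ((\<Sum>\<alpha>\<in>S. norm (radial_part \<alpha>)) / M)"
    unfolding M_def using finite_S xi_in_S by (intro concave_average_le[OF concave]) auto
  also have "\<dots> \<le> \<omega> (2 * height \<xi>)"
    using sum_norm_radial_part M_pos height_nonneg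
    by (intro mono_onD[OF mono]) (auto simp: field_simps sum_nonneg)
  finally show ?thesis .
qed

text \<open>With \<open>X = 1 / (24 h\<^sub>D(\<xi>))\<close>, the trivial bound 1 is good enough when \<open>\<parallel>n\<parallel>\<^sub>1 \<ge> X\<close>, as \<open>H\<close> is monotone.
  Otherwise \<open>character_sum_bound\<close> gives the square root of \<open>\<parallel>n\<parallel>\<^sub>1 / X\<close>, and \<open>H\<close> grows at most like the
  square root.\<close>

lemma average_character_bound:
  fixes H :: "real \<Rightarrow> real"
  assumes H_pos: "\<And>x. x > 0 \<Longrightarrow> H x > 0" and H_mono: "mono_on {0<..} H"
    and H_sqrt: "antimono_on {0<..} (\<lambda>x. H x / sqrt x)" and n: "n \<noteq> 0"
  shows "cmod ((\<Sum>\<alpha>\<in>S. torus_char n (angular_part \<alpha>)) / M) \<le> H (l1_norm n) / H (inverse (24 * height_D \<xi>))"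
proof -
  define l where "l = real (l1_norm n)"
  define X where "X = inverse (24 * height_D \<xi>)"
  have l: "l > 0" using l1_norm_pos[OF n] by (simp add: l_def)
  have X: "X > 0" using height_D_pos by (simp add: X_def)
  have HX: "H X > 0" "H l > 0" using H_pos X l by auto
  have M: "real M > 0" using M_pos by simp
  have sum_eq: "(\<Sum>\<alpha>\<in>S. torus_char n (angular_part \<alpha>)) = (\<Sum>\<alpha>\<in>S. sgn (monomial_char n \<alpha>))"
    using S_nonzero by (intro sum.cong refl torus_char_angular_part) auto
  show ?thesis
  proof (cases "X \<le> l")
    case True
    have "cmod (\<Sum>\<alpha>\<in>S. torus_char n (angular_part \<alpha>)) \<le> (\<Sum>\<alpha>\<in>S. 1)"
      by (intro order.trans[OF norm_sum] sum_mono) simp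
    then have "cmod ((\<Sum>\<alpha>\<in>S. torus_char n (angular_part \<alpha>)) / M) \<le> 1"
      using M by (simp add: norm_divide M_def)
    also have "1 \<le> H l / H X" using mono_onD[OF H_mono, of X l] X l True HX by simp
    finally show ?thesis by (simp add: l_def X_def)
  next
    case False
    have "(cmod (\<Sum>\<alpha>\<in>S. torus_char n (angular_part \<alpha>)))\<^sup>2 \<le> real M ^ 2 * (24 * (l * height_D \<xi>))"
      unfolding sum_eq l_def by (rule character_sum_bound[OF n])
    also have "24 * (l * height_D \<xi>) = l / X" by (simp add: X_def field_simps)
    finally have "cmod (\<Sum>\<alpha>\<in>S. torus_char n (angular_part \<alpha>)) \<le> sqrt (real M ^ 2 * (l / X))"
      by (rule real_le_rsqrt)
    also have "\<dots> = M * (sqrt l / sqrt X)" by (simp add: real_sqrt_mult real_sqrt_divide)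
    finally have "cmod ((\<Sum>\<alpha>\<in>S. torus_char n (angular_part \<alpha>)) / M) \<le> sqrt l / sqrt X"
      using M by (simp add: norm_divide field_simps)
    also have "\<dots> \<le> H l / H X"
    proof -
      have "H X / sqrt X \<le> H l / sqrt l"
        using monotone_onD[OF H_sqrt, of l X] X l False by simp
      then show ?thesis using X l HX by (simp add: field_simps)
    qed
    finally show ?thesis by (simp add: l_def X_def)
  qed
qed

lemma equidist_error_split:
  assumes "\<And>\<theta> s. cmod (F \<theta> s - F \<theta> 0) \<le> \<omega> (norm s)"
  shows "equidist_error F \<xi> \<le> (\<Sum>\<alpha>\<in>S. \<omega> (norm (radial_part \<alpha>))) / M
    + cmod ((\<Sum>\<alpha>\<in>S. F (angular_part \<alpha>) 0) / M - torus_integral (\<lambda>\<theta>. F \<theta> 0))"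
proof -
  let ?d = "\<lambda>\<alpha>. F (angular_part \<alpha>) (radial_part \<alpha>) - F (angular_part \<alpha>) 0"
  let ?I = "torus_integral (\<lambda>\<theta>. F \<theta> 0)"
  have "(\<Sum>\<alpha>\<in>S. F (angular_part \<alpha>) (radial_part \<alpha>)) / M - ?I =
      (\<Sum>\<alpha>\<in>S. ?d \<alpha>) / M + ((\<Sum>\<alpha>\<in>S. F (angular_part \<alpha>) 0) / M - ?I)"
    by (simp add: sum_subtractf diff_divide_distrib)
  then have "equidist_error F \<xi> = cmod ((\<Sum>\<alpha>\<in>S. ?d \<alpha>) / M + ((\<Sum>\<alpha>\<in>S. F (angular_part \<alpha>) 0) / M - ?I))"
    unfolding equidist_error_def S_def[symmetric] M_def[symmetric] by (rule arg_cong)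
  also have "\<dots> \<le> cmod ((\<Sum>\<alpha>\<in>S. ?d \<alpha>) / M) + cmod ((\<Sum>\<alpha>\<in>S. F (angular_part \<alpha>) 0) / M - ?I)"
    by (rule norm_triangle_ineq)
  also have "cmod ((\<Sum>\<alpha>\<in>S. ?d \<alpha>) / M) = cmod (\<Sum>\<alpha>\<in>S. ?d \<alpha>) / M" by (simp add: norm_divide)
  also have "\<dots> \<le> (\<Sum>\<alpha>\<in>S. \<omega> (norm (radial_part \<alpha>))) / M"
    using assms by (intro divide_right_mono order.trans[OF norm_sum] sum_mono) auto
  finally show ?thesis by simp
qed

text \<open>Averaging the Fourier series over the orbit, the term \<open>n = 0\<close> gives exactly the torus integral, and the
  other terms are bounded one by one.\<close>

lemma angular_error_bound:
  fixes f :: "real ^ 'n \<Rightarrow> complex" and H :: "real \<Rightarrow> real"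
  assumes f: "continuous_on UNIV f" "torus_periodic f"
    and H_pos: "\<And>x. x > 0 \<Longrightarrow> H x > 0" and H_mono: "mono_on {0<..} H"
    and H_sqrt: "antimono_on {0<..} (\<lambda>x. H x / sqrt x)"
    and summ: "(\<lambda>n. cmod (torus_fourier f n) * H (l1_norm n)) summable_on - {0}"
  shows "cmod ((\<Sum>\<alpha>\<in>S. f (angular_part \<alpha>)) / M - torus_integral f)
    \<le> (\<Sum>\<^sub>\<infinity>n\<in>- {0}. cmod (torus_fourier f n) * H (l1_norm n)) / H (inverse (24 * height_D \<xi>))"
proof -
  define c where "c = torus_fourier f"
  define A where "A n = (\<Sum>\<alpha>\<in>S. torus_char n (angular_part \<alpha>)) / M" for n
  define X where "X = inverse (24 * height_D \<xi>)"
  have "(\<lambda>n. cmod (c n) * H (l1_norm n) * inverse (H 1)) summable_on - {0}"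
    using summ unfolding c_def by (rule summable_on_cmult_left)
  then have "(\<lambda>n. cmod (c n)) summable_on - {0}"
  proof (rule summable_on_comparison_test)
    fix n :: "int ^ 'n" assume "n \<in> - {0}"
    then have "1 \<le> real (l1_norm n)" using l1_norm_pos[of n] by simp
    then have "1 \<le> H (l1_norm n) * inverse (H 1)"
      using mono_onD[OF H_mono, of 1 "l1_norm n"] H_pos[of 1] by (simp add: field_simps)
    then have "cmod (c n) * 1 \<le> cmod (c n) * (H (l1_norm n) * inverse (H 1))"
      by (intro mult_left_mono) auto
    then show "cmod (c n) \<le> cmod (c n) * H (l1_norm n) * inverse (H 1)" by (simp add: mult.assoc)
  qed simp
  then have "(\<lambda>n. cmod (c n)) summable_on insert 0 (- {0})"
    by (simp only: summable_on_insert_iff)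
  moreover have "insert 0 (- {0}) = (UNIV :: (int ^ 'n) set)" by auto
  ultimately have abs: "(\<lambda>n. cmod (torus_fourier f n)) summable_on UNIV"
    by (simp only: c_def)
  have "((\<lambda>n. \<Sum>\<alpha>\<in>S. c n * torus_char n (angular_part \<alpha>)) has_sum (\<Sum>\<alpha>\<in>S. f (angular_part \<alpha>))) UNIV"
    unfolding c_def by (intro has_sum_finite_sum finite_S fourier_inversion f abs)
  then have "((\<lambda>n. (\<Sum>\<alpha>\<in>S. c n * torus_char n (angular_part \<alpha>)) * inverse (of_nat M))
      has_sum (\<Sum>\<alpha>\<in>S. f (angular_part \<alpha>)) * inverse (of_nat M)) UNIV"
    by (rule has_sum_cmult_left)
  then have total: "((\<lambda>n. c n * A n) has_sum (\<Sum>\<alpha>\<in>S. f (angular_part \<alpha>)) / M) UNIV"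
    by (simp add: A_def divide_inverse mult.assoc flip: sum_distrib_left)
  have A0: "A 0 = 1" using M_pos by (simp add: A_def M_def)
  have "torus_fourier f 0 = torus_integral f" by (simp add: torus_fourier_def)
  then have "((\<lambda>n. c n * A n) has_sum torus_integral f) {0}"
    by (intro has_sum_finiteI) (auto simp: A0 c_def)
  then have "((\<lambda>n. c n * A n) has_sum (\<Sum>\<alpha>\<in>S. f (angular_part \<alpha>)) / M - torus_integral f) (UNIV - {0})"
    using total by (intro has_sum_Diff) auto
  then have diff: "((\<lambda>n. c n * A n) has_sum (\<Sum>\<alpha>\<in>S. f (angular_part \<alpha>)) / M - torus_integral f) (- {0})"
    by (simp add: Compl_eq_Diff_UNIV)
  have "((\<lambda>n. cmod (c n) * H (l1_norm n) * inverse (H X)) has_sum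
      (\<Sum>\<^sub>\<infinity>n\<in>- {0}. cmod (c n) * H (l1_norm n)) * inverse (H X)) (- {0})"
    using summ unfolding c_def by (intro has_sum_cmult_left has_sum_infsum)
  then have "cmod ((\<Sum>\<alpha>\<in>S. f (angular_part \<alpha>)) / M - torus_integral f)
      \<le> (\<Sum>\<^sub>\<infinity>n\<in>- {0}. cmod (c n) * H (l1_norm n)) * inverse (H X)"
  proof (rule norm_infsum_le[OF diff])
    fix n :: "int ^ 'n" assume "n \<in> - {0}"
    then have "cmod (A n) \<le> H (l1_norm n) / H X"
      unfolding A_def X_def by (intro average_character_bound H_pos H_mono H_sqrt) auto
    then have "cmod (c n) * cmod (A n) \<le> cmod (c n) * (H (l1_norm n) / H X)"
      by (intro mult_left_mono) auto
    then show "cmod (c n * A n) \<le> cmod (c n) * H (l1_norm n) * inverse (H X)"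
      by (simp add: norm_mult divide_inverse mult.assoc)
  qed
  then show ?thesis unfolding c_def X_def divide_inverse .
qed

end

theorem theorem5:
  fixes \<omega> H :: "real \<Rightarrow> real"
    and F :: "real ^ 'n \<Rightarrow> real ^ 'n \<Rightarrow> complex"
    and \<xi> :: "complex ^ 'n"
  assumes omega_nonneg: "\<And>x. x \<ge> 0 \<Longrightarrow> \<omega> x \<ge> 0"
    and omega_mono: "mono_on {0..} \<omega>"
    and omega_concave: "concave_on {0..} \<omega>"
    and omega_lim: "(\<omega> \<longlongrightarrow> 0) (at_right 0)"
    and F_periodic: "\<And>s. torus_periodic (\<lambda>\<theta>. F \<theta> s)"
    and F_continuous: "continuous_on UNIV (\<lambda>(\<theta>, s). F \<theta> s)"
    and F_omega: "\<And>\<theta> s. cmod (F \<theta> s - F \<theta> 0) \<le> \<omega> (norm s)"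
    and H_pos: "\<And>x. x > 0 \<Longrightarrow> H x > 0"
    and H_mono: "mono_on {0<..} H"
    and H_lim: "filterlim H at_top at_top"
    and H_sqrt: "antimono_on {0<..} (\<lambda>x. H x / sqrt x)"
    and xi_algebraic: "\<And>j. algebraic (\<xi> $ j)"
    and xi_nonzero: "\<And>j. \<xi> $ j \<noteq> 0"
  shows "ennreal (equidist_error F \<xi>)
    \<le> ennreal (\<omega> (2 * height \<xi>)) + C2_const F H / ennreal (H (inverse (24 * height_D \<xi>)))"
proof -
  interpret galois_units \<xi>
    by unfold_locales (fact xi_algebraic, fact xi_nonzero)
  define f where "f \<theta> = F \<theta> 0" for \<theta>
  define HX where "HX = H (inverse (24 * height_D \<xi>))"
  have HX: "HX > 0" unfolding HX_def using height_D_pos by (intro H_pos) simp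
  show ?thesis
  proof (cases "C2_const F H")
    case top
    then show ?thesis by (simp add: ennreal_top_divide)
  next
    case (real B)
    have "continuous_on UNIV (\<lambda>\<theta>. (\<lambda>(\<theta>, s). F \<theta> s) (\<theta>, 0))"
      by (rule continuous_on_compose2[OF F_continuous]) (auto intro!: continuous_intros)
    then have f: "continuous_on UNIV f" "torus_periodic f"
      using F_periodic[of 0] by (simp_all add: f_def[abs_def])
    define w where "w n = cmod (torus_fourier f n) * H (l1_norm n)" for n
    have w: "w n \<ge> 0" if "n \<in> - {0}" for n
      using H_pos[of "l1_norm n"] l1_norm_pos[of n] that by (simp add: w_def)
    have "(\<Sum>\<^sub>\<infinity>n\<in>- {0}. ennreal (w n)) = ennreal B"
      using real by (simp add: C2_const_def w_def f_def[abs_def])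
    note W = summable_of_infsum_ennreal_finite[OF w this real(1)]
    have "cmod ((\<Sum>\<alpha>\<in>S. f (angular_part \<alpha>)) / M - torus_integral f) \<le> infsum w (- {0}) / HX"
      using W(1) unfolding w_def HX_def by (intro angular_error_bound f H_pos H_mono H_sqrt)
    also have "\<dots> \<le> B / HX" using W(2) HX by (intro divide_right_mono) auto
    finally have "equidist_error F \<xi> \<le> \<omega> (2 * height \<xi>) + B / HX"
      using equidist_error_split[of F \<omega>, OF F_omega]
        average_radial_modulus[OF omega_nonneg omega_mono omega_concave]
      unfolding f_def by linarith
    then have "ennreal (equidist_error F \<xi>) \<le> ennreal (\<omega> (2 * height \<xi>) + B / HX)"
      by (rule ennreal_leI)
    also have "\<dots> = ennreal (\<omega> (2 * height \<xi>)) + ennreal B / ennreal HX"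
      using omega_nonneg height_nonneg real(1) HX by (simp add: ennreal_plus divide_ennreal)
    finally show ?thesis using real by (simp add: HX_def)
  qed
qed

end
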